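(* Let $d \geq 2$. For integers $1 \le k \le n$ and $m \ge 1$, let $\mathbf{I^d}(m,k,n)$ denote the maximum, over all sets $\mathcal{H}_R$ of $k$ red hyperplanes and $\mathcal{H}_B$ of $n-k$ blue hyperplanes in $\mathbb{E}^d$ (with $\mathcal{H}_R \cap \mathcal{H}_B = \emptyset$) and all sets $\mathcal{P}$ of $m$ vertices of the combined arrangement $\mathcal{H}_R \cup \mathcal{H}_B$, of the number of incident pairs $(P,H)$ with $P \in \mathcal{P}$, $H \in \mathcal{H}_R$. If $m = \Omega(n^{d-2})$, then \[\mathbf{I^d}(m,k,n) = \Theta_d\left(m^{2/3}k^{2/3}n^{(d-2)/3} + kn^{d-2} + m\right).\]
   Context: A vertex of an arrangement of hyperplanes in $\mathbb{E}^d$ is a point that is the unique common point of some subset of the hyperplanes. The subscript $d$ in $\Theta_d$ indicates that the implied constants depend only on $d$ (and on the constant implicit in the hypothesis $m=\Omega(n^{d-2})$).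
   Formalization: The lower bound is claimed only when m = O(k n^{d-1}), its constant depending also on that implicit constant: without this it fails (d=2, k=1, n lines in general position, m = C(n,2)). The maximum is assumed to be over a non-empty family. *)

theory Defs
  imports "HOL-Analysis.Analysis"
begin

definition hyperplane :: "'a::euclidean_space set \<Rightarrow> bool" where
  "hyperplane H \<longleftrightarrow> (\<exists>a b. a \<noteq> 0 \<and> H = {x. a \<bullet> x = b})"

definition arrangement_vertices :: "'a::euclidean_space set set \<Rightarrow> 'a set" where
  "arrangement_vertices \<H> = {p. \<exists>S\<subseteq>\<H>. \<Inter>S = {p}}"

definition incidences :: "'a set \<Rightarrow> 'a set set \<Rightarrow> ('a \<times> 'a set) set" where
  "incidences P \<H> = {(p, H). p \<in> P \<and> H \<in> \<H> \<and> p \<in> H}"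

definition bichromatic_configuration ::
  "nat \<Rightarrow> nat \<Rightarrow> nat \<Rightarrow> 'a::euclidean_space set set \<Rightarrow> 'a set set \<Rightarrow> 'a set \<Rightarrow> bool" where
  "bichromatic_configuration m k n \<R> \<B> P \<longleftrightarrow>
     finite \<R> \<and> card \<R> = k \<and> (\<forall>H\<in>\<R>. hyperplane H) \<and>
     finite \<B> \<and> card \<B> = n - k \<and> (\<forall>H\<in>\<B>. hyperplane H) \<and>
     \<R> \<inter> \<B> = {} \<and>
     finite P \<and> card P = m \<and> P \<subseteq> arrangement_vertices (\<R> \<union> \<B>)"

definition red_incidence_counts :: "'a::euclidean_space itself \<Rightarrow> nat \<Rightarrow> nat \<Rightarrow> nat \<Rightarrow> nat set" where
  "red_incidence_counts _ m k n =
     {card (incidences P \<R>) | (\<R> :: 'a set set) \<B> P. bichromatic_configuration m k n \<R> \<B> P}"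

text \<open>
  The type argument carries the dimension: the ambient space is \<open>'a\<close>, a Euclidean space of
  dimension \<open>DIM('a)\<close>. If no arrangement of \<open>n\<close> hyperplanes has \<open>m\<close> vertices, the maximum is
  taken over the empty set and is meaningless, so statements about it must require
  \<^term>\<open>red_incidence_counts TYPE('a::euclidean_space) m k n \<noteq> {}\<close>.
\<close>

definition max_red_incidences :: "'a::euclidean_space itself \<Rightarrow> nat \<Rightarrow> nat \<Rightarrow> nat \<Rightarrow> nat" where
  "max_red_incidences T m k n = Max (red_incidence_counts T m k n)"

definition incidence_bound :: "nat \<Rightarrow> nat \<Rightarrow> nat \<Rightarrow> nat \<Rightarrow> real" where
  "incidence_bound d m k n =
     real m powr (2/3) * real k powr (2/3) * real n powr ((real d - 2) / 3)
     + real k * real n ^ (d - 2) + real m"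

text \<open>
  A hyperplane of the arrangement contains at most \<open>O(n\<^sup>d\<^sup>-\<^sup>1)\<close> of its vertices, so the number of
  red incidences never exceeds \<open>O(k n\<^sup>d\<^sup>-\<^sup>1)\<close>. Since the bound contains the summand \<open>m\<close>, it can be
  attained up to a constant only by parameters with \<open>m = O(k n\<^sup>d\<^sup>-\<^sup>1)\<close>; for \<open>d = 2\<close> and \<open>k = 1\<close>,
  for example, there are at most \<open>n - 1\<close> incidences, while \<open>m\<close> can be of order \<open>n\<^sup>2\<close>. This is
  the reason for the constant \<open>K\<close> in lower bounds.
\<close>

end

theory Submission
  imports Defs
begin

text \<open>
  Upper bound. Every vertex \<open>p\<close> is assigned to a plane that is the intersection of at most \<open>d - 2\<close>
  hyperplanes through \<open>p\<close> and in which a constant proportion of the red hyperplanes through \<open>p\<close>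
  induce distinct lines. Such a plane exists by \<open>d - 2\<close> applications of a weak Dirac theorem to the
  normal vectors at \<open>p\<close>: among \<open>r\<close> non-collinear points one lies on \<open>\<Omega>(r)\<close> connecting lines. The
  Szemeredi--Trotter bound is then summed over the \<open>O(n\<^sup>d\<^sup>-\<^sup>2)\<close> planes.

  Lower bound. If \<open>m = \<Omega>(n\<^sup>d)\<close>, recolouring an arbitrary configuration is enough. Otherwise the
  vertices are taken from an axis-parallel grid, and each of the three summands is reached by its own
  choice of red hyperplanes: \<open>y = a x\<close> with the points on \<open>x = y = 0\<close> for \<open>k n\<^sup>d\<^sup>-\<^sup>2\<close>, \<open>x = i\<close> for
  \<open>m\<close>, and the Szemeredi--Trotter grid \<open>y = a x + b\<close> for the mixed term.
\<close>

section \<open>Non-crossing straight-line graphs\<close>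

text \<open>The obstacle for d > 2 is degeneracy. Hyperplanes through a vertex may share large
  flats, a generic plane contains no vertices, and a projection to a plane does not turn hyperplanes
  into lines. Hence the planes have to be flats of the arrangement itself, and the red hyperplanes
  must not collapse to a few lines in the plane chosen for \<open>p\<close>. The price is a factor
  16000000 for each of the d - 2 reductions; it stems from a split of joining lines at 40000 points,
  and no constant is optimised.

  The Szemeredi-Trotter bound is used twice: for the weak Dirac theorem, which concerns the normal
  vectors at one vertex, and then inside the planes.

  All planar arguments assume that the points have pairwise different first coordinates, which a
  generic linear map achieves. No line through two points is then vertical, a line is a pair of
  slope and intercept, edges run from left to right, and the topology of drawings reduces to
  comparing affine functions on intervals.\<close>

type_synonym point = "real \<times> real"
type_synonym segment = "point \<times> point"

definition slope :: "segment \<Rightarrow> real" where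
  "slope e = (snd (snd e) - snd (fst e)) / (fst (snd e) - fst (fst e))"

definition height :: "segment \<Rightarrow> real \<Rightarrow> real" where
  "height e x = snd (fst e) + slope e * (x - fst (fst e))"

definition over :: "segment \<Rightarrow> real \<Rightarrow> bool" where
  "over e x \<longleftrightarrow> fst (fst e) < x \<and> x < fst (snd e)"

definition crossing :: "segment \<Rightarrow> segment \<Rightarrow> bool" where
  "crossing e f \<longleftrightarrow> e \<noteq> f \<and> (\<exists>x. over e x \<and> over f x \<and> height e x = height f x)"

lemma finite_min_exists:
  fixes h :: "'b \<Rightarrow> real"
  assumes "finite S" "S \<noteq> {}" 
  shows "\<exists>x\<in>S. \<forall>y\<in>S. h x \<le> h y"
  using arg_min_if_finite(1)[OF assms, of h] arg_min_least[OF assms, of _ h] by metis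

lemma height_left [simp]: "height e (fst (fst e)) = snd (fst e)"
  by (simp add: height_def)

lemma height_right: "fst (fst e) < fst (snd e) \<Longrightarrow> height e (fst (snd e)) = snd (snd e)"
  by (simp add: height_def slope_def)

text \<open>By the intermediate value theorem the order at \<open>u\<close> persists to the left.
  The conclusion is weak because nothing is assumed at \<open>l\<close>, where the two edges may
  meet.\<close>

lemma height_le_left:
  assumes nc: "\<And>z. l < z \<Longrightarrow> z < u \<Longrightarrow> height e z \<noteq> height f z"
    and "height e u < height f u" "l \<le> x" "x \<le> u"
  shows "height e x \<le> height f x"
proof (rule ccontr)
  assume "\<not> height e x \<le> height f x"
  then have neg: "height f x - height e x < 0" and pos: "0 < height f u - height e u"
    using assms(2) by auto
  have "continuous_on {x..u} (\<lambda>z. height f z - height e z)"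
    unfolding height_def by (intro continuous_intros)
  then obtain z where z: "x \<le> z" "z \<le> u" "height f z - height e z = 0"
    using IVT'[of "\<lambda>z. height f z - height e z" x 0 u] neg pos assms(4) by auto
  then have "z \<noteq> x" "z \<noteq> u" using neg pos by auto
  then show False using nc[of z] z assms(3) by auto
qed

text \<open>Crossings are allowed here and are excluded only in a later context, since the crossing
  inequality is about arbitrary drawings and their subgraphs. The condition \<open>no_vertex\<close>
  keeps vertices off the interior of edges; this is what prevents collinear edges from
  overlapping.\<close>

locale plane_graph =
  fixes V :: "point set" and E :: "segment set"
  assumes finite_V: "finite V"
    and inj_x: "inj_on fst V"
    and E_sub: "E \<subseteq> V \<times> V"
    and left_right: "e \<in> E \<Longrightarrow> fst (fst e) < fst (snd e)"
    and no_vertex: "e \<in> E \<Longrightarrow> v \<in> V \<Longrightarrow> over e (fst v) \<Longrightarrow> height e (fst v) \<noteq> snd v"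
begin

lemma finite_E: "finite E"
  using E_sub finite_V finite_subset by blast

lemma ends: "e \<in> E \<Longrightarrow> fst e \<in> V" "e \<in> E \<Longrightarrow> snd e \<in> V"
  using E_sub by auto

lemma eqI_x: "v \<in> V \<Longrightarrow> w \<in> V \<Longrightarrow> fst v = fst w \<Longrightarrow> v = w"
  using inj_x by (auto dest: inj_onD)

text \<open>If the right ends differed, the nearer one would be a vertex in the interior of the
  longer edge.\<close>

lemma same_left_same_slope:
  assumes "e \<in> E" "f \<in> E" "fst e = fst f" "slope e = slope f"
  shows "e = f"
proof -
  have h: "height e x = height f x" for x
    using assms(3,4) by (simp add: height_def)
  have "\<not> fst (snd e) < fst (snd f)"
  proof
    assume "fst (snd e) < fst (snd f)"
    then have "over f (fst (snd e))"
      using left_right[OF assms(1)] assms(3) by (simp add: over_def)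
    then show False
      using no_vertex[OF assms(2) ends(2)[OF assms(1)]] height_right[OF left_right[OF assms(1)]] h
      by simp
  qed
  moreover have "\<not> fst (snd f) < fst (snd e)"
  proof
    assume "fst (snd f) < fst (snd e)"
    then have "over e (fst (snd f))"
      using left_right[OF assms(2)] assms(3) by (simp add: over_def)
    then show False
      using no_vertex[OF assms(1) ends(2)[OF assms(2)]] height_right[OF left_right[OF assms(2)]] h
      by simp
  qed
  ultimately have "snd e = snd f"
    by (intro eqI_x ends assms(1,2)) simp
  then show ?thesis using assms(3) by (simp add: prod_eq_iff)
qed

definition next_edge :: "segment \<Rightarrow> segment \<Rightarrow> bool" where
  "next_edge e f \<longleftrightarrow> e \<in> E \<and> f \<in> E \<and> fst e = fst f \<and> slope e < slope f \<and>
     (\<forall>g\<in>E. fst g = fst e \<longrightarrow> \<not> (slope e < slope g \<and> slope g < slope f))"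

definition top_edge :: "segment \<Rightarrow> bool" where
  "top_edge e \<longleftrightarrow> e \<in> E \<and> (\<forall>g\<in>E. fst g = fst e \<longrightarrow> slope g \<le> slope e)"

lemma top_or_next: 
  assumes "e \<in> E" shows "top_edge e \<or> (\<exists>f. next_edge e f)"
proof (cases "top_edge e")
  case False
  let ?S = "{g \<in> E. fst g = fst e \<and> slope e < slope g}"
  have "finite ?S" by (rule finite_subset[OF _ finite_E]) (rule Collect_restrict)
  moreover have "?S \<noteq> {}"
  proof
    assume S: "?S = {}"
    have "slope g \<le> slope e" if "g \<in> E" "fst g = fst e" for g
    proof (rule ccontr)
      assume "\<not> slope g \<le> slope e"
      then have "g \<in> ?S" using that by simp
      then show False using S by (simp only: empty_iff)
    qed
    then have "top_edge e" unfolding top_edge_def using assms by blast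
    then show False using False by contradiction
  qed
  ultimately have "\<exists>f\<in>?S. \<forall>g\<in>?S. slope f \<le> slope g" by (rule finite_min_exists[where h=slope])
  then obtain f where "f \<in> ?S" and min: "\<forall>g\<in>?S. slope f \<le> slope g" by (rule bexE)
  then have f: "f \<in> E" "fst f = fst e" "slope e < slope f" by (simp_all only: mem_Collect_eq)
  have "\<not> (slope e < slope g \<and> slope g < slope f)" if "g \<in> E" "fst g = fst e" for g
  proof
    assume "slope e < slope g \<and> slope g < slope f"
    moreover from this that have "g \<in> ?S" by simp
    ultimately show False using bspec[OF min, of g] by linarith
  qed
  then have "next_edge e f" using assms f unfolding next_edge_def by metis
  then show ?thesis by blast
qed simp

text \<open>The region is closed along both edges, so the nearer of the two right ends always
  belongs to it and a leftmost vertex exists; the common left end is excluded.\<close>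

definition wedge :: "segment \<Rightarrow> segment \<Rightarrow> point set" where
  "wedge e f = {v \<in> V. fst (fst e) < fst v \<and> fst v \<le> fst (snd e) \<and> fst v \<le> fst (snd f) \<and>
     height e (fst v) \<le> snd v \<and> snd v \<le> height f (fst v)}"

definition tip :: "segment \<Rightarrow> segment \<Rightarrow> point \<Rightarrow> bool" where
  "tip e f v \<longleftrightarrow> v \<in> wedge e f \<and> (\<forall>w\<in>wedge e f. fst v \<le> fst w)"

lemma next_edge_height:
  assumes "next_edge e f" "fst (fst e) < x" shows "height e x < height f x"
proof -
  have "slope e * (x - fst (fst e)) < slope f * (x - fst (fst e))"
    using assms by (intro mult_strict_right_mono) (auto simp: next_edge_def)
  then show ?thesis using assms by (simp add: height_def next_edge_def)
qed

lemma tip_exists: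
  assumes "next_edge e f" shows "\<exists>v. tip e f v"
proof -
  have e: "e \<in> E" "f \<in> E" "fst e = fst f" using assms by (auto simp: next_edge_def)
  note lr = left_right[OF e(1)] left_right[OF e(2)]
  have "snd e \<in> wedge e f \<or> snd f \<in> wedge e f"
  proof (cases "fst (snd e) \<le> fst (snd f)")
    case True
    then show ?thesis
      using next_edge_height[OF assms, of "fst (snd e)"] lr ends(2)[OF e(1)] height_right[OF lr(1)]
      by (auto simp: wedge_def)
  next
    case False
    then show ?thesis
      using next_edge_height[OF assms, of "fst (snd f)"] lr ends(2)[OF e(2)] height_right[OF lr(2)] e(3)
      by (auto simp: wedge_def)
  qed
  then have "wedge e f \<noteq> {}" by blast
  moreover have "finite (wedge e f)" using finite_V by (simp add: wedge_def)
  ultimately have "\<exists>v\<in>wedge e f. \<forall>w\<in>wedge e f. fst v \<le> fst w" by (intro finite_min_exists)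
  then show ?thesis unfolding tip_def by metis
qed

context
  assumes planar: "\<And>e f. e \<in> E \<Longrightarrow> f \<in> E \<Longrightarrow> \<not> crossing e f"
begin

lemma planarD: "e \<in> E \<Longrightarrow> f \<in> E \<Longrightarrow> e \<noteq> f \<Longrightarrow> over e x \<Longrightarrow> over f x \<Longrightarrow> height e x \<noteq> height f x"
  using planar unfolding crossing_def by blast

text \<open>Follow \<open>g\<close> from the tip to the left. Planarity keeps it between
  \<open>e\<close> and \<open>f\<close>, so its left end cannot be anywhere: beyond the apex,
  \<open>g\<close> would run through the apex; at the apex, its slope would lie between two
  consecutive slopes; inside the wedge, it would be a vertex to the left of the tip.\<close>

lemma wedge_empty:
  assumes "next_edge e f" "tip e f v" "g \<in> E" 
    and g: "fst (fst g) < fst v" "fst v \<le> fst (snd g)"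
    and "height e (fst v) < height g (fst v)" "height g (fst v) < height f (fst v)"
  shows False
proof -
  have e: "e \<in> E" "f \<in> E" "fst e = fst f" "slope e < slope f" using assms by (auto simp: next_edge_def)
  have v: "v \<in> V" "fst (fst e) < fst v" "fst v \<le> fst (snd e)" "fst v \<le> fst (snd f)"
    using assms(2) by (auto simp: tip_def wedge_def)
  have ne: "g \<noteq> e" "g \<noteq> f" using assms(6,7) by auto
  let ?l = "max (fst (fst e)) (fst (fst g))"
  have lo: "height e x \<le> height g x" if "?l \<le> x" "x \<le> fst v" for x
  proof (rule height_le_left[of ?l "fst v"])
    fix z assume "?l < z" "z < fst v"
    then show "height e z \<noteq> height g z" 
      using planarD[OF e(1) assms(3)] ne v g by (auto simp: over_def)
  qed (use that assms in auto)
  have hi: "height g x \<le> height f x" if "?l \<le> x" "x \<le> fst v" for x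
  proof (rule height_le_left[of ?l "fst v"])
    fix z assume "?l < z" "z < fst v"
    then show "height g z \<noteq> height f z" 
      using planarD[OF assms(3) e(2)] ne v g e(3) by (auto simp: over_def)
  qed (use that assms in auto)
  consider "fst (fst g) < fst (fst e)" | "fst (fst g) = fst (fst e)" | "fst (fst g) > fst (fst e)"
    by linarith
  then show False
  proof cases
    case 1
    then have "height g (fst (fst e)) = snd (fst e)"
      using lo[of "fst (fst e)"] hi[of "fst (fst e)"] v e(3) height_left[of e] height_left[of f] by simp
    then show False
      using no_vertex[OF assms(3) ends(1)[OF e(1)]] 1 v(2) g(2) by (simp add: over_def)
  next
    case 2
    then have p: "fst g = fst e" using eqI_x ends e(1) assms(3) by blast
    have d: "0 < fst v - fst (fst e)" using v by simp
    have "slope e * (fst v - fst (fst e)) < slope g * (fst v - fst (fst e))"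
         "slope g * (fst v - fst (fst e)) < slope f * (fst v - fst (fst e))"
      using assms(6,7) p e(3) by (auto simp: height_def)
    then have "slope e < slope g" "slope g < slope f"
      using d by (auto simp: mult_less_cancel_right_pos)
    then show False using assms(1,3) p by (auto simp: next_edge_def)
  next
    case 3
    then have "fst g \<in> wedge e f"
      using lo[of "fst (fst g)"] hi[of "fst (fst g)"] g v ends(1)[OF assms(3)]
      by (auto simp: wedge_def)
    then show False using assms(2) g(1) by (auto simp: tip_def)
  qed
qed

text \<open>Here \<open>v\<close> is strictly below \<open>f\<close>. Of two candidates for the
  upper edge, the lower one would pass strictly inside the wedge of the other, which
  \<open>wedge_empty\<close> forbids; so both have the same height above \<open>v\<close> and
  planarity makes them equal.\<close>

lemma upper_determined:
  assumes "next_edge e f" "tip e f v" "v \<noteq> snd f" "next_edge e' f'" "tip e' f' v" "v \<noteq> snd f'"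
  shows "f = f'"
proof -
  have A: "fst v < fst (snd f) \<and> snd v < height f (fst v) \<and> fst (fst f) < fst v \<and> f \<in> E
     \<and> height e (fst v) \<le> snd v"
    if "next_edge e f" "tip e f v" "v \<noteq> snd f" for e f
  proof -
    have 1: "f \<in> E" "v \<in> V" "fst (fst f) < fst v" "fst v \<le> fst (snd f)" "snd v \<le> height f (fst v)"
      "height e (fst v) \<le> snd v"
      using that by (auto simp: tip_def wedge_def next_edge_def)
    then have "fst v \<noteq> fst (snd f)" using that(3) eqI_x ends by blast
    then have 2: "fst v < fst (snd f)" using 1 by simp
    have "height f (fst v) \<noteq> snd v" using no_vertex[OF 1(1,2)] 1 2 by (simp add: over_def)
    then show ?thesis using 1 2 by auto
  qed
  have B: False if "next_edge e f" "tip e f v" "v \<noteq> snd f" "next_edge e' f'" "tip e' f' v" "v \<noteq> snd f'"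
    "height f (fst v) < height f' (fst v)" for e f e' f'
    using wedge_empty[OF that(4,5), of f] A[OF that(1-3)] A[OF that(4-6)] that(7) by auto
  have "height f (fst v) = height f' (fst v)"
    using B[OF assms] B[OF assms(4-6) assms(1-3)] by (meson linorder_neqE)
  then show ?thesis
    using planarD[of f f' "fst v"] A[OF assms(1-3)] A[OF assms(4-6)] by (auto simp: over_def)
qed

text \<open>Mirror image of the previous argument. Since \<open>v\<close> is the right end of
  \<open>f\<close>, it cannot also be the right end of \<open>e\<close>, because \<open>e\<close>
  and \<open>f\<close> already share the left end; hence \<open>v\<close> is strictly above
  \<open>e\<close>.\<close>

lemma lower_determined:
  assumes "next_edge e f" "tip e f v" "v = snd f" "next_edge e' f'" "tip e' f' v" "v = snd f'"
  shows "e = e'"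
proof -
  have A: "fst v < fst (snd e) \<and> snd v > height e (fst v) \<and> fst (fst e) < fst v \<and> e \<in> E
     \<and> height f (fst v) = snd v"
    if "next_edge e f" "tip e f v" "v = snd f" for e f
  proof -
    have 1: "e \<in> E" "f \<in> E" "v \<in> V" "fst (fst e) < fst v" "fst v \<le> fst (snd e)" "snd v \<ge> height e (fst v)"
      "fst e = fst f"
      using that by (auto simp: tip_def wedge_def next_edge_def)
    have "v \<noteq> snd e"
    proof
      assume "v = snd e"
      then have "e = f" using that(3) 1 by (simp add: prod_eq_iff)
      then show False using that(1) by (simp add: next_edge_def)
    qed
    then have "fst v \<noteq> fst (snd e)" using eqI_x ends 1 by blast
    then have 2: "fst v < fst (snd e)" using 1 by simp
    have "height e (fst v) \<noteq> snd v" using no_vertex[OF 1(1,3)] 1 2 by (simp add: over_def)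
    then show ?thesis using 1 2 that(3) height_right left_right by auto
  qed
  have B: False if "next_edge e f" "tip e f v" "v = snd f" "next_edge e' f'" "tip e' f' v" "v = snd f'"
    "height e (fst v) < height e' (fst v)" for e f e' f'
    using wedge_empty[OF that(1,2), of e'] A[OF that(1-3)] A[OF that(4-6)] that(7) by auto
  have "height e (fst v) = height e' (fst v)"
    using B[OF assms] B[OF assms(4-6) assms(1-3)] by (meson linorder_neqE)
  then show ?thesis
    using planarD[of e e' "fst v"] A[OF assms(1-3)] A[OF assms(4-6)] by (auto simp: over_def)
qed

lemma next_edge_unique_left:
  assumes "next_edge e f" "next_edge e' f" shows "e = e'"
proof -
  have "slope e = slope e'" using assms unfolding next_edge_def by (metis linorder_neqE)
  then show ?thesis using assms same_left_same_slope by (auto simp: next_edge_def)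
qed

text \<open>
  Charging: an edge that is not the topmost one at its left endpoint is charged to the leftmost
  vertex \<open>v\<close> of the wedge between it and the next edge above it. Nothing enters this wedge to the
  left of \<open>v\<close>, so the two edges are the ones vertically adjacent to \<open>v\<close>; hence \<open>v\<close> together with
  one bit (is \<open>v\<close> the endpoint of the upper edge?) determines the charged edge.
\<close>

lemma planar_edge_bound: "card E \<le> 3 * card V"
proof -
  let ?T = "{e. top_edge e}" and ?N = "{e. \<exists>f. next_edge e f}"
  have "inj_on fst ?T"
  proof (rule inj_onI)
    fix e f assume "e \<in> ?T" "f \<in> ?T" and eq: "fst e = fst f"
    then have T: "top_edge e" "top_edge f" by simp_all
    then have E: "e \<in> E" "f \<in> E" by (simp_all add: top_edge_def)
    then have "slope e \<le> slope f" "slope f \<le> slope e" using T eq unfolding top_edge_def by metis+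
    then show "e = f" using same_left_same_slope[OF E eq] by simp
  qed
  moreover have "fst ` ?T \<subseteq> V" using ends by (auto simp: top_edge_def)
  ultimately have T: "card ?T \<le> card V" using finite_V by (simp add: card_inj_on_le)
  define F where "F e = (SOME f. next_edge e f)" for e
  define W where "W e = (SOME v. tip e (F e) v)" for e
  define code where "code e = (W e, W e = snd (F e))" for e
  have F: "next_edge e (F e)" if "e \<in> ?N" for e using that unfolding F_def by (auto intro: someI)
  have W: "tip e (F e) (W e)" if "e \<in> ?N" for e
    unfolding W_def using tip_exists[OF F[OF that]] by (auto intro: someI)
  have "inj_on code ?N"
  proof (rule inj_onI)
    fix e e' assume H: "e \<in> ?N" "e' \<in> ?N" "code e = code e'"
    then have w: "W e = W e'" "W e = snd (F e) \<longleftrightarrow> W e' = snd (F e')" by (auto simp: code_def)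
    show "e = e'"
    proof (cases "W e = snd (F e)")
      case True
      then show ?thesis using lower_determined[OF F[OF H(1)] W[OF H(1)] True F[OF H(2)]] W[OF H(2)] w by auto
    next
      case False
      then have "F e = F e'" using upper_determined[OF F[OF H(1)] W[OF H(1)] False F[OF H(2)]] W[OF H(2)] w by auto
      then show ?thesis using next_edge_unique_left F[OF H(1)] F[OF H(2)] by metis
    qed
  qed
  moreover have "code e \<in> V \<times> UNIV" if "e \<in> ?N" for e 
    using W[OF that] by (simp add: code_def tip_def wedge_def)
  then have "code ` ?N \<subseteq> V \<times> UNIV" by (intro image_subsetI)
  ultimately have "card ?N \<le> card (V \<times> (UNIV :: bool set))"
    using finite_V by (intro card_inj_on_le) auto
  then have N: "card ?N \<le> 2 * card V" by (simp add: card_cartesian_product)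
  have "E \<subseteq> ?T \<union> ?N" using top_or_next by auto
  moreover have "?T \<union> ?N \<subseteq> E" by (auto simp: top_edge_def next_edge_def)
  ultimately have "E = ?T \<union> ?N" by blast
  then have "card E \<le> card ?T + card ?N" by (metis card_Un_le)
  then show ?thesis using T N by linarith
qed

end

end

section \<open>The crossing inequality and the Szemeredi--Trotter bound\<close>

lemma height_eq_everywhere:
  assumes "height e x = height f x" "height e y = height f y" "x \<noteq> y"
  shows "height e z = height f z"
proof -
  have "(slope e - slope f) * (x - y) = (height e x - height f x) - (height e y - height f y)"
    by (simp add: height_def algebra_simps)
  then have s: "slope e = slope f" using assms by simp
  have "height e z - height f z = (height e x - height f x) + (slope e - slope f) * (z - x)"
    by (simp add: height_def algebra_simps)
  then show ?thesis using s assms(1) by simp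
qed

text \<open>Ordered pairs, so each crossing is counted twice. This fits the injection into
  \<open>L \<times> L\<close> in the Szemeredi-Trotter argument.\<close>

definition crossings :: "segment set \<Rightarrow> (segment \<times> segment) set" where
  "crossings E = {(e, f). e \<in> E \<and> f \<in> E \<and> crossing e f}"

context plane_graph
begin

lemma subgraph:
  assumes "W \<subseteq> V" "F \<subseteq> E" "F \<subseteq> W \<times> W" shows "plane_graph W F"
proof
  show "finite W" using assms(1) finite_V finite_subset by blast
  show "inj_on fst W" using inj_x assms(1) inj_on_subset by blast
qed (use assms left_right no_vertex in blast)+

text \<open>If the left ends differed, the one further right would lie in the interior of the other
  edge.\<close>

lemma no_overlap:
  assumes "e \<in> E" "f \<in> E" "over e x" "over f x" "\<And>z. height e z = height f z"
  shows "e = f"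
proof -
  have *: "\<not> fst (fst e) < fst (fst f)" 
    if "e \<in> E" "f \<in> E" "over e x" "over f x" "\<And>z. height e z = height f z" for e f
    using no_vertex[OF that(1) ends(1)[OF that(2)]] that(3,4) that(5)[of "fst (fst f)"]
    by (auto simp: over_def)
  have "fst (fst e) = fst (fst f)"
    using *[OF assms] *[OF assms(2,1,4,3)] assms(5) by fastforce
  then have p: "fst e = fst f" using eqI_x ends assms(1,2) by blast
  have "height e (fst (fst e) + 1) = height f (fst (fst e) + 1)" by (rule assms(5))
  then have "slope e = slope f" using p by (simp add: height_def)
  then show ?thesis using same_left_same_slope assms(1,2) p by blast
qed

text \<open>A shared left or right end together with the crossing point gives two agreements of
  affine functions, so the edges would overlap; a left end and a right end are separated by the
  crossing. Four distinct endpoints are what makes a crossing survive a random choice of vertices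
  with the fourth power of the probability.\<close>

lemma crossing_distinct:
  assumes "e \<in> E" "f \<in> E" "crossing e f"
  shows "card {fst e, snd e, fst f, snd f} = 4"
proof -
  obtain x where x: "over e x" "over f x" "height e x = height f x" and ne: "e \<noteq> f"
    using assms(3) by (auto simp: crossing_def)
  note lr = left_right[OF assms(1)] left_right[OF assms(2)]
  have no: "height e y \<noteq> height f y" if "y \<noteq> x" for y
    using no_overlap[OF assms(1,2) x(1,2)] height_eq_everywhere[OF x(3), of y] ne that by blast
  have "fst e \<noteq> fst f"
  proof
    assume "fst e = fst f"
    then show False using no[of "fst (fst e)"] x height_left[of e] height_left[of f] by (simp add: over_def)
  qed
  moreover have "snd e \<noteq> snd f"
  proof
    assume "snd e = snd f"
    then show False 
      using no[of "fst (snd e)"] x height_right[OF lr(1)] height_right[OF lr(2)] by (simp add: over_def)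
  qed
  moreover have "fst e \<noteq> snd e" "fst f \<noteq> snd f" using lr by auto
  moreover have "fst e \<noteq> snd f" "fst f \<noteq> snd e"
    using x by (auto simp: over_def)
  ultimately show ?thesis by auto
qed

end

text \<open>Delete an edge of some crossing: the number of edges drops by one and the number of
  crossings by at least one. At the end the drawing is planar.\<close>

lemma edge_bound_crossings:
  assumes "plane_graph V E" shows "card E \<le> 3 * card V + card (crossings E)"
  using assms
proof (induction "card E" arbitrary: E rule: less_induct)
  case less
  interpret plane_graph V E by (rule less.prems)
  have fin: "finite (crossings E)"
    using finite_E by (rule_tac finite_subset[of _ "E \<times> E"]) (auto simp: crossings_def)
  show ?case
  proof (cases "\<exists>e\<in>E. \<exists>f\<in>E. crossing e f")
    case False
    then show ?thesis using planar_edge_bound by (meson trans_le_add1)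
  next
    case True
    then obtain e f where ef: "e \<in> E" "f \<in> E" "crossing e f" by blast
    have "plane_graph V (E - {e})" by (rule subgraph) (use E_sub in auto)
    moreover have c: "card (E - {e}) = card E - 1" "card E > 0"
      using ef(1) finite_E by (auto simp: card_gt_0_iff)
    ultimately have "card (E - {e}) \<le> 3 * card V + card (crossings (E - {e}))"
      using less.hyps[of "E - {e}"] by linarith
    moreover have "crossings (E - {e}) \<subset> crossings E"
    proof
      show "crossings (E - {e}) \<subseteq> crossings E" by (auto simp: crossings_def)
      have "(e, f) \<in> crossings E" "(e, f) \<notin> crossings (E - {e})" 
        using ef by (auto simp: crossings_def)
      then show "crossings (E - {e}) \<noteq> crossings E" by blast
    qed
    then have "card (crossings (E - {e})) < card (crossings E)"
      using fin by (rule psubset_card_mono[rotated])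
    ultimately show ?thesis using c by linarith
  qed
qed

text \<open>The integer form of the statement that a random colouring with \<open>s\<close> colours
  gives colour 0 to all of \<open>W\<close> with probability \<open>1 / s ^ card W\<close>.\<close>

lemma card_colourings:
  assumes "finite V" "W \<subseteq> V" "s > 0"
  shows "s ^ card W * card {c \<in> V \<rightarrow>\<^sub>E {..<s}. \<forall>w\<in>W. c w = (0::nat)} = s ^ card V"
proof -
  have "{c \<in> V \<rightarrow>\<^sub>E {..<s}. \<forall>w\<in>W. c w = (0::nat)} = Pi\<^sub>E V (\<lambda>v. if v \<in> W then {0} else {..<s})"
    using assms(2,3) by (auto simp: PiE_def Pi_def split: if_splits) 
  then have "card {c \<in> V \<rightarrow>\<^sub>E {..<s}. \<forall>w\<in>W. c w = (0::nat)} = (\<Prod>v\<in>V. card (if v \<in> W then {0} else {..<s}))"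
    using assms(1) by (simp add: card_PiE)
  also have "\<dots> = (\<Prod>v\<in>V - W. s)"
    using assms(1) by (intro prod.mono_neutral_cong_right) auto
  also have "\<dots> = s ^ card (V - W)" by simp
  finally show ?thesis
    using assms by (simp add: power_add[symmetric] card_Diff_subset finite_subset card_mono)
qed

text \<open>Linearity of expectation, as a double count: each \<open>a\<close> survives when its
  \<open>j\<close> vertices get colour 0.\<close>

lemma sum_card_colourings:
  assumes "finite V" "finite A" "s > 0" and W: "\<And>a. a \<in> A \<Longrightarrow> W a \<subseteq> V \<and> card (W a) = j"
  shows "s ^ j * (\<Sum>c\<in>V \<rightarrow>\<^sub>E {..<s}. card {a \<in> A. \<forall>w\<in>W a. c w = (0::nat)}) = card A * s ^ card V"
proof -
  have fin: "finite (V \<rightarrow>\<^sub>E {..<s})" using assms(1) by (simp add: finite_PiE)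
  have "(\<Sum>c\<in>V \<rightarrow>\<^sub>E {..<s}. card {a \<in> A. \<forall>w\<in>W a. c w = 0})
      = (\<Sum>a\<in>A. card {c \<in> V \<rightarrow>\<^sub>E {..<s}. \<forall>w\<in>W a. c w = 0})"
    by (rule sum_multicount_gen[OF fin assms(2)]) simp
  then have "s ^ j * (\<Sum>c\<in>V \<rightarrow>\<^sub>E {..<s}. card {a \<in> A. \<forall>w\<in>W a. c w = 0})
     = (\<Sum>a\<in>A. s ^ card (W a) * card {c \<in> V \<rightarrow>\<^sub>E {..<s}. \<forall>w\<in>W a. c w = 0})"
    using W by (simp add: sum_distrib_left)
  also have "\<dots> = (\<Sum>a\<in>A. s ^ card V)"
    by (rule sum.cong[OF refl], rule card_colourings) (use assms in auto)
  finally show ?thesis by simp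
qed

text \<open>
  Colour the vertices with \<open>s\<close> colours and keep one colour class: vertices, edges and crossings
  survive with probability \<open>1/s\<close>, \<open>1/s\<^sup>2\<close> and \<open>1/s\<^sup>4\<close>.
\<close>

lemma crossing_inequality:
  assumes "plane_graph V E" "s > 0"
  shows "card E * s\<^sup>2 \<le> 3 * card V * s ^ 3 + card (crossings E)"
proof -
  interpret plane_graph V E by (rule assms(1))
  let ?K = "V \<rightarrow>\<^sub>E {..<s}"
  \<comment> \<open>The three surviving sets are written as a condition on an explicit vertex set of
    size 1, 2 and 4, the shape that \<open>sum_card_colourings\<close> expects.\<close>
  define V0 where "V0 c = {v \<in> V. \<forall>w\<in>{v}. c w = (0::nat)}" for c
  define E0 where "E0 c = {e \<in> E. \<forall>w\<in>{fst e, snd e}. c w = (0::nat)}" for c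
  define X0 where "X0 c = {z \<in> crossings E. \<forall>w\<in>{fst (fst z), snd (fst z), fst (snd z), snd (snd z)}. c w = (0::nat)}" for c
  have finX: "finite (crossings E)"
    using finite_E by (rule_tac finite_subset[of _ "E \<times> E"]) (auto simp: crossings_def)
  have le: "card (E0 c) \<le> 3 * card (V0 c) + card (X0 c)" for c
  proof -
    have "plane_graph (V0 c) (E0 c)"
    proof (rule subgraph)
      show "E0 c \<subseteq> V0 c \<times> V0 c" using E_sub by (auto simp: E0_def V0_def)
    qed (auto simp: E0_def V0_def)
    moreover have "crossings (E0 c) = X0 c" by (auto simp: crossings_def E0_def X0_def)
    ultimately show ?thesis using edge_bound_crossings by metis
  qed
  have sV: "s ^ 1 * (\<Sum>c\<in>?K. card (V0 c)) = card V * s ^ card V"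
    unfolding V0_def using finite_V assms(2) by (intro sum_card_colourings) auto
  have sE: "s\<^sup>2 * (\<Sum>c\<in>?K. card (E0 c)) = card E * s ^ card V"
    unfolding E0_def
  proof (rule sum_card_colourings[OF finite_V finite_E assms(2)])
    fix e assume e: "e \<in> E"
    then have "fst e \<noteq> snd e" using left_right[OF e] by auto
    then show "{fst e, snd e} \<subseteq> V \<and> card {fst e, snd e} = 2" using ends[of e] e by auto
  qed
  have sX: "s ^ 4 * (\<Sum>c\<in>?K. card (X0 c)) = card (crossings E) * s ^ card V"
    unfolding X0_def
  proof (rule sum_card_colourings[OF finite_V finX assms(2)])
    fix z assume "z \<in> crossings E"
    then have z: "fst z \<in> E" "snd z \<in> E" "crossing (fst z) (snd z)" by (auto simp: crossings_def)
    then show "{fst (fst z), snd (fst z), fst (snd z), snd (snd z)} \<subseteq> V \<and>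
        card {fst (fst z), snd (fst z), fst (snd z), snd (snd z)} = 4"
      using crossing_distinct[OF z] ends[OF z(1)] ends[OF z(2)] by simp
  qed
  have "(\<Sum>c\<in>?K. card (E0 c)) \<le> (\<Sum>c\<in>?K. 3 * card (V0 c) + card (X0 c))"
    by (rule sum_mono) (rule le)
  also have "\<dots> = 3 * (\<Sum>c\<in>?K. card (V0 c)) + (\<Sum>c\<in>?K. card (X0 c))"
    by (simp add: sum.distrib sum_distrib_left)
  \<comment> \<open>The factor \<open>s ^ 4\<close> clears the denominators of all three
    expectations at once.\<close>
  finally have "s ^ 4 * (\<Sum>c\<in>?K. card (E0 c)) \<le>
      s ^ 4 * (3 * (\<Sum>c\<in>?K. card (V0 c)) + (\<Sum>c\<in>?K. card (X0 c)))"
    by (rule mult_le_mono2)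
  moreover have "s ^ 4 * (\<Sum>c\<in>?K. card (E0 c)) = s\<^sup>2 * (s\<^sup>2 * (\<Sum>c\<in>?K. card (E0 c)))"
    by (simp add: power2_eq_square power4_eq_xxxx)
  moreover have "s ^ 4 * (3 * x + y) = 3 * s ^ 3 * (s ^ 1 * x) + s ^ 4 * y" for x y
    by (simp add: power3_eq_cube power4_eq_xxxx algebra_simps)
  ultimately have "s\<^sup>2 * (card E * s ^ card V)
      \<le> 3 * s ^ 3 * (card V * s ^ card V) + card (crossings E) * s ^ card V"
    by (simp only: sV sE sX)
  then have "card E * s\<^sup>2 * s ^ card V \<le> (3 * card V * s ^ 3 + card (crossings E)) * s ^ card V"
    by (simp only: mult_ac distrib_left distrib_right)
  then show ?thesis using assms(2) by simp
qed

section \<open>Incidences of points and non-vertical lines in the plane\<close>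

definition on_line :: "point \<Rightarrow> real \<times> real \<Rightarrow> bool" where
  "on_line p l \<longleftrightarrow> snd p = fst l * fst p + snd l"

definition line_incidences :: "point set \<Rightarrow> (real \<times> real) set \<Rightarrow> (point \<times> (real \<times> real)) set" where
  "line_incidences P L = {(p, l). p \<in> P \<and> l \<in> L \<and> on_line p l}"

definition consecutive :: "point set \<Rightarrow> real \<times> real \<Rightarrow> segment \<Rightarrow> bool" where
  "consecutive P l e \<longleftrightarrow> fst e \<in> P \<and> snd e \<in> P \<and> fst (fst e) < fst (snd e) \<and>
     on_line (fst e) l \<and> on_line (snd e) l \<and>
     (\<forall>r\<in>P. on_line r l \<longrightarrow> \<not> over e (fst r))"

lemma height_on_line:
  assumes "on_line (fst e) l" "on_line (snd e) l" "fst (fst e) < fst (snd e)"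
  shows "height e x = fst l * x + snd l"
proof -
  have "snd (snd e) - snd (fst e) = fst l * (fst (snd e) - fst (fst e))"
    using assms(1,2) by (simp add: on_line_def algebra_simps)
  then have "slope e = fst l" using assms(3) by (simp add: slope_def)
  then show ?thesis using assms(1) by (simp add: height_def on_line_def algebra_simps)
qed

lemma line_eqI:
  assumes "on_line p l" "on_line q l" "on_line p l'" "on_line q l'" "fst p \<noteq> fst q"
  shows "l = l'"
proof -
  have "(fst l - fst l') * (fst p - fst q) = 0" using assms(1-4) by (simp add: on_line_def algebra_simps)
  then have "fst l = fst l'" using assms(5) by simp
  then show ?thesis using assms(1,3) by (simp add: on_line_def prod_eq_iff)
qed

text \<open>
  Szekely's argument, with the parameter \<open>s\<close> left free: the optimal \<open>s\<close> is chosen only after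
  summing over many planes, which replaces an application of Hoelder's inequality.
\<close>

theorem szemeredi_trotter_crossing:
  assumes P: "finite P" "inj_on fst P" and L: "finite L" and "s > 0"
  shows "card (line_incidences P L) * s\<^sup>2 \<le> card L * s\<^sup>2 + 3 * card P * s ^ 3 + (card L)\<^sup>2"
proof -
  define E where "E = {e. \<exists>l\<in>L. consecutive P l e}"
  have E: "\<exists>l\<in>L. consecutive P l e" if "e \<in> E" for e using that by (simp add: E_def)
  define l where "l e = (SOME l. l \<in> L \<and> consecutive P l e)" for e
  have l: "l e \<in> L \<and> consecutive P (l e) e" if "e \<in> E" for e
    unfolding l_def using E[OF that] by (metis (mono_tags, lifting) someI_ex)
  have h: "height e x = fst (l e) * x + snd (l e)" if "e \<in> E" for e x
    using l[OF that] by (auto simp: consecutive_def intro!: height_on_line)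
  interpret plane_graph P E
  proof
    show "E \<subseteq> P \<times> P" using l by (force simp: consecutive_def)
    show "fst (fst e) < fst (snd e)" if "e \<in> E" for e using l[OF that] by (simp add: consecutive_def)
    show "height e (fst v) \<noteq> snd v" if "e \<in> E" "v \<in> P" "over e (fst v)" for e v
    proof
      assume "height e (fst v) = snd v"
      then have "on_line v (l e)" using h[OF that(1)] by (simp add: on_line_def)
      then show False using l[OF that(1)] that(2,3) by (auto simp: consecutive_def)
    qed
  qed (use P in auto)
  \<comment> \<open>Two different lines meet only once, so the pair of supporting lines fixes the
    place of the crossing, and above that place each line carries at most one edge.\<close>
  have X: "card (crossings E) \<le> card (L \<times> L)"
  proof (rule card_inj_on_le)
    show "(\<lambda>(e, f). (l e, l f)) ` crossings E \<subseteq> L \<times> L" using l by (auto simp: crossings_def)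
    show "inj_on (\<lambda>(e, f). (l e, l f)) (crossings E)"
    proof (rule inj_onI, clarify)
      fix e f e' f' assume H: "(e, f) \<in> crossings E" "(e', f') \<in> crossings E" "l e = l e'" "l f = l f'"
      then have E: "e \<in> E" "f \<in> E" "e' \<in> E" "f' \<in> E" by (auto simp: crossings_def)
      obtain x where x: "over e x" "over f x" "height e x = height f x" "e \<noteq> f"
        using H(1) by (auto simp: crossings_def crossing_def)
      obtain x' where x': "over e' x'" "over f' x'" "height e' x' = height f' x'"
        using H(2) by (auto simp: crossings_def crossing_def)
      have "x = x'"
      proof (rule ccontr)
        assume "x \<noteq> x'"
        moreover have "height e x' = height f x'" using x'(3) h E H(3,4) by simp
        ultimately have "height e z = height f z" for z using height_eq_everywhere[OF x(3)] by blast
        then show False using no_overlap[OF E(1,2) x(1,2)] x(4) by blast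
      qed
      then have "e = e'" "f = f'"
        using no_overlap[OF E(1,3) x(1)] no_overlap[OF E(2,4) x(2)] x' h E H(3,4) by auto
      then show "e = e' \<and> f = f'" by simp
    qed
  qed (use L in auto)
  \<comment> \<open>On each line every incident point except the last one starts an edge to its
    successor, so there are at most \<open>card L + card E\<close> incidences.\<close>
  define is_last :: "point \<Rightarrow> real \<times> real \<Rightarrow> bool" where "is_last p k \<longleftrightarrow> (\<forall>q\<in>P. on_line q k \<longrightarrow> fst q \<le> fst p)" for p k
  let ?I = "line_incidences P L"
  let ?I1 = "{(p, k). (p, k) \<in> ?I \<and> is_last p k}" and ?I2 = "{(p, k). (p, k) \<in> ?I \<and> \<not> is_last p k}"
  have "card ?I1 \<le> card L"
  proof (rule card_inj_on_le[where f=snd])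
    show "inj_on snd ?I1"
    proof (rule inj_onI)
      fix y y' assume y: "y \<in> ?I1" "y' \<in> ?I1" "snd y = snd y'"
      then have *: "fst y \<in> P" "fst y' \<in> P" "on_line (fst y) (snd y)" "on_line (fst y') (snd y)"
          "is_last (fst y) (snd y)" "is_last (fst y') (snd y)"
        by (auto simp: line_incidences_def)
      then have "fst (fst y) \<le> fst (fst y')" "fst (fst y') \<le> fst (fst y)"
        unfolding is_last_def by simp_all
      with * have "fst y = fst y'" using P(2) by (auto dest: inj_onD)
      then show "y = y'" using y(3) by (simp add: prod_eq_iff)
    qed
  qed (use L in \<open>auto simp: line_incidences_def\<close>)
  moreover have "card ?I2 \<le> card E"
  proof -
    have nx: "\<exists>q. consecutive P k (p, q)" if pk: "(p, k) \<in> ?I" "\<not> is_last p k" for p k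
    proof -
      let ?Q = "{q \<in> P. on_line q k \<and> fst p < fst q}"
      obtain q where "q \<in> P" "on_line q k" "fst p < fst q"
        using pk(2) unfolding is_last_def by (meson not_le)
      then have "q \<in> ?Q" by simp
      then have "?Q \<noteq> {}" by blast
      moreover have "finite ?Q" using P(1) by simp
      ultimately have "\<exists>q\<in>?Q. \<forall>r\<in>?Q. fst q \<le> fst r" by (intro finite_min_exists)
      then obtain q where "q \<in> ?Q" "\<forall>r\<in>?Q. fst q \<le> fst r" by blast
      then have "consecutive P k (p, q)"
        using pk by (force simp: consecutive_def line_incidences_def over_def not_less)
      then show ?thesis ..
    qed
    define g where "g = (\<lambda>(p, k). (p, SOME q. consecutive P k (p, q)))"
    have g: "consecutive P k (g (p, k)) \<and> fst (g (p, k)) = p" if "(p, k) \<in> ?I2" for p k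
      unfolding g_def using someI_ex[OF nx[of p k]] that by auto
    show ?thesis
    proof (rule card_inj_on_le)
      show "g ` ?I2 \<subseteq> E" using g by (force simp: E_def line_incidences_def)
      show "inj_on g ?I2"
      proof (rule inj_onI)
        fix y y' assume y: "y \<in> ?I2" "y' \<in> ?I2" "g y = g y'"
        obtain p k p' k' where eq: "y = (p, k)" "y' = (p', k')" by (metis surj_pair)
        have c: "consecutive P k (g y)" "consecutive P k' (g y)" "p = p'"
          using g[of p k] g[of p' k'] y eq by auto
        then have "k = k'" by (intro line_eqI[of "fst (g y)" k "snd (g y)"]) (auto simp: consecutive_def)
        then show "y = y'" using c eq by simp
      qed
    qed (rule finite_E)
  qed
  moreover have "card ?I = card (?I1 \<union> ?I2)" by (rule arg_cong[where f = card]) auto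
  moreover have "card (?I1 \<union> ?I2) \<le> card ?I1 + card ?I2" by (rule card_Un_le)
  ultimately have "card ?I \<le> card L + card E" by linarith
  then have "card ?I * s\<^sup>2 \<le> (card L + card E) * s\<^sup>2" by (rule mult_le_mono1)
  also have "\<dots> \<le> card L * s\<^sup>2 + (3 * card P * s ^ 3 + card (crossings E))"
    using crossing_inequality[OF plane_graph_axioms \<open>s > 0\<close>] by (simp add: algebra_simps)
  finally show ?thesis using X by (simp add: power2_eq_square card_cartesian_product)
qed

section \<open>A weak Dirac theorem in the plane\<close>

definition points_on :: "point set \<Rightarrow> real \<times> real \<Rightarrow> point set" where
  "points_on P l = {p \<in> P. on_line p l}"

definition joining_line :: "point \<Rightarrow> point \<Rightarrow> real \<times> real" where
  "joining_line p q = (slope (p, q), snd p - slope (p, q) * fst p)"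

definition spanned_lines :: "point set \<Rightarrow> (real \<times> real) set" where
  "spanned_lines P = {l. \<exists>p\<in>P. \<exists>q\<in>P. p \<noteq> q \<and> on_line p l \<and> on_line q l}"

lemma on_joining_line:
  assumes "fst p \<noteq> fst q"
  shows "on_line p (joining_line p q)" "on_line q (joining_line p q)"
proof -
  have "slope (p, q) * (fst q - fst p) = snd q - snd p" using assms by (simp add: slope_def)
  then show "on_line p (joining_line p q)" "on_line q (joining_line p q)"
    by (simp_all add: on_line_def joining_line_def algebra_simps)
qed

lemma finite_spanned_lines:
  assumes "finite P" "inj_on fst P" shows "finite (spanned_lines P)"
proof (rule finite_subset)
  show "spanned_lines P \<subseteq> (\<lambda>(p, q). joining_line p q) ` (P \<times> P)"
  proof
    fix l assume "l \<in> spanned_lines P"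
    then obtain p q where pq: "p \<in> P" "q \<in> P" "p \<noteq> q" "on_line p l" "on_line q l"
      by (auto simp: spanned_lines_def)
    then have "fst p \<noteq> fst q" using assms(2) by (auto dest: inj_onD)
    then have "l = joining_line p q" using line_eqI[OF pq(4,5)] on_joining_line by blast
    then show "l \<in> (\<lambda>(p, q). joining_line p q) ` (P \<times> P)" using pq by auto
  qed
qed (use assms in simp)

lemma sum_card_points_on:
  assumes "finite P" "finite L"
  shows "card (line_incidences P L) = (\<Sum>l\<in>L. card (points_on P l))"
proof -
  have "line_incidences P L = (\<lambda>(l, p). (p, l)) ` (SIGMA l:L. points_on P l)"
    by (auto simp: line_incidences_def points_on_def)
  then have "card (line_incidences P L) = card (SIGMA l:L. points_on P l)"
    by (simp add: card_image inj_on_def split_def prod_eq_iff)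
  also have "\<dots> = (\<Sum>l\<in>L. card (points_on P l))"
    using assms by (intro card_SigmaI) (auto simp: points_on_def)
  finally show ?thesis .
qed

text \<open>The usual dual form of the incidence bound. The parameter is taken near the square root
  of \<open>N / u\<close>, so that the crossing term and the trivial term are absorbed by the left
  side and only \<open>u * N \<le> 12 * r * s\<close> remains.\<close>

lemma rich_lines_bound:
  assumes P: "finite P" "inj_on fst P" and L: "finite L" and t: "2 \<le> t"
    and rich: "\<And>l. l \<in> L \<Longrightarrow> t \<le> card (points_on P l)"
  shows "real (card L) \<le> 1296 * (real (card P))\<^sup>2 / real t ^ 3 + 36 * real (card P) / real t"
proof (cases "L = {}")
  case False
  define N r u where "N = real (card L)" and "r = real (card P)" and "u = real t"
  have N: "N > 0" using False L by (simp add: N_def card_gt_0_iff)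
  have u: "u \<ge> 2" using t by (simp add: u_def)
  define y where "y = sqrt (N / u)"
  have y: "y > 0" "y\<^sup>2 = N / u" using N u by (simp_all add: y_def)
  \<comment> \<open>The factor 2 gives \<open>N \<le> u * s^2 / 4\<close>, so the squared term costs
    a quarter of the left side; \<open>u \<ge> 2\<close> lets the first term cost a half. Rounding
    up is harmless for \<open>y \<ge> 1\<close>, where \<open>s \<le> 3 * y\<close>; otherwise
    \<open>s \<le> 3\<close> yields the linear summand.\<close>
  define s where "s = nat \<lceil>2 * y\<rceil>"
  have s: "s > 0" "real s \<ge> 2 * y" "real s \<le> 2 * y + 1"
    using y by (auto simp: s_def)
  have "t * card L \<le> card (line_incidences P L)"
    using sum_card_points_on[OF P(1) L] sum_mono[OF rich, of L "\<lambda>l. l"] by (simp add: mult.commute)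
  then have "t * card L * s\<^sup>2 \<le> card (line_incidences P L) * s\<^sup>2" by (rule mult_le_mono1)
  also have "\<dots> \<le> card L * s\<^sup>2 + 3 * card P * s ^ 3 + (card L)\<^sup>2"
    by (rule szemeredi_trotter_crossing[OF P L s(1)])
  finally have "real (t * card L * s\<^sup>2) \<le> real (card L * s\<^sup>2 + 3 * card P * s ^ 3 + (card L)\<^sup>2)"
    by (simp only: of_nat_le_iff)
  then have 1: "u * N * (real s)\<^sup>2 \<le> N * (real s)\<^sup>2 + 3 * r * real s ^ 3 + N\<^sup>2"
    by (simp add: N_def r_def u_def)
  have "4 * (N / u) \<le> (real s)\<^sup>2"
    using power_mono[OF s(2), of 2] y by (simp add: power_mult_distrib)
  then have "N \<le> u * (real s)\<^sup>2 / 4" using u by (simp add: field_simps)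
  then have "N * N \<le> N * (u * (real s)\<^sup>2 / 4)" using N by (intro mult_left_mono) auto
  moreover have "N * (real s)\<^sup>2 \<le> u / 2 * N * (real s)\<^sup>2"
    using N u by (intro mult_right_mono) auto
  ultimately have "(u * N / 4) * (real s)\<^sup>2 \<le> (3 * r * real s) * (real s)\<^sup>2"
    using 1 by (simp add: power2_eq_square power3_eq_cube algebra_simps)
  then have "u * N / 4 \<le> 3 * r * real s"
    using s(1) by (simp only: mult_le_cancel_right) auto
  then have 2: "u * N \<le> 12 * r * real s" by simp
  have r: "r \<ge> 0" by (simp add: r_def)
  have "N \<le> 1296 * r\<^sup>2 / u ^ 3 + 36 * r / u"
  proof (cases "y \<ge> 1")
    case True
    have "12 * r * real s \<le> 12 * r * (3 * y)"
      using s(3) True r by (intro mult_left_mono) auto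
    then have "u * (u * y\<^sup>2) \<le> 36 * r * y" using 2 y u by simp
    then have "u\<^sup>2 * y * y \<le> 36 * r * y" by (simp add: power2_eq_square mult_ac)
    then have "u\<^sup>2 * y \<le> 36 * r" using y(1) by (simp add: mult_le_cancel_right)
    then have "y \<le> 36 * r / u\<^sup>2" using u by (simp add: field_simps)
    then have "y\<^sup>2 \<le> (36 * r / u\<^sup>2)\<^sup>2" using y(1) by (intro power_mono) auto
    then have "u * y\<^sup>2 \<le> u * (36 * r / u\<^sup>2)\<^sup>2" using u by (intro mult_left_mono) auto
    also have "\<dots> = 1296 * r\<^sup>2 / u ^ 3"
      using u by (simp add: power2_eq_square power3_eq_cube field_simps)
    finally have "N \<le> 1296 * r\<^sup>2 / u ^ 3" using y(2) u by simp
    moreover have "0 \<le> 36 * r / u" using r u by simp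
    ultimately show ?thesis by linarith
  next
    case False
    have "12 * r * real s \<le> 12 * r * 3"
      using s(3) False r by (intro mult_left_mono) auto
    then have "N * u \<le> 36 * r" using 2 by (simp only: mult_ac)
    then have "N \<le> 36 * r / u" using u by (simp add: field_simps)
    moreover have "0 \<le> 1296 * r\<^sup>2 / u ^ 3" using u by simp
    ultimately show ?thesis by linarith
  qed
  then show ?thesis by (simp add: N_def r_def u_def)
qed simp

lemma sum_inverse_squares: "T > 0 \<Longrightarrow> (\<Sum>t\<in>{T<..M}. 1 / (real t)\<^sup>2) \<le> 1 / real T"
proof -
  assume T: "T > 0"
  have *: "(\<Sum>t\<in>{T<..T + k}. 1 / (real t)\<^sup>2) \<le> 1 / real T - 1 / real (T + k)" for k
  proof (induction k)
    case (Suc k)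
    have "{T<..T + Suc k} = insert (T + Suc k) {T<..T + k}" by auto
    moreover have "1 / (real (T + Suc k))\<^sup>2 \<le> 1 / real (T + k) - 1 / real (T + Suc k)"
    proof -
      have "1 / real (T + k) - 1 / real (T + Suc k) = 1 / (real (T + k) * real (T + Suc k))"
        using T by (simp add: field_simps)
      also have "\<dots> \<ge> 1 / (real (T + Suc k) * real (T + Suc k))"
        using T by (intro divide_left_mono mult_right_mono mult_pos_pos) auto
      finally show ?thesis by (simp add: power2_eq_square)
    qed
    ultimately show ?case using Suc by simp
  qed simp
  show ?thesis
  proof (cases "M \<le> T")
    case False
    then obtain k where "M = T + k" by (metis le_iff_add nat_le_linear)
    moreover have "0 \<le> 1 / real (T + k)" by simp
    ultimately show ?thesis using *[of k] by (simp only:)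
  qed (use T in simp)
qed

text \<open>Summation by parts: it turns a sum of squares over lines into a sum over thresholds
  \<open>t\<close> of \<open>2 * t\<close> times the number of lines with at least \<open>t\<close>
  points.\<close>

lemma square_le_sum:
  assumes "T \<le> n" "n \<le> M"
  shows "n\<^sup>2 \<le> T\<^sup>2 + (\<Sum>t\<in>{T<..M}. if t \<le> n then 2 * t else 0 :: nat)"
proof -
  have "(\<Sum>t\<in>{T<..M}. if t \<le> n then 2 * t else 0) = (\<Sum>t\<in>{T<..n}. 2 * t)"
    using assms by (intro sum.mono_neutral_cong_right) auto
  moreover have "(T + k)\<^sup>2 \<le> T\<^sup>2 + (\<Sum>t\<in>{T<..T + k}. 2 * t)" for k
  proof (induction k)
    case (Suc k)
    have "{T<..T + Suc k} = insert (T + Suc k) {T<..T + k}" by auto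
    then have "(\<Sum>t\<in>{T<..T + Suc k}. 2 * t) = 2 * (T + Suc k) + (\<Sum>t\<in>{T<..T + k}. 2 * t)" by simp
    moreover have "(T + Suc k)\<^sup>2 \<le> (T + k)\<^sup>2 + 2 * (T + Suc k)" by (simp add: power2_eq_square)
    ultimately show ?case using Suc by linarith
  qed simp
  ultimately show ?thesis using assms(1) by (metis le_iff_add)
qed

text \<open>The bound on rich lines is inserted at every threshold. The quadratic part sums like the
  inverse squares beyond \<open>T\<close>, hence the saving \<open>1 / T\<close> with 3888 = 1296 +
  2592; the linear part contributes \<open>72 * r\<close> for each of at most \<open>M\<close>
  thresholds.\<close>

lemma sum_squares_rich_lines:
  assumes P: "finite P" "inj_on fst P" and L: "finite L" and T: "2 \<le> T"
    and rich: "\<And>l. l \<in> L \<Longrightarrow> T \<le> card (points_on P l) \<and> card (points_on P l) \<le> M"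
  shows "real (\<Sum>l\<in>L. (card (points_on P l))\<^sup>2)
    \<le> 3888 * (real (card P))\<^sup>2 / real T + 36 * real (card P) * real T + 72 * real (card P) * real M"
proof -
  define r where "r = real (card P)"
  define n where "n l = card (points_on P l)" for l
  define N where "N t = real (card {l \<in> L. t \<le> n l})" for t
  have N: "N t \<le> 1296 * r\<^sup>2 / real t ^ 3 + 36 * r / real t" if "2 \<le> t" for t
    unfolding N_def r_def by (rule rich_lines_bound[OF P _ that]) (use L in \<open>auto simp: n_def\<close>)
  have "(\<Sum>l\<in>L. (n l)\<^sup>2) \<le> (\<Sum>l\<in>L. T\<^sup>2 + (\<Sum>t\<in>{T<..M}. if t \<le> n l then 2 * t else 0))"
    using rich by (intro sum_mono square_le_sum) (auto simp: n_def)
  also have "\<dots> = card L * T\<^sup>2 + (\<Sum>t\<in>{T<..M}. \<Sum>l\<in>L. if t \<le> n l then 2 * t else 0)"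
    by (simp add: sum.distrib sum.swap[of _ L])
  also have "(\<Sum>t\<in>{T<..M}. \<Sum>l\<in>L. if t \<le> n l then 2 * t else 0) = (\<Sum>t\<in>{T<..M}. 2 * t * card {l \<in> L. t \<le> n l})"
    using L by (simp add: sum.If_cases Int_def mult.commute)
  also have "card L = card {l \<in> L. T \<le> n l}"
    using rich by (intro arg_cong[where f = card]) (auto simp: n_def)
  finally have "real (\<Sum>l\<in>L. (n l)\<^sup>2) \<le> real (card {l \<in> L. T \<le> n l} * T\<^sup>2 + (\<Sum>t\<in>{T<..M}. 2 * t * card {l \<in> L. t \<le> n l}))"
    by (simp only: of_nat_le_iff)
  also have "\<dots> = N T * (real T)\<^sup>2 + (\<Sum>t\<in>{T<..M}. 2 * real t * N t)"
    by (simp add: N_def)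
  also have "\<dots> \<le> (1296 * r\<^sup>2 / real T + 36 * r * real T) + (\<Sum>t\<in>{T<..M}. 2592 * r\<^sup>2 * (1 / (real t)\<^sup>2) + 72 * r)"
  proof (intro add_mono sum_mono)
    have "N T * (real T)\<^sup>2 \<le> (1296 * r\<^sup>2 / real T ^ 3 + 36 * r / real T) * (real T)\<^sup>2"
      using N[OF T] by (intro mult_right_mono) auto
    also have "\<dots> = 1296 * r\<^sup>2 / real T + 36 * r * real T"
      using T by (simp add: power2_eq_square power3_eq_cube field_simps)
    finally show "N T * (real T)\<^sup>2 \<le> 1296 * r\<^sup>2 / real T + 36 * r * real T" .
    fix t assume "t \<in> {T<..M}"
    then have t: "2 \<le> t" using T by auto
    have "2 * real t * N t \<le> 2 * real t * (1296 * r\<^sup>2 / real t ^ 3 + 36 * r / real t)"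
      using N[OF t] by (intro mult_left_mono) auto
    also have "\<dots> = 2592 * r\<^sup>2 * (1 / (real t)\<^sup>2) + 72 * r"
      using t by (simp add: power2_eq_square power3_eq_cube field_simps)
    finally show "2 * real t * N t \<le> 2592 * r\<^sup>2 * (1 / (real t)\<^sup>2) + 72 * r" .
  qed
  also have "(\<Sum>t\<in>{T<..M}. 2592 * r\<^sup>2 * (1 / (real t)\<^sup>2) + 72 * r)
      = 2592 * r\<^sup>2 * (\<Sum>t\<in>{T<..M}. 1 / (real t)\<^sup>2) + 72 * r * real (M - T)"
    by (simp add: sum.distrib sum_distrib_left)
  also have "\<dots> \<le> 2592 * r\<^sup>2 * (1 / real T) + 72 * r * real M"
    using sum_inverse_squares[of T M] T
    by (intro add_mono mult_left_mono) (auto simp: r_def)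
  finally show ?thesis by (simp add: n_def r_def)
qed

text \<open>If both alternatives fail, the ordered pairs of distinct points are too few. Pairs on
  poor lines are bounded because few lines pass through a point, pairs on rich lines because the sum
  of squares gains a factor \<open>1 / T\<close>.\<close>

theorem weak_dirac_plane:
  assumes P: "finite P" "inj_on fst P"
  shows "(\<exists>l. card P \<le> 16000000 * card (points_on P l)) \<or>
    (\<exists>w\<in>P. card P \<le> 16000000 * card {l \<in> spanned_lines P. on_line w l})"
proof (rule ccontr)
  \<comment> \<open>With r points, poor lines cover about \<open>T / A\<close> = 1/400 of all pairs.
    Rich lines cover 3888/40000, plus \<open>36 * r * T\<close>, which is below 0.09 r^2 once r >
    \<open>A\<close>, plus a negligible term with \<open>M\<close>. The total stays well below
    1.\<close>
  define A T M where "A = (16000000::nat)" and "T = (40000::nat)" and "M = card P div A"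
  define \<Lambda> where "\<Lambda> = spanned_lines P"
  have fin: "finite \<Lambda>" using finite_spanned_lines[OF P] by (simp add: \<Lambda>_def)
  assume "\<not> ?thesis"
  then have few: "A * card (points_on P l) < card P" "w \<in> P \<Longrightarrow> A * card {l \<in> \<Lambda>. on_line w l} < card P" for l w
    unfolding A_def \<Lambda>_def by (meson not_le)+
  have M: "card (points_on P l) \<le> M" "w \<in> P \<Longrightarrow> card {l \<in> \<Lambda>. on_line w l} \<le> M" for l w
    using few(1)[of l] few(2)[of w] by (auto simp: M_def A_def less_eq_div_iff_mult_less_eq)
  have "P \<noteq> {}" using few(1) by auto
  then obtain p where p: "p \<in> P" by auto
  \<comment> \<open>The horizontal line through \<open>p\<close> contains a point, so failure of the
    first alternative already forces more than \<open>A\<close> points.\<close>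
  have "p \<in> points_on P (0, snd p)" using p by (simp add: points_on_def on_line_def)
  then have "points_on P (0, snd p) \<noteq> {}" by blast
  then have "card (points_on P (0, snd p)) \<ge> 1" using P(1) by (simp add: Suc_le_eq card_gt_0_iff points_on_def)
  then have r: "A < card P" using few(1)[of "(0, snd p)"] by (simp add: A_def)
  define rich where "rich = {l \<in> \<Lambda>. T \<le> card (points_on P l)}"
  let ?D = "P \<times> P - Id"
  \<comment> \<open>Pairs on poor lines are grouped by their first point, pairs on rich lines by the
    line.\<close>
  let ?poor = "SIGMA p:P. \<Union>l\<in>{l \<in> \<Lambda> - rich. on_line p l}. points_on P l"
  let ?rich = "\<Union>l\<in>rich. points_on P l \<times> points_on P l"
  have finp: "finite (points_on P l)" for l using P by (simp add: points_on_def)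
  have "?D \<subseteq> ?poor \<union> ?rich"
  proof
    fix z assume "z \<in> ?D"
    then obtain p q where z: "z = (p, q)" "p \<in> P" "q \<in> P" "p \<noteq> q" by auto
    then have "fst p \<noteq> fst q" using P(2) by (auto dest: inj_onD)
    note j = on_joining_line[OF this]
    then have l: "joining_line p q \<in> \<Lambda>" unfolding \<Lambda>_def spanned_lines_def using z by blast
    have "p \<in> points_on P (joining_line p q)" "q \<in> points_on P (joining_line p q)"
      using j z by (simp_all add: points_on_def)
    then show "z \<in> ?poor \<union> ?rich" using z l j by (cases "joining_line p q \<in> rich") blast+
  qed
  then have "card ?D \<le> card (?poor \<union> ?rich)"
    using P fin finp by (intro card_mono finite_UnI finite_SigmaI finite_UN_I) (auto simp: rich_def)
  also have "\<dots> \<le> card ?poor + card ?rich" by (rule card_Un_le)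
  also have "card ?poor \<le> card P * (M * T)"
  proof -
    have "card ?poor = (\<Sum>p\<in>P. card (\<Union>l\<in>{l \<in> \<Lambda> - rich. on_line p l}. points_on P l))"
      using P fin finp by (intro card_SigmaI) auto
    also have "\<dots> \<le> (\<Sum>p\<in>P. M * T)"
    proof (rule sum_mono)
      fix p assume p: "p \<in> P"
      have "card (\<Union>l\<in>{l \<in> \<Lambda> - rich. on_line p l}. points_on P l) \<le> (\<Sum>l\<in>{l \<in> \<Lambda> - rich. on_line p l}. card (points_on P l))"
        using fin by (intro card_UN_le) auto
      also have "\<dots> \<le> (\<Sum>l\<in>{l \<in> \<Lambda> - rich. on_line p l}. T)"
        by (rule sum_mono) (auto simp: rich_def)
      also have "\<dots> \<le> card {l \<in> \<Lambda>. on_line p l} * T"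
        using fin by (auto intro!: card_mono)
      also have "\<dots> \<le> M * T" using M(2)[OF p] by simp
      finally show "card (\<Union>l\<in>{l \<in> \<Lambda> - rich. on_line p l}. points_on P l) \<le> M * T" .
    qed
    finally show ?thesis by simp
  qed
  also have "card ?rich \<le> (\<Sum>l\<in>rich. (card (points_on P l))\<^sup>2)"
    using card_UN_le[of rich "\<lambda>l. points_on P l \<times> points_on P l"] fin
    by (simp add: rich_def card_cartesian_product power2_eq_square)
  finally have D1: "real (card ?D) \<le> real (card P * (M * T)) + real (\<Sum>l\<in>rich. (card (points_on P l))\<^sup>2)"
    by (simp only: of_nat_add[symmetric] of_nat_le_iff)
  have D2: "real (\<Sum>l\<in>rich. (card (points_on P l))\<^sup>2)
    \<le> 3888 * (real (card P))\<^sup>2 / real T + 36 * real (card P) * real T + 72 * real (card P) * real M"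
    using fin M(1) by (intro sum_squares_rich_lines[OF P]) (auto simp: rich_def T_def)
  have D3: "card ?D = card P * card P - card P"
  proof -
    have "?D = P \<times> P - (\<lambda>p. (p, p)) ` P" by auto
    moreover have "card ((\<lambda>p. (p, p)) ` P) = card P" by (intro card_image) (auto simp: inj_on_def)
    moreover have "(\<lambda>p. (p, p)) ` P \<subseteq> P \<times> P" by auto
    ultimately show ?thesis using P by (simp add: card_Diff_subset card_cartesian_product)
  qed
  define r where "r = real (card P)"
  define m q where "m = r * real M" and "q = r * r"
  have "real (card ?D) = q - r" unfolding D3
    by (subst of_nat_diff) (use le_square in \<open>auto simp: r_def q_def\<close>)
  moreover have "real (card P * (M * T)) = 40000 * m" by (simp add: T_def m_def r_def)
  moreover have "3888 * (real (card P))\<^sup>2 / real T + 36 * real (card P) * real T + 72 * real (card P) * real M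
      = 3888 * q / 40000 + 1440000 * r + 72 * m"
    by (simp add: T_def m_def r_def q_def power2_eq_square)
  ultimately have "q - r \<le> 40000 * m + (3888 * q / 40000 + 1440000 * r + 72 * m)"
    using D1 D2 by simp
  moreover have r': "r > 16000000" using r by (simp add: r_def A_def)
  then have "r * 16000000 < q" unfolding q_def by (intro mult_strict_left_mono) auto
  moreover have "real M \<le> r / 16000000"
    using of_nat_div_le_of_nat[of "card P" A, where 'a = real] by (simp add: M_def A_def r_def)
  then have "m \<le> r * (r / 16000000)" using r' unfolding m_def by (intro mult_left_mono) auto
  then have "m \<le> q / 16000000" by (simp add: q_def)
  ultimately show False using r' by linarith
qed

section \<open>A weak Dirac theorem for vectors\<close>

lemma generic_vector:
  fixes Z :: "'a::euclidean_space set"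
  assumes "finite Z" "0 \<notin> Z"
  shows "\<exists>u. \<forall>z\<in>Z. u \<bullet> z \<noteq> 0"
proof -
  have "negligible (\<Union>z\<in>Z. {u. z \<bullet> u = 0})"
    using assms by (intro negligible_Union) (auto intro!: negligible_hyperplane)
  then have "(\<Union>z\<in>Z. {u. z \<bullet> u = 0}) \<noteq> UNIV"
    by (metis non_negligible_UNIV)
  then show ?thesis by (auto simp: inner_commute)
qed

lemma span_singletonD: "x \<in> span {y} \<Longrightarrow> \<exists>t. x = t *\<^sub>R y"
  by (auto simp: span_singleton)

lemma span_doubletonD: "x \<in> span {y, z} \<Longrightarrow> \<exists>s t. x = s *\<^sub>R y + t *\<^sub>R z"
  by (force simp: span_insert span_singleton algebra_simps)

lemma in_span_doubleton: "s *\<^sub>R y + t *\<^sub>R z \<in> span {y, z}"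
  by (intro span_add span_scale span_base) auto

text \<open>
  The vectors are mapped to the plane by \<open>v \<mapsto> ((a \<bullet> v) / (c \<bullet> v), (b \<bullet> v) / (c \<bullet> v))\<close> with generic
  \<open>a\<close> and \<open>c\<close>; \<open>b\<close> is chosen such that \<open>a\<close>, \<open>b\<close>, \<open>c\<close> are independent on the span of \<open>V\<close>. If many
  points lie on one line, any \<open>w \<in> V\<close> off that line separates all of them.
\<close>

lemma weak_dirac_vectors:
  fixes V :: "'a::euclidean_space set"
  assumes V: "finite V" "3 \<le> dim V" and R: "R \<subseteq> V" "0 \<notin> R"
    and pw: "pairwise (\<lambda>v v'. v' \<notin> span {v}) R"
  shows "\<exists>w\<in>V. w \<noteq> 0 \<and> (\<exists>R'\<subseteq>R. card R \<le> 16000000 * card R' \<and> (\<forall>v\<in>R'. v \<notin> span {w}) \<and>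
    pairwise (\<lambda>v v'. v' \<notin> span {w, v}) R')"
proof -
  have np: "v' \<notin> span {v}" if "v \<in> R" "v' \<in> R" "v \<noteq> v'" for v v'
    using pairwiseD[OF pw that] .
  obtain B where B: "B \<subseteq> V" "independent B" "card B = dim V" by (metis basis_exists)
  obtain T where T: "T \<subseteq> B" "card T = 3" using B(3) V(2) by (metis obtain_subset_with_card_n)
  then have iT: "independent T" using B(2) independent_mono by metis
  obtain v1 v2 v3 where T3: "T = {v1, v2, v3}" "v1 \<noteq> v2" "v1 \<noteq> v3" "v2 \<noteq> v3"
    using T(2) unfolding card_3_iff by metis
  have vV: "v1 \<in> V" "v2 \<in> V" "v3 \<in> V" using T B T3 by auto
  have vn0: "v1 \<noteq> 0" "v2 \<noteq> 0" "v3 \<noteq> 0" 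
    using iT T3(1) dependent_zero[of T] by auto
  have v1: "v1 \<notin> span {v2, v3}"
  proof -
    have "T - {v1} = {v2, v3}" using T3 by auto
    then show ?thesis using iT T3 by (metis dependent_def insertI1)
  qed
  have v2: "v2 \<notin> span {v3}"
  proof -
    have "independent {v2, v3}" by (rule independent_mono[OF iT]) (use T3(1) in auto)
    moreover have "{v2, v3} - {v2} = {v3}" using T3 by auto
    ultimately show ?thesis by (metis dependent_def insertI1)
  qed
  obtain c where c: "\<And>v. v \<in> V \<Longrightarrow> v \<noteq> 0 \<Longrightarrow> c \<bullet> v \<noteq> 0"
    using generic_vector[of "V - {0}"] V(1) by auto
  \<comment> \<open>Avoiding these combinations makes the quotients
    \<open>(a \<bullet> v) / (c \<bullet> v)\<close> of non-parallel vectors different, so the image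
    points have distinct first coordinates.\<close>
  define Z where "Z = (\<lambda>(v, v'). (c \<bullet> v') *\<^sub>R v - (c \<bullet> v) *\<^sub>R v') ` (V \<times> V) - {0}"
  obtain a where a: "\<And>z. z \<in> Z \<Longrightarrow> a \<bullet> z \<noteq> 0"
    using generic_vector[of Z] V(1) by (auto simp: Z_def)
  have sep: "(a \<bullet> v) * (c \<bullet> v') \<noteq> (a \<bullet> v') * (c \<bullet> v)"
    if "v \<in> V" "v' \<in> V" "v' \<noteq> 0" "v \<notin> span {v'}" for v v'
  proof
    assume eq: "(a \<bullet> v) * (c \<bullet> v') = (a \<bullet> v') * (c \<bullet> v)"
    have "(c \<bullet> v') *\<^sub>R v - (c \<bullet> v) *\<^sub>R v' \<noteq> 0"
    proof
      assume "(c \<bullet> v') *\<^sub>R v - (c \<bullet> v) *\<^sub>R v' = 0"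
      then have "(1 / (c \<bullet> v')) *\<^sub>R ((c \<bullet> v') *\<^sub>R v) = (1 / (c \<bullet> v')) *\<^sub>R ((c \<bullet> v) *\<^sub>R v')" by simp
      then have "v = ((c \<bullet> v) / (c \<bullet> v')) *\<^sub>R v'" using c[OF that(2,3)] by simp
      then show False using that(4) by (metis span_base span_scale singletonI)
    qed
    then have "(c \<bullet> v') *\<^sub>R v - (c \<bullet> v) *\<^sub>R v' \<in> Z" using that by (auto simp: Z_def)
    from a[OF this] show False using eq by (simp add: inner_diff_right mult.commute)
  qed
  define D where "D x y = (a \<bullet> x) * (c \<bullet> y) - (a \<bullet> y) * (c \<bullet> x)" for x y
  \<comment> \<open>The expansion of a 3 by 3 determinant whose rows consist of the products with
    \<open>a\<close>, the products with \<open>c\<close>, and the vectors \<open>v1\<close>,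
    \<open>v2\<close>, \<open>v3\<close> themselves. Pairing with \<open>a\<close> or
    \<open>c\<close> repeats a row, so \<open>b\<close> is orthogonal to both.\<close>
  define b where "b = D v2 v3 *\<^sub>R v1 - D v1 v3 *\<^sub>R v2 + D v1 v2 *\<^sub>R v3"
  have ab: "a \<bullet> b = 0" "c \<bullet> b = 0"
    by (simp_all add: b_def D_def inner_add_right inner_diff_right algebra_simps)
  have D23: "D v2 v3 \<noteq> 0" using sep[OF vV(2,3) vn0(3) v2] by (simp add: D_def)
  have "b \<noteq> 0"
  proof
    assume "b = 0"
    then have eq: "D v2 v3 *\<^sub>R v1 = D v1 v3 *\<^sub>R v2 - D v1 v2 *\<^sub>R v3"
      by (simp add: b_def algebra_simps)
    have "v1 = (1 / D v2 v3) *\<^sub>R (D v2 v3 *\<^sub>R v1)" using D23 by simp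
    also have "\<dots> = (D v1 v3 / D v2 v3) *\<^sub>R v2 + (- (D v1 v2 / D v2 v3)) *\<^sub>R v3"
      unfolding eq by (simp add: scaleR_diff_right)
    finally have "v1 = (D v1 v3 / D v2 v3) *\<^sub>R v2 + (- (D v1 v2 / D v2 v3)) *\<^sub>R v3" .
    then show False using v1 in_span_doubleton by metis
  qed
  define \<pi> where "\<pi> v = ((a \<bullet> v) / (c \<bullet> v), (b \<bullet> v) / (c \<bullet> v))" for v
  \<comment> \<open>The hyperplane orthogonal to \<open>g l\<close> is the preimage of the planar
    line \<open>l\<close>.\<close>
  define g where "g l = b - fst l *\<^sub>R a - snd l *\<^sub>R c" for l :: "real \<times> real"
  have on: "on_line (\<pi> v) l \<longleftrightarrow> g l \<bullet> v = 0" if "v \<in> R" for v l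
  proof -
    have "c \<bullet> v \<noteq> 0" using c that R by blast
    then show ?thesis
      by (simp add: on_line_def \<pi>_def g_def inner_diff_left inner_add_left field_simps)
  qed
  have fst_eq: "v = v'" if "v \<in> R" "v' \<in> R" "fst (\<pi> v) = fst (\<pi> v')" for v v'
  proof (rule ccontr)
    assume "v \<noteq> v'"
    then have "(a \<bullet> v) * (c \<bullet> v') \<noteq> (a \<bullet> v') * (c \<bullet> v)"
      using that R np by (intro sep) auto
    moreover have "c \<bullet> v \<noteq> 0" "c \<bullet> v' \<noteq> 0" using c that R by blast+
    ultimately show False using that(3) by (simp add: \<pi>_def field_simps)
  qed
  have inj: "inj_on \<pi> R" "inj_on fst (\<pi> ` R)" using fst_eq by (auto simp: inj_on_def)
  have finR: "finite R" using V(1) R(1) finite_subset by blast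
  have cR: "card (\<pi> ` R) = card R" by (rule card_image[OF inj(1)])
  consider l where "card R \<le> 16000000 * card (points_on (\<pi> ` R) l)"
    | w where "w \<in> R" "card R \<le> 16000000 * card {l \<in> spanned_lines (\<pi> ` R). on_line (\<pi> w) l}"
    using weak_dirac_plane[OF _ inj(2)] finR cR by auto
  then show ?thesis
  proof cases
    case 1
    define R' where "R' = {v \<in> R. on_line (\<pi> v) l}"
    have "points_on (\<pi> ` R) l = \<pi> ` R'" by (auto simp: points_on_def R'_def)
    then have "card (points_on (\<pi> ` R) l) = card R'"
      using inj_on_subset[OF inj(1)] by (simp add: card_image R'_def)
    then have cd: "card R \<le> 16000000 * card R'" using 1 by simp
    have gR: "g l \<bullet> v = 0" "v \<in> R" "v \<noteq> 0" if "v \<in> R'" for v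
      using that on[of v l] R(2) by (auto simp: R'_def)
    \<comment> \<open>As \<open>b\<close> is a combination of the three vectors and
      \<open>g l \<bullet> b = b \<bullet> b\<close> is positive, one of them is off the preimage of
      \<open>l\<close>. All vectors of \<open>R'\<close> lie in this preimage, so they stay pairwise
      non-parallel modulo that vector.\<close>
    have "\<exists>w\<in>{v1, v2, v3}. g l \<bullet> w \<noteq> 0"
    proof (rule ccontr)
      assume "\<not> ?thesis"
      then have "g l \<bullet> b = 0" by (simp add: b_def inner_add_right inner_diff_right)
      moreover have "g l \<bullet> b = b \<bullet> b" using ab by (simp add: g_def inner_diff_left)
      ultimately show False using \<open>b \<noteq> 0\<close> by simp
    qed
    then obtain w where w: "w \<in> V" "g l \<bullet> w \<noteq> 0" using vV by auto
    have "v \<notin> span {w}" if "v \<in> R'" for v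
    proof
      assume "v \<in> span {w}"
      then obtain t where "v = t *\<^sub>R w" using span_singletonD by blast
      then show False using gR[OF that] w by simp
    qed
    moreover have "v' \<notin> span {w, v}" if "v \<in> R'" "v' \<in> R'" "v \<noteq> v'" for v v'
    proof
      assume "v' \<in> span {w, v}"
      then obtain s t where e: "v' = s *\<^sub>R w + t *\<^sub>R v" using span_doubletonD by blast
      then have "s = 0" using gR(1)[OF that(1)] gR(1)[OF that(2)] w by (simp add: inner_add_right)
      then have "v' \<in> span {v}" using e by (simp add: span_base span_scale)
      then show False using np gR that by blast
    qed
    then have "pairwise (\<lambda>v v'. v' \<notin> span {w, v}) R'" by (simp add: pairwise_def)
    moreover have "R' \<subseteq> R" "w \<noteq> 0" using w by (auto simp: R'_def)
    ultimately show ?thesis using w(1) cd by blast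
  next
    case 2
    let ?L = "{l \<in> spanned_lines (\<pi> ` R). on_line (\<pi> w) l}"
    have ex: "\<exists>v. v \<in> R \<and> v \<noteq> w \<and> on_line (\<pi> v) l" if "l \<in> ?L" for l
    proof -
      have "l \<in> spanned_lines (\<pi> ` R)" using that by simp
      then obtain x y where xy: "x \<in> R" "y \<in> R" "\<pi> x \<noteq> \<pi> y" "on_line (\<pi> x) l" "on_line (\<pi> y) l"
        unfolding spanned_lines_def by (elim CollectE bexE imageE conjE) simp
      then have "x \<noteq> w \<or> y \<noteq> w" by metis
      then show ?thesis using xy by metis
    qed
    \<comment> \<open>One vector per connecting line through the image of \<open>w\<close>.
      Different lines through this image correspond to different planes through \<open>w\<close>, so
      the representatives are pairwise non-parallel modulo \<open>w\<close>.\<close>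
    define rep where "rep l = (SOME v. v \<in> R \<and> v \<noteq> w \<and> on_line (\<pi> v) l)" for l
    have rep: "rep l \<in> R" "rep l \<noteq> w" "on_line (\<pi> (rep l)) l" if "l \<in> ?L" for l
      using someI_ex[OF ex[OF that], folded rep_def] by simp_all
    have det: "l = l'" if "l \<in> ?L" "l' \<in> ?L" "on_line (\<pi> (rep l)) l'" for l l'
    proof (rule line_eqI)
      show "fst (\<pi> w) \<noteq> fst (\<pi> (rep l))" using fst_eq[OF 2(1) rep(1)[OF that(1)]] rep(2)[OF that(1)] by metis
      show "on_line (\<pi> w) l" "on_line (\<pi> w) l'" using that(1,2) by simp_all
    qed (rule rep(3)[OF that(1)] that(3))+
    have "inj_on rep ?L"
    proof (rule inj_onI)
      fix l l' assume l: "l \<in> ?L" "l' \<in> ?L" "rep l = rep l'"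
      show "l = l'" by (rule det[OF l(1,2)]) (use rep(3)[OF l(2)] l(3) in simp)
    qed
    then have "card (rep ` ?L) = card ?L" by (rule card_image)
    then have cd: "card R \<le> 16000000 * card (rep ` ?L)" using 2(2) by (simp only:)
    have "v \<notin> span {w}" if v: "v \<in> rep ` ?L" for v
    proof -
      obtain l where "l \<in> ?L" "v = rep l" using v by (rule imageE) (rule that)
      then show ?thesis using rep(1,2)[of l] np[OF 2(1), of v] by simp
    qed
    moreover have "v' \<notin> span {w, v}" if vv: "v \<in> rep ` ?L" "v' \<in> rep ` ?L" "v \<noteq> v'" for v v'
    proof
      assume sp: "v' \<in> span {w, v}"
      obtain l where l1: "l \<in> ?L" "v = rep l" using vv(1) by (rule imageE) (rule that)
      obtain l' where l2: "l' \<in> ?L" "v' = rep l'" using vv(2) by (rule imageE) (rule that)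
      note l = l1 l2
      obtain s t where e: "v' = s *\<^sub>R w + t *\<^sub>R v" using span_doubletonD[OF sp] by (elim exE)
      have "g l \<bullet> w = 0" using on[OF 2(1)] l(1) by simp
      moreover have "g l \<bullet> v = 0" using on[OF rep(1)[OF l(1)]] rep(3)[OF l(1)] l(2) by simp
      ultimately have "on_line (\<pi> v') l" using e on[OF rep(1)[OF l(3)]] l(4) by (simp add: inner_add_right)
      then have "l' = l" using det[OF l(3) l(1)] l(4) by simp
      then show False using l vv by simp
    qed
    then have "pairwise (\<lambda>v v'. v' \<notin> span {w, v}) (rep ` ?L)" by (rule pairwiseI)
    moreover have "rep ` ?L \<subseteq> R" using rep(1) by (intro image_subsetI)
    moreover have "w \<in> V" "w \<noteq> 0" using 2(1) R by auto
    ultimately show ?thesis using cd by blast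
  qed
qed

text \<open>Each step factors out one vector \<open>w\<close> and lowers the dimension by one, while
  a fixed proportion of \<open>R\<close> stays nonzero and pairwise non-parallel. The two vectors
  \<open>x\<close>, \<open>y\<close> record that \<open>S\<close> spans a space of codimension at
  most 2; with \<open>card S \<le> D\<close> this makes its dimension exactly
  \<open>D\<close>.\<close>

lemma weak_dirac_iterated:
  fixes V :: "'a::euclidean_space set"
  assumes "finite V" "dim V = D + 2" "R \<subseteq> V" "0 \<notin> R"
    and "pairwise (\<lambda>v v'. v' \<notin> span {v}) R"
  shows "\<exists>S\<subseteq>V. card S \<le> D \<and> (\<exists>x y. V \<subseteq> span (S \<union> {x, y})) \<and>
    (\<exists>R'\<subseteq>R. card R \<le> 16000000 ^ D * card R' \<and> (\<forall>v\<in>R'. v \<notin> span S) \<and>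
      pairwise (\<lambda>v v'. v' \<notin> span (insert v S)) R')"
  using assms
proof (induction D arbitrary: V R)
  case 0
  obtain B where B: "B \<subseteq> V" "independent B" "V \<subseteq> span B" "card B = dim V" by (metis basis_exists)
  then have "card B = 2" using 0(2) by simp
  then obtain x y where "B = {x, y}" by (meson card_2_iff)
  then have xy: "V \<subseteq> span ({} \<union> {x, y})" using B by simp
  show ?case
  proof (rule exI[of _ "{}"], intro conjI)
    show "\<exists>x y. V \<subseteq> span ({} \<union> {x, y})" using xy by (intro exI)
    show "\<exists>R'\<subseteq>R. card R \<le> 16000000 ^ 0 * card R' \<and> (\<forall>v\<in>R'. v \<notin> span {}) \<and>
      pairwise (\<lambda>v v'. v' \<notin> span {v}) R'"
    proof (rule exI[of _ R], intro conjI ballI)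
      show "v \<notin> span {}" if "v \<in> R" for v using that 0(4) by auto
    qed (use 0(5) in simp_all)
  qed simp_all
next
  case (Suc D)
  obtain w R1 where w: "w \<in> V" "w \<noteq> 0" and R1: "R1 \<subseteq> R" "card R \<le> 16000000 * card R1"
    "\<And>v. v \<in> R1 \<Longrightarrow> v \<notin> span {w}"
    "\<And>v v'. v \<in> R1 \<Longrightarrow> v' \<in> R1 \<Longrightarrow> v \<noteq> v' \<Longrightarrow> v' \<notin> span {w, v}"
  proof -
    have "3 \<le> dim V" using Suc.prems(2) by simp
    from weak_dirac_vectors[OF Suc.prems(1) this Suc.prems(3-5)] show ?thesis
      by (elim bexE conjE exE) (rule that, (assumption | erule (1) bspec | erule (3) pairwiseD)+)
  qed
  \<comment> \<open>The orthogonal projection along \<open>w\<close> models the quotient by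
    \<open>w\<close> inside the same type, so the induction hypothesis applies.\<close>
  define \<pi> where "\<pi> x = x - ((x \<bullet> w) / (w \<bullet> w)) *\<^sub>R w" for x :: 'a
  have lin: "linear \<pi>"
    unfolding \<pi>_def by (rule linearI) (simp_all add: inner_add_left add_divide_distrib algebra_simps)
  have \<pi>w: "\<pi> w = 0" using w by (simp add: \<pi>_def)
  have orth: "\<pi> x \<bullet> w = 0" for x using w by (simp add: \<pi>_def inner_diff_left)
  have decomp: "x \<in> span X" if "\<pi> x \<in> span X" "w \<in> span X" for x X
  proof -
    have "x = \<pi> x + ((x \<bullet> w) / (w \<bullet> w)) *\<^sub>R w" by (simp add: \<pi>_def)
    then show ?thesis using that by (metis span_add span_scale)
  qed
  have sub: "\<pi> ` X \<subseteq> span (insert w X)" for X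
    unfolding \<pi>_def by (auto intro!: span_diff span_scale intro: span_base)
  \<comment> \<open>The dictionary of the induction: a span after projection is a span together with
    \<open>w\<close> before it.\<close>
  have proj: "\<pi> x \<in> span (\<pi> ` X) \<longleftrightarrow> x \<in> span (insert w X)" for x X
  proof
    assume "\<pi> x \<in> span (\<pi> ` X)"
    then have "\<pi> x \<in> span (insert w X)" using span_minimal[OF sub subspace_span] by blast
    then show "x \<in> span (insert w X)" by (rule decomp) (simp add: span_base)
  next
    assume "x \<in> span (insert w X)"
    then have "\<pi> x \<in> span (\<pi> ` insert w X)" using linear_span_image[OF lin] by blast
    then show "\<pi> x \<in> span (\<pi> ` X)" by (simp add: \<pi>w)
  qed
  have dimV: "dim (\<pi> ` V) = D + 2"
  proof -
    have "w \<notin> span (\<pi> ` V)"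
    proof
      assume "w \<in> span (\<pi> ` V)"
      moreover have "span (\<pi> ` V) \<subseteq> {x. w \<bullet> x = 0}"
        using orth by (intro span_minimal subspace_hyperplane) (auto simp: inner_commute)
      ultimately show False using w by auto
    qed
    then have "dim (insert w (\<pi> ` V)) = Suc (dim (\<pi> ` V))" by (simp add: dim_insert)
    moreover have "span (insert w (\<pi> ` V)) = span V"
    proof
      show "span (insert w (\<pi> ` V)) \<subseteq> span V"
        using sub[of V] w(1) by (intro span_minimal) (auto simp: insert_absorb span_base)
      have "v \<in> span (insert w (\<pi> ` V))" if "v \<in> V" for v
        by (rule decomp) (use that in \<open>auto intro: span_base\<close>)
      then show "span V \<subseteq> span (insert w (\<pi> ` V))" by (intro span_minimal) auto
    qed
    ultimately show ?thesis using Suc.prems(2) by (metis add_Suc dim_span old.nat.inject)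
  qed
  have inj: "inj_on \<pi> R1"
  proof (rule inj_onI, rule ccontr)
    fix v v' assume "v \<in> R1" "v' \<in> R1" "\<pi> v = \<pi> v'" "v \<noteq> v'"
    moreover have "\<pi> v \<in> span (\<pi> ` {v})" by (simp add: span_base)
    ultimately show False using R1(4)[of v v'] proj[of v' "{v}"] by simp
  qed
  have "\<exists>S\<subseteq>\<pi> ` V. card S \<le> D \<and> (\<exists>x y. \<pi> ` V \<subseteq> span (S \<union> {x, y})) \<and>
    (\<exists>R'\<subseteq>\<pi> ` R1. card (\<pi> ` R1) \<le> 16000000 ^ D * card R' \<and> (\<forall>v\<in>R'. v \<notin> span S) \<and>
      pairwise (\<lambda>v v'. v' \<notin> span (insert v S)) R')"
  proof (rule Suc.IH)
    show "0 \<notin> \<pi> ` R1"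
    proof
      assume "0 \<in> \<pi> ` R1"
      then obtain v where "v \<in> R1" "\<pi> v = 0" by auto
      then show False using proj[of v "{}"] R1(3) by simp
    qed
    have "\<pi> v' \<notin> span {\<pi> v}" if "v \<in> R1" "v' \<in> R1" "v \<noteq> v'" for v v'
      using proj[of v' "{v}"] R1(4) that by simp
    then show "pairwise (\<lambda>v v'. v' \<notin> span {v}) (\<pi> ` R1)"
      unfolding pairwise_image by (auto simp: pairwise_def)
  qed (use Suc.prems(1,3) R1(1) dimV in auto)
  then obtain S where S1: "S \<subseteq> \<pi> ` V \<and> card S \<le> D \<and> (\<exists>x y. \<pi> ` V \<subseteq> span (S \<union> {x, y})) \<and>
    (\<exists>R'\<subseteq>\<pi> ` R1. card (\<pi> ` R1) \<le> 16000000 ^ D * card R' \<and> (\<forall>v\<in>R'. v \<notin> span S) \<and>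
      pairwise (\<lambda>v v'. v' \<notin> span (insert v S)) R')"
    by (elim exE)
  then obtain x y where S: "S \<subseteq> \<pi> ` V" "card S \<le> D" "\<pi> ` V \<subseteq> span (S \<union> {x, y})" by (elim conjE exE)
  from S1 obtain R' where R': "R' \<subseteq> \<pi> ` R1" "card (\<pi> ` R1) \<le> 16000000 ^ D * card R'" "\<And>v. v \<in> R' \<Longrightarrow> v \<notin> span S"
      "\<And>v v'. v \<in> R' \<Longrightarrow> v' \<in> R' \<Longrightarrow> v \<noteq> v' \<Longrightarrow> v' \<notin> span (insert v S)"
    unfolding pairwise_def by (elim conjE exE) metis
  \<comment> \<open>The sets are lifted to preimages on which the projection is injective, so that
    cardinalities are preserved.\<close>
  obtain S0 where S0: "S0 \<subseteq> V" "inj_on \<pi> S0" "S = \<pi> ` S0" using S(1) unfolding subset_image_inj by metis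
  obtain R2 where R2: "R2 \<subseteq> R1" "inj_on \<pi> R2" "R' = \<pi> ` R2" using R'(1) unfolding subset_image_inj by metis
  have "card R \<le> 16000000 * card (\<pi> ` R1)" using R1(2) by (simp add: card_image[OF inj])
  also have "\<dots> \<le> 16000000 * (16000000 ^ D * card R')" using R'(2) by simp
  finally have cd: "card R \<le> 16000000 ^ Suc D * card R2" using R2 by (simp add: card_image mult.assoc)
  have xy: "V \<subseteq> span (insert w S0 \<union> {x, y})"
  proof
    fix v assume "v \<in> V"
    then have v: "\<pi> v \<in> span (S \<union> {x, y})" using S(3) by (meson image_subset_iff)
    have "S \<subseteq> span (insert w S0)" using sub[of S0] S0(3) by simp
    moreover have "span (insert w S0) \<subseteq> span (insert w S0 \<union> {x, y})" by (rule span_mono) auto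
    ultimately have "S \<subseteq> span (insert w S0 \<union> {x, y})" by (rule order.trans)
    moreover have "{x, y} \<subseteq> span (insert w S0 \<union> {x, y})" by (simp add: span_base)
    ultimately have "S \<union> {x, y} \<subseteq> span (insert w S0 \<union> {x, y})" by (rule Un_least)
    then have "span (S \<union> {x, y}) \<subseteq> span (insert w S0 \<union> {x, y})" by (rule span_minimal) simp
    then have "\<pi> v \<in> span (insert w S0 \<union> {x, y})" using v by (rule subsetD)
    then show "v \<in> span (insert w S0 \<union> {x, y})" by (rule decomp) (simp add: span_base)
  qed
  show ?case
  proof (rule exI[of _ "insert w S0"], intro conjI)
    show "insert w S0 \<subseteq> V" using w(1) S0(1) by simp
    show "card (insert w S0) \<le> Suc D"
      using S(2) S0 card_insert_le_m1[of "Suc D" S0 w] by (simp add: card_image)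
    show "\<exists>x y. V \<subseteq> span (insert w S0 \<union> {x, y})" using xy by (intro exI)
    show "\<exists>R'\<subseteq>R. card R \<le> 16000000 ^ Suc D * card R' \<and> (\<forall>v\<in>R'. v \<notin> span (insert w S0)) \<and>
      pairwise (\<lambda>v v'. v' \<notin> span (insert v (insert w S0))) R'"
    proof (rule exI[of _ R2], intro conjI ballI pairwiseI)
      show "R2 \<subseteq> R" using R2(1) R1(1) by (rule order.trans)
      show "v \<notin> span (insert w S0)" if "v \<in> R2" for v
      proof -
        have "\<pi> v \<in> R'" using that R2(3) by simp
        from R'(3)[OF this] show ?thesis using proj[of v S0] S0(3) by simp
      qed
      fix v v' assume v: "v \<in> R2" "v' \<in> R2" "v \<noteq> v'"
      then have "\<pi> v \<noteq> \<pi> v'" using R2(2) inj_on_contraD by metis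
      moreover have "\<pi> v \<in> R'" "\<pi> v' \<in> R'" using v(1,2) R2(3) by simp_all
      ultimately have no: "\<pi> v' \<notin> span (insert (\<pi> v) S)" by (intro R'(4))
      have "insert v (insert w S0) = insert w (insert v S0)" by (rule insert_commute)
      moreover have "v' \<notin> span (insert w (insert v S0))"
      proof
        assume "v' \<in> span (insert w (insert v S0))"
        then have "\<pi> v' \<in> span (\<pi> ` insert v S0)" by (rule iffD2[OF proj])
        then show False using no S0(3) by simp
      qed
      ultimately show "v' \<notin> span (insert v (insert w S0))" by (simp only: not_False_eq_True)
    qed (rule cd)
  qed
qed

section \<open>The upper bound\<close>

definition normal_of :: "'a::euclidean_space set \<Rightarrow> 'a" where
  "normal_of H = (SOME a. a \<noteq> 0 \<and> (\<exists>b. H = {x. a \<bullet> x = b}))"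

lemma normal_of:
  assumes "hyperplane H"
  shows "normal_of H \<noteq> 0" "\<exists>b. H = {x. normal_of H \<bullet> x = b}"
proof -
  have "\<exists>a. a \<noteq> 0 \<and> (\<exists>b. H = {x. a \<bullet> x = b})" using assms unfolding hyperplane_def by metis
  from someI_ex[OF this, folded normal_of_def]
  show "normal_of H \<noteq> 0" "\<exists>b. H = {x. normal_of H \<bullet> x = b}" by simp_all
qed

lemma hyperplane_through:
  assumes "hyperplane H" "p \<in> H" shows "x \<in> H \<longleftrightarrow> normal_of H \<bullet> (x - p) = 0"
proof -
  obtain b where "H = {x. normal_of H \<bullet> x = b}" using normal_of(2)[OF assms(1)] by (elim exE)
  then have "x \<in> H \<longleftrightarrow> normal_of H \<bullet> x = b" "normal_of H \<bullet> p = b" using assms(2) by blast+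
  then show ?thesis by (simp add: inner_diff_right)
qed

definition is_line :: "'a::euclidean_space set \<Rightarrow> bool" where
  "is_line l \<longleftrightarrow> (\<exists>p w. w \<noteq> 0 \<and> l = range (\<lambda>t. p + t *\<^sub>R w))"

lemma not_in_span_orthogonal:
  fixes x :: "'a::euclidean_space"
  assumes "x \<notin> span T" shows "\<exists>y. (\<forall>s\<in>T. s \<bullet> y = 0) \<and> x \<bullet> y \<noteq> 0"
proof -
  obtain y z where yz: "y \<in> span T" "\<And>w. w \<in> span T \<Longrightarrow> orthogonal z w" "x = y + z"
    using orthogonal_subspace_decomp_exists by metis
  have "z \<noteq> 0" using yz assms by auto
  moreover have "y \<bullet> z = 0" using yz(2)[OF yz(1)] by (simp add: orthogonal_def inner_commute)
  ultimately have "x \<bullet> z \<noteq> 0" using yz(3) by (simp add: inner_add_left)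
  moreover have "s \<bullet> z = 0" if "s \<in> T" for s
    using yz(2)[OF span_base[OF that]] by (simp add: orthogonal_def inner_commute)
  ultimately show ?thesis by blast
qed

lemma orthogonal_line:
  fixes T :: "'a::euclidean_space set"
  assumes "dim T + 1 = DIM('a)"
  shows "\<exists>w. w \<noteq> 0 \<and> {y. \<forall>s\<in>T. s \<bullet> y = 0} = range (\<lambda>t. t *\<^sub>R w)"
proof -
  let ?O = "{y. \<forall>s\<in>T. s \<bullet> y = 0}"
  have "?O = {y \<in> UNIV. \<forall>x\<in>span T. orthogonal x y}"
  proof (intro subset_antisym subsetI CollectI conjI ballI)
    fix y x assume "y \<in> ?O" "x \<in> span T"
    then have "T \<subseteq> {x. y \<bullet> x = 0}" by (auto simp: inner_commute)
    then have "span T \<subseteq> {x. y \<bullet> x = 0}" by (intro span_minimal subspace_hyperplane)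
    with \<open>x \<in> span T\<close> show "orthogonal x y" by (auto simp: orthogonal_def inner_commute)
  qed (auto simp: orthogonal_def intro: span_base)
  then have "dim ?O + dim (span T) = DIM('a)"
    using dim_subspace_orthogonal_to_vectors[of "span T" UNIV] by simp
  then have "dim ?O = 1" using assms by simp
  moreover obtain B where B: "B \<subseteq> ?O" "independent B" "?O \<subseteq> span B" "card B = dim ?O"
    by (rule basis_exists)
  ultimately obtain w where w: "B = {w}" by (metis card_1_singletonE)
  have "w \<noteq> 0" using B(2) w dependent_zero[of B] by auto
  moreover have "?O = range (\<lambda>t. t *\<^sub>R w)"
  proof
    show "?O \<subseteq> range (\<lambda>t. t *\<^sub>R w)" using B(3) w by (simp add: span_singleton)
    have "w \<in> ?O" using B(1) w by simp
    then show "range (\<lambda>t. t *\<^sub>R w) \<subseteq> ?O" by auto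
  qed
  ultimately show ?thesis by metis
qed

text \<open>A direction orthogonal to all normals at \<open>p\<close> could be added to
  \<open>p\<close> without leaving any hyperplane through \<open>p\<close>, so \<open>p\<close>
  would not be an isolated intersection.\<close>

lemma normals_at_vertex_span:
  fixes \<H> :: "'a::euclidean_space set set"
  assumes "\<forall>H\<in>\<H>. hyperplane H" "p \<in> arrangement_vertices \<H>"
  shows "span (normal_of ` {H \<in> \<H>. p \<in> H}) = UNIV"
proof (rule ccontr)
  assume "\<not> ?thesis"
  then obtain x where "x \<notin> span (normal_of ` {H \<in> \<H>. p \<in> H})" by auto
  from not_in_span_orthogonal[OF this]
  obtain y where y: "\<forall>s\<in>normal_of ` {H \<in> \<H>. p \<in> H}. s \<bullet> y = 0" "x \<bullet> y \<noteq> 0"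
    by (elim exE conjE)
  obtain S where S: "S \<subseteq> \<H>" "\<Inter>S = {p}" using assms(2) by (auto simp: arrangement_vertices_def)
  have "p + y \<in> \<Inter>S"
  proof
    fix H assume H: "H \<in> S"
    then have "p \<in> H" "H \<in> \<H>" using S by auto
    then show "p + y \<in> H" using hyperplane_through[of H p "p + y"] y(1) assms(1) by simp
  qed
  then show False using S(2) y(2) by simp
qed

text \<open>
  The flat \<open>\<Inter>\<S>\<close> is a plane through \<open>p\<close> in which a fixed proportion of the hyperplanes of \<open>\<R>\<close>
  cut out pairwise distinct lines.
\<close>

lemma vertex_flat:
  fixes \<H> :: "'a::euclidean_space set set"
  assumes \<H>: "finite \<H>" "\<forall>H\<in>\<H>. hyperplane H" and p: "p \<in> arrangement_vertices \<H>"
    and d: "DIM('a) = D + 2" and \<R>: "\<R> \<subseteq> {H \<in> \<H>. p \<in> H}"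
  shows "\<exists>\<S>\<subseteq>{H \<in> \<H>. p \<in> H}. card \<S> \<le> D \<and>
    (\<exists>\<R>'\<subseteq>\<R>. card \<R> \<le> 16000000 ^ D * card \<R>' \<and>
      (\<forall>H\<in>\<R>'. is_line (H \<inter> \<Inter>\<S>)) \<and> inj_on (\<lambda>H. H \<inter> \<Inter>\<S>) \<R>')"
proof -
  let ?Hp = "{H \<in> \<H>. p \<in> H}"
  let ?V = "normal_of ` ?Hp"
  have thru: "x \<in> H \<longleftrightarrow> normal_of H \<bullet> (x - p) = 0" if "H \<in> ?Hp" for H x
    using hyperplane_through[of H p x] that \<H>(2) by simp
  have nz: "normal_of H \<noteq> 0" if "H \<in> ?Hp" for H using normal_of(1)[of H] \<H>(2) that by simp
  \<comment> \<open>All these hyperplanes contain \<open>p\<close>, so parallel normals mean equal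
    hyperplanes; the normals thus meet the non-parallelism hypothesis of the weak Dirac
    theorem.\<close>
  have par: "H = H'" if H: "H \<in> ?Hp" "H' \<in> ?Hp" "normal_of H' \<in> span {normal_of H}" for H H'
  proof -
    obtain t where t: "normal_of H' = t *\<^sub>R normal_of H" using span_singletonD[OF H(3)] by (elim exE)
    then have "t \<noteq> 0" using nz[OF H(2)] by auto
    then have "x \<in> H' \<longleftrightarrow> x \<in> H" for x using thru[OF H(1)] thru[OF H(2)] t by simp
    then show ?thesis by blast
  qed
  have inj: "inj_on normal_of ?Hp" by (rule inj_onI) (rule par, simp_all add: span_base)
  have spanV: "span ?V = UNIV" by (rule normals_at_vertex_span[OF \<H>(2) p])
  have dimV: "dim ?V = D + 2"
    using d arg_cong[OF spanV, of dim] by simp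
  have pw: "pairwise (\<lambda>v v'. v' \<notin> span {v}) (normal_of ` \<R>)"
    using par \<R> unfolding pairwise_image by (auto simp: pairwise_def)
  have n0: "0 \<notin> normal_of ` \<R>" using nz \<R> by force
  have sub: "normal_of ` \<R> \<subseteq> ?V" using \<R> by (rule image_mono)
  have "finite ?V" using \<H>(1) by simp
  from weak_dirac_iterated[OF this dimV sub n0 pw] obtain S where S1: "S \<subseteq> ?V \<and> card S \<le> D \<and> (\<exists>x y. ?V \<subseteq> span (S \<union> {x, y})) \<and>
    (\<exists>R'\<subseteq>normal_of ` \<R>. card (normal_of ` \<R>) \<le> 16000000 ^ D * card R' \<and> (\<forall>v\<in>R'. v \<notin> span S) \<and>
      pairwise (\<lambda>v v'. v' \<notin> span (insert v S)) R')"
    by (elim exE)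
  then obtain x y where S: "S \<subseteq> ?V" "card S \<le> D" "?V \<subseteq> span (S \<union> {x, y})" by (elim conjE exE)
  from S1 have "\<exists>R'\<subseteq>normal_of ` \<R>. card (normal_of ` \<R>) \<le> 16000000 ^ D * card R' \<and>
      (\<forall>v\<in>R'. v \<notin> span S) \<and> pairwise (\<lambda>v v'. v' \<notin> span (insert v S)) R'"
    by (elim conjE)
  then obtain R' where R0: "R' \<subseteq> normal_of ` \<R> \<and> card (normal_of ` \<R>) \<le> 16000000 ^ D * card R' \<and>
      (\<forall>v\<in>R'. v \<notin> span S) \<and> pairwise (\<lambda>v v'. v' \<notin> span (insert v S)) R'"
    by (rule exE)
  then have R': "R' \<subseteq> normal_of ` \<R>" "card (normal_of ` \<R>) \<le> 16000000 ^ D * card R'"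
    "\<And>v. v \<in> R' \<Longrightarrow> v \<notin> span S" "pairwise (\<lambda>v v'. v' \<notin> span (insert v S)) R'"
    by simp_all
  obtain \<S> where \<S>: "\<S> \<subseteq> ?Hp" "inj_on normal_of \<S>" "S = normal_of ` \<S>"
    using S(1) unfolding subset_image_inj by metis
  obtain \<R>' where \<R>': "\<R>' \<subseteq> \<R>" "inj_on normal_of \<R>'" "R' = normal_of ` \<R>'"
    using R'(1) unfolding subset_image_inj by metis
  have flat: "z \<in> H \<inter> \<Inter>\<S> \<longleftrightarrow> (\<forall>s\<in>insert (normal_of H) S. s \<bullet> (z - p) = 0)" if "H \<in> ?Hp" for H z
    unfolding \<S>(3) using thru[OF that, of z] thru[of _ z] \<S>(1) by (simp add: subset_iff) 
  have line: "is_line (H \<inter> \<Inter>\<S>)" if H: "H \<in> \<R>'" for H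
  proof -
    have Hp: "H \<in> ?Hp" using H \<R>'(1) \<R> by (meson subsetD)
    have fS: "finite S" using S(1) \<open>finite ?V\<close> by (rule finite_subset)
    have "normal_of H \<notin> span S" using R'(3) H \<R>'(3) by simp
    then have 1: "dim (insert (normal_of H) S) = Suc (dim S)" by (simp add: dim_insert)
    have "dim S \<le> D" using dim_le_card'[OF fS] S(2) by simp
    \<comment> \<open>Two more vectors complete \<open>S\<close> to a spanning set. Hence
      \<open>S\<close> is independent in effect, its flat is a plane, and one further normal outside
      its span cuts out a line.\<close>
    moreover have "D + 2 \<le> dim S + 2"
    proof -
      have "UNIV \<subseteq> span (S \<union> {x, y})" using S(3) spanV span_minimal[OF S(3)] by simp
      then have "DIM('a) \<le> dim (S \<union> {x, y})" using dim_span[of "S \<union> {x, y}"] by (simp add: top.extremum_unique)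
      also have "S \<union> {x, y} = insert x (insert y S)" by auto
      also have "dim \<dots> \<le> dim S + 2" by (simp add: dim_insert)
      finally show ?thesis using d by simp
    qed
    ultimately have "dim (insert (normal_of H) S) + 1 = DIM('a)" using 1 d by simp
    from orthogonal_line[OF this] obtain w
      where w: "w \<noteq> 0" "{y. \<forall>s\<in>insert (normal_of H) S. s \<bullet> y = 0} = range (\<lambda>t. t *\<^sub>R w)"
      by (elim exE conjE)
    have "H \<inter> \<Inter>\<S> = range (\<lambda>t. p + t *\<^sub>R w)"
    proof (rule set_eqI)
      fix z
      have "z \<in> H \<inter> \<Inter>\<S> \<longleftrightarrow> z - p \<in> {y. \<forall>s\<in>insert (normal_of H) S. s \<bullet> y = 0}"
        using flat[OF Hp, of z] by simp
      also have "\<dots> \<longleftrightarrow> z - p \<in> range (\<lambda>t. t *\<^sub>R w)" unfolding w(2) ..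
      also have "\<dots> \<longleftrightarrow> z \<in> range (\<lambda>t. p + t *\<^sub>R w)" by (auto simp: image_iff algebra_simps)
      finally show "z \<in> H \<inter> \<Inter>\<S> \<longleftrightarrow> z \<in> range (\<lambda>t. p + t *\<^sub>R w)" .
    qed
    then show ?thesis unfolding is_line_def using w(1) by metis
  qed
  \<comment> \<open>A direction orthogonal to \<open>S\<close> and to the normal of
    \<open>H\<close>, but not to that of \<open>H'\<close>, leads from \<open>p\<close> to a point
    on the first line and off the second.\<close>
  have injl: "inj_on (\<lambda>H. H \<inter> \<Inter>\<S>) \<R>'"
  proof (rule inj_onI, rule ccontr)
    fix H H' assume H: "H \<in> \<R>'" "H' \<in> \<R>'" "H \<inter> \<Inter>\<S> = H' \<inter> \<Inter>\<S>" "H \<noteq> H'"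
    have Hp: "H \<in> ?Hp" "H' \<in> ?Hp" using H \<R>'(1) \<R> by (meson subsetD)+
    have "normal_of H \<in> R'" "normal_of H' \<in> R'" using H \<R>'(3) by simp_all
    moreover have "normal_of H \<noteq> normal_of H'" using H \<R>'(2) by (meson inj_onD)
    ultimately have "normal_of H' \<notin> span (insert (normal_of H) S)" using R'(4) by (simp add: pairwise_def)
    from not_in_span_orthogonal[OF this]
    obtain y where y: "\<forall>s\<in>insert (normal_of H) S. s \<bullet> y = 0" "normal_of H' \<bullet> y \<noteq> 0"
      by (elim exE conjE)
    have "p + y \<in> H \<inter> \<Inter>\<S>" using flat[OF Hp(1), of "p + y"] y(1) by simp
    moreover have "p + y \<notin> H'" using thru[OF Hp(2), of "p + y"] y(2) by simp
    ultimately show False using H(3) by blast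
  qed
  have cS: "card \<S> \<le> D" using S(2) \<S> by (simp add: card_image)
  have cR: "card \<R> \<le> 16000000 ^ D * card \<R>'"
    using R'(2) \<R>' card_image[OF inj_on_subset[OF inj \<R>]] by (simp add: card_image)
  show ?thesis
  proof (rule exI[of _ \<S>], intro conjI)
    show "\<exists>\<R>'\<subseteq>\<R>. card \<R> \<le> 16000000 ^ D * card \<R>' \<and>
      (\<forall>H\<in>\<R>'. is_line (H \<inter> \<Inter>\<S>)) \<and> inj_on (\<lambda>H. H \<inter> \<Inter>\<S>) \<R>'"
      by (rule exI[of _ \<R>'], intro conjI ballI \<R>'(1) cR line injl)
  qed (rule \<S>(1), rule cS)
qed

text \<open>A generic linear map to the plane keeps points and lines distinct and preserves
  incidences; new incidences would only help the inequality.\<close>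

lemma szemeredi_trotter_space:
  fixes P :: "'a::euclidean_space set"
  assumes P: "finite P" and \<L>: "finite \<L>" "\<And>l. l \<in> \<L> \<Longrightarrow> is_line l" and "s > 0"
  shows "card {(p, l). p \<in> P \<and> l \<in> \<L> \<and> p \<in> l} * s\<^sup>2 \<le> card \<L> * s\<^sup>2 + 3 * card P * s ^ 3 + (card \<L>)\<^sup>2"
proof -
  have "\<exists>q. snd q \<noteq> 0 \<and> l = range (\<lambda>t. fst q + t *\<^sub>R snd q)" if "l \<in> \<L>" for l
    using \<L>(2)[OF that] unfolding is_line_def by fastforce
  then obtain pw where pw: "\<And>l. l \<in> \<L> \<Longrightarrow> snd (pw l) \<noteq> 0 \<and> l = range (\<lambda>t. fst (pw l) + t *\<^sub>R snd (pw l))"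
    by metis
  define Z where "Z = ((\<lambda>(p, q). p - q) ` (P \<times> P) - {0}) \<union> (\<lambda>l. snd (pw l)) ` \<L>"
  have "finite Z" "0 \<notin> Z" using P \<L>(1) pw by (auto simp: Z_def)
  from generic_vector[OF this] obtain u where u: "\<forall>z\<in>Z. u \<bullet> z \<noteq> 0" by (elim exE)
  have u_dir: "u \<bullet> snd (pw l) \<noteq> 0" if "l \<in> \<L>" for l using u that by (simp add: Z_def)
  have u_inj: "p = q" if "p \<in> P" "q \<in> P" "u \<bullet> p = u \<bullet> q" for p q
  proof (rule ccontr)
    assume "p \<noteq> q"
    then have "p - q \<in> Z" using that by (force simp: Z_def)
    then show False using u that(3) by (auto simp: inner_diff_right)
  qed
  \<comment> \<open>Normalised so that the parameter on each line is its
    \<open>u\<close>-coordinate. Slope and intercept of the image are then the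
    \<open>v\<close>-coordinates of \<open>w l\<close> and \<open>o' l\<close>, and both can be kept
    distinct by avoiding finitely many differences.\<close>
  define w where "w l = (1 / (u \<bullet> snd (pw l))) *\<^sub>R snd (pw l)" for l
  define o' where "o' l = fst (pw l) - (u \<bullet> fst (pw l)) *\<^sub>R w l" for l
  have uw: "u \<bullet> w l = 1" "u \<bullet> o' l = 0" if "l \<in> \<L>" for l
    using u_dir[OF that] by (simp_all add: w_def o'_def inner_diff_right)
  have line: "l = range (\<lambda>t. o' l + t *\<^sub>R w l)" if "l \<in> \<L>" for l
  proof -
    let ?a = "u \<bullet> fst (pw l)" and ?b = "u \<bullet> snd (pw l)"
    have "l = range (\<lambda>t. fst (pw l) + t *\<^sub>R snd (pw l))" using pw[OF that] by simp
    also have "\<dots> = range (\<lambda>t. o' l + t *\<^sub>R w l)"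
    proof (intro subset_antisym image_subsetI)
      fix t
      have "fst (pw l) + t *\<^sub>R snd (pw l) = o' l + (?a + t * ?b) *\<^sub>R w l"
        using u_dir[OF that] by (simp add: o'_def w_def scaleR_left_distrib add_divide_distrib)
      then show "fst (pw l) + t *\<^sub>R snd (pw l) \<in> range (\<lambda>t. o' l + t *\<^sub>R w l)" by (rule range_eqI)
      have "o' l + t *\<^sub>R w l = fst (pw l) + ((t - ?a) / ?b) *\<^sub>R snd (pw l)"
        by (simp add: o'_def w_def scaleR_left_diff_distrib diff_divide_distrib algebra_simps)
      then show "o' l + t *\<^sub>R w l \<in> range (\<lambda>t. fst (pw l) + t *\<^sub>R snd (pw l))" by (rule range_eqI)
    qed
    finally show ?thesis .
  qed
  define Y where "Y = (\<lambda>(l, l'). w l - w l') ` (\<L> \<times> \<L>) \<union> (\<lambda>(l, l'). o' l - o' l') ` (\<L> \<times> \<L>) - {0}"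
  have "finite Y" "0 \<notin> Y" using \<L>(1) by (auto simp: Y_def)
  from generic_vector[OF this] obtain v where v: "\<forall>z\<in>Y. v \<bullet> z \<noteq> 0" by (elim exE)
  define \<mu> where "\<mu> l = (v \<bullet> w l, v \<bullet> o' l)" for l
  define \<pi> where "\<pi> p = (u \<bullet> p, v \<bullet> p)" for p
  have inj\<mu>: "inj_on \<mu> \<L>"
  proof (rule inj_onI)
    fix l l' assume l: "l \<in> \<L>" "l' \<in> \<L>" "\<mu> l = \<mu> l'"
    then have "v \<bullet> (w l - w l') = 0" "v \<bullet> (o' l - o' l') = 0" by (auto simp: \<mu>_def inner_diff_right)
    then have "w l - w l' \<notin> Y" "o' l - o' l' \<notin> Y" using v by blast+
    then have "w l = w l'" "o' l = o' l'" using l(1,2) by (force simp: Y_def)+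
    then show "l = l'" using line[OF l(1)] line[OF l(2)] by simp
  qed
  have inj\<pi>: "inj_on \<pi> P" "inj_on fst (\<pi> ` P)"
    using u_inj by (auto simp: \<pi>_def inj_on_def)
  have on: "on_line (\<pi> p) (\<mu> l)" if l: "l \<in> \<L>" "p \<in> l" for p l
  proof -
    obtain t where "p = o' l + t *\<^sub>R w l" using l line[OF l(1)] by blast
    then show ?thesis using uw[OF l(1)] by (simp add: on_line_def \<pi>_def \<mu>_def inner_add_right)
  qed
  have "card {(p, l). p \<in> P \<and> l \<in> \<L> \<and> p \<in> l} \<le> card (line_incidences (\<pi> ` P) (\<mu> ` \<L>))"
  proof (rule card_inj_on_le)
    show "inj_on (map_prod \<pi> \<mu>) {(p, l). p \<in> P \<and> l \<in> \<L> \<and> p \<in> l}"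
      by (rule inj_on_subset[OF map_prod_inj_on[OF inj\<pi>(1) inj\<mu>]]) auto
    show "map_prod \<pi> \<mu> ` {(p, l). p \<in> P \<and> l \<in> \<L> \<and> p \<in> l} \<subseteq> line_incidences (\<pi> ` P) (\<mu> ` \<L>)"
      using on by (auto simp: line_incidences_def)
    show "finite (line_incidences (\<pi> ` P) (\<mu> ` \<L>))"
      by (rule finite_subset[of _ "\<pi> ` P \<times> \<mu> ` \<L>"]) (use P \<L>(1) in \<open>auto simp: line_incidences_def\<close>)
  qed
  then have "card {(p, l). p \<in> P \<and> l \<in> \<L> \<and> p \<in> l} * s\<^sup>2 \<le> card (line_incidences (\<pi> ` P) (\<mu> ` \<L>)) * s\<^sup>2"
    by (rule mult_le_mono1)
  also have "\<dots> \<le> card (\<mu> ` \<L>) * s\<^sup>2 + 3 * card (\<pi> ` P) * s ^ 3 + (card (\<mu> ` \<L>))\<^sup>2"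
    using P \<L>(1) by (intro szemeredi_trotter_crossing inj\<pi>(2) \<open>s > 0\<close>) auto
  finally show ?thesis by (simp add: card_image inj\<mu> inj\<pi>(1))
qed

section \<open>Summation over the planes\<close>

lemma card_small_subsets:
  assumes "finite A"
  shows "card {S. S \<subseteq> A \<and> card S \<le> j} \<le> (card A + 1) ^ j"
proof -
  \<comment> \<open>Lists of length exactly \<open>j\<close>, padded with \<open>None\<close>; the
    extra symbol is the \<open>+ 1\<close> in the bound.\<close>
  let ?L = "{xs. set xs \<subseteq> insert None (Some ` A) \<and> length xs = j}"
  have "{S. S \<subseteq> A \<and> card S \<le> j} \<subseteq> (\<lambda>xs. {a. Some a \<in> set xs}) ` ?L"
  proof
    fix S assume "S \<in> {S. S \<subseteq> A \<and> card S \<le> j}"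
    then have S: "S \<subseteq> A" "card S \<le> j" by auto
    obtain ys where ys: "set ys = S" "distinct ys"
      using finite_distinct_list finite_subset[OF S(1) assms] by metis
    let ?xs = "map Some ys @ replicate (j - card S) None"
    have "length ys = card S" using ys distinct_card by metis
    then have "?xs \<in> ?L" using S ys(1) by auto
    moreover have "S = {a. Some a \<in> set ?xs}" using ys(1) by auto
    ultimately show "S \<in> (\<lambda>xs. {a. Some a \<in> set xs}) ` ?L" by (intro image_eqI[of _ _ ?xs])
  qed
  then have "card {S. S \<subseteq> A \<and> card S \<le> j} \<le> card ((\<lambda>xs. {a. Some a \<in> set xs}) ` ?L)"
    using assms by (intro card_mono finite_imageI finite_lists_length_eq) auto
  also have "\<dots> \<le> card ?L" using assms by (intro card_image_le finite_lists_length_eq) auto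
  also have "\<dots> = card (insert None (Some ` A)) ^ j" using assms by (intro card_lists_length_eq) auto
  also have "card (insert None (Some ` A)) = card A + 1"
    using assms by (subst card_insert_disjoint) (auto simp: card_image)
  finally show ?thesis .
qed

text \<open>Each vertex is assigned to a single flat \<open>F p\<close>, so the vertex sets of the
  flats are disjoint and their sizes add up to \<open>m\<close>, whereas the terms in
  \<open>k\<close> are paid once per flat. The same \<open>s\<close> serves all flats.\<close>

theorem incidences_crossing_bound:
  fixes \<R> :: "'a::euclidean_space set set"
  assumes conf: "bichromatic_configuration m k n \<R> \<B> P" and d: "DIM('a) = D + 2" and "k \<le> n" and "s > 0"
  shows "card (incidences P \<R>) * s\<^sup>2 \<le> 16000000 ^ D * ((n + 1) ^ D * (k * s\<^sup>2 + k\<^sup>2) + 3 * m * s ^ 3)"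
proof -
  define \<H> where "\<H> = \<R> \<union> \<B>"
  have c: "finite \<R>" "card \<R> = k" "finite \<H>" "\<forall>H\<in>\<H>. hyperplane H" "finite P" "card P = m"
    "P \<subseteq> arrangement_vertices \<H>" "\<R> \<subseteq> \<H>"
    using conf by (auto simp: bichromatic_configuration_def \<H>_def)
  have "card \<H> \<le> card \<R> + card \<B>" unfolding \<H>_def by (rule card_Un_le)
  then have cH: "card \<H> \<le> n" using conf \<open>k \<le> n\<close> by (auto simp: bichromatic_configuration_def)
  define good where "good p \<S> \<R>' \<longleftrightarrow> \<S> \<subseteq> {H \<in> \<H>. p \<in> H} \<and> card \<S> \<le> D \<and> \<R>' \<subseteq> {H \<in> \<R>. p \<in> H} \<and>
     card {H \<in> \<R>. p \<in> H} \<le> 16000000 ^ D * card \<R>' \<and>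
     (\<forall>H\<in>\<R>'. is_line (H \<inter> \<Inter>\<S>)) \<and> inj_on (\<lambda>H. H \<inter> \<Inter>\<S>) \<R>'" for p and \<S> \<R>' :: "'a set set"
  have "\<exists>\<S> \<R>'. good p \<S> \<R>'" if "p \<in> P" for p
  proof -
    have "p \<in> arrangement_vertices \<H>" "{H \<in> \<R>. p \<in> H} \<subseteq> {H \<in> \<H>. p \<in> H}" using that c(7,8) by auto
    from vertex_flat[OF c(3,4) this(1) d this(2)] show ?thesis unfolding good_def by (elim exE conjE) blast
  qed
  then obtain F G where FG: "\<And>p. p \<in> P \<Longrightarrow> good p (F p) (G p)" by metis
  define \<F> where "\<F> = {S. S \<subseteq> \<H> \<and> card S \<le> D}"
  have fin\<F>: "finite \<F>" unfolding \<F>_def using c(3) by simp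
  have "card \<F> \<le> (card \<H> + 1) ^ D" unfolding \<F>_def by (rule card_small_subsets[OF c(3)])
  also have "\<dots> \<le> (n + 1) ^ D" using cH by (intro power_mono) auto
  finally have card\<F>: "card \<F> \<le> (n + 1) ^ D" .
  define \<L> where "\<L> S = {l \<in> (\<lambda>H. H \<inter> \<Inter>S) ` \<R>. is_line l}" for S
  define PS where "PS S = {p \<in> P. F p = S}" for S
  have \<L>: "finite (\<L> S)" "card (\<L> S) \<le> k" for S
  proof -
    show "finite (\<L> S)" using c(1) by (simp add: \<L>_def)
    have "card (\<L> S) \<le> card ((\<lambda>H. H \<inter> \<Inter>S) ` \<R>)" using c(1) by (intro card_mono) (auto simp: \<L>_def)
    also have "\<dots> \<le> k" using card_image_le[OF c(1)] c(2) by simp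
    finally show "card (\<L> S) \<le> k" .
  qed
  let ?I = "\<lambda>S. {(p, l). p \<in> PS S \<and> l \<in> \<L> S \<and> p \<in> l}"
  have finI: "finite (?I S)" for S
    by (rule finite_subset[of _ "P \<times> \<L> S"]) (use c(5) \<L>(1) in \<open>auto simp: PS_def\<close>)
  have finG: "finite (G p)" if "p \<in> P" for p
    using FG[OF that] c(1) by (auto simp: good_def intro: finite_subset)
  have "incidences P \<R> = (SIGMA p:P. {H \<in> \<R>. p \<in> H})" by (auto simp: incidences_def)
  then have "card (incidences P \<R>) = (\<Sum>p\<in>P. card {H \<in> \<R>. p \<in> H})"
    using c(1,5) by (simp add: card_SigmaI)
  also have "\<dots> \<le> (\<Sum>p\<in>P. 16000000 ^ D * card (G p))"
    using FG by (intro sum_mono) (simp add: good_def)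
  also have "\<dots> = 16000000 ^ D * card (SIGMA p:P. G p)"
    using c(5) finG by (simp add: card_SigmaI sum_distrib_left)
  also have "card (SIGMA p:P. G p) \<le> card (SIGMA S:\<F>. ?I S)"
  proof (rule card_inj_on_le)
    \<comment> \<open>Injective because the hyperplanes of \<open>G p\<close> cut distinct lines out
      of the flat of \<open>p\<close>.\<close>
    let ?f = "\<lambda>(p, H). (F p, (p, H \<inter> \<Inter>(F p)))"
    show "inj_on ?f (SIGMA p:P. G p)"
      using FG by (auto simp: inj_on_def good_def)
    show "?f ` (SIGMA p:P. G p) \<subseteq> (SIGMA S:\<F>. ?I S)"
    proof (rule image_subsetI)
      fix z assume "z \<in> (SIGMA p:P. G p)"
      then obtain p H where z: "z = (p, H)" "p \<in> P" "H \<in> G p" by auto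
      then have g: "F p \<subseteq> {H \<in> \<H>. p \<in> H}" "card (F p) \<le> D" "H \<in> \<R>" "p \<in> H" "is_line (H \<inter> \<Inter>(F p))"
        using FG[OF z(2)] unfolding good_def by blast+
      then show "?f z \<in> (SIGMA S:\<F>. ?I S)"
        using z by (auto simp: \<F>_def PS_def \<L>_def)
    qed
    show "finite (SIGMA S:\<F>. ?I S)" using fin\<F> finI by (intro finite_SigmaI)
  qed
  also have "card (SIGMA S:\<F>. ?I S) = (\<Sum>S\<in>\<F>. card (?I S))"
    using fin\<F> finI by (intro card_SigmaI) auto
  finally have "card (incidences P \<R>) * s\<^sup>2 \<le> 16000000 ^ D * (\<Sum>S\<in>\<F>. card (?I S)) * s\<^sup>2"
    by (simp only: mult_le_mono)
  also have "\<dots> = 16000000 ^ D * (\<Sum>S\<in>\<F>. card (?I S) * s\<^sup>2)"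
    by (simp only: sum_distrib_right mult.assoc)
  also have "(\<Sum>S\<in>\<F>. card (?I S) * s\<^sup>2) \<le> (\<Sum>S\<in>\<F>. (k * s\<^sup>2 + k\<^sup>2) + 3 * s ^ 3 * card (PS S))"
  proof (rule sum_mono)
    fix S
    have "card (?I S) * s\<^sup>2 \<le> card (\<L> S) * s\<^sup>2 + 3 * card (PS S) * s ^ 3 + (card (\<L> S))\<^sup>2"
      using c(5) \<L>(1) \<open>s > 0\<close> by (intro szemeredi_trotter_space) (auto simp: PS_def \<L>_def)
    also have "\<dots> \<le> k * s\<^sup>2 + 3 * card (PS S) * s ^ 3 + k\<^sup>2"
      using \<L>(2) by (intro add_mono mult_le_mono1 power_mono order_refl) auto
    finally show "card (?I S) * s\<^sup>2 \<le> (k * s\<^sup>2 + k\<^sup>2) + 3 * s ^ 3 * card (PS S)" by (simp add: mult_ac)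
  qed
  also have "\<dots> = card \<F> * (k * s\<^sup>2 + k\<^sup>2) + 3 * s ^ 3 * (\<Sum>S\<in>\<F>. card (PS S))"
    by (simp add: sum.distrib sum_distrib_left distrib_left)
  also have "(\<Sum>S\<in>\<F>. card (PS S)) = m"
  proof -
    have "F p \<in> \<F>" if "p \<in> P" for p using FG[OF that] by (auto simp: good_def \<F>_def)
    then have "(\<Union>S\<in>\<F>. PS S) = P" by (auto simp: PS_def)
    moreover have "card (\<Union>S\<in>\<F>. PS S) = (\<Sum>S\<in>\<F>. card (PS S))"
      using fin\<F> c(5) by (intro card_UN_disjoint) (auto simp: PS_def)
    ultimately show ?thesis using c(6) by simp
  qed
  finally have "card (incidences P \<R>) * s\<^sup>2 \<le> 16000000 ^ D * (card \<F> * (k * s\<^sup>2 + k\<^sup>2) + 3 * s ^ 3 * m)"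
    by simp
  also have "\<dots> \<le> 16000000 ^ D * ((n + 1) ^ D * (k * s\<^sup>2 + k\<^sup>2) + 3 * s ^ 3 * m)"
    using card\<F> by (intro mult_le_mono2 add_le_mono mult_le_mono1 order_refl)
  finally show ?thesis by (simp add: mult_ac)
qed

section \<open>Choice of the parameter in the upper bound\<close>

lemma incidence_bound_pos:
  assumes "m \<ge> 1" shows "incidence_bound d m k n > 0"
  using assms by (auto simp: incidence_bound_def intro!: add_nonneg_pos)

lemma powr_cube:
  assumes "x > 0" "z * 3 = real j" shows "(x powr z) ^ 3 = x ^ j"
proof -
  have "(x powr z) ^ 3 = x powr (3 * z)" using assms(1) by (simp add: powr_powr powr_realpow[symmetric] mult.commute)
  also have "\<dots> = x ^ j" using assms by (simp add: mult.commute powr_realpow)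
  finally show ?thesis .
qed

text \<open>The cube removes the fractional exponents; all later comparisons with the mixed term are
  made between cubes.\<close>

lemma mixed_term_cube:
  assumes "m \<ge> 1" "k \<ge> 1" "n \<ge> 1" 
  shows "(real m powr (2/3) * real k powr (2/3) * real n powr ((real (D + 2) - 2) / 3)) ^ 3
    = (real m)\<^sup>2 * (real k)\<^sup>2 * real n ^ D"
  unfolding power_mult_distrib
  using powr_cube[of "real m" "2/3" 2] powr_cube[of "real k" "2/3" 2] powr_cube[of "real n" "(real (D + 2) - 2) / 3" D] assms
  by simp

theorem incidences_upper_bound:
  fixes \<R> :: "'a::euclidean_space set set"
  assumes conf: "bichromatic_configuration m k n \<R> \<B> P" and d: "DIM('a) = D + 2"
    and kmn: "1 \<le> k" "k \<le> n" "1 \<le> m"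
  shows "real (card (incidences P \<R>)) \<le> 16000000 ^ D * (4 * 2 ^ D) * incidence_bound (D + 2) m k n"
proof -
  define I M K N where "I = real (card (incidences P \<R>))" and "M = real m" and "K = real k" and "N = real n ^ D"
  define Z where "Z = real m powr (2/3) * real k powr (2/3) * real n powr ((real (D + 2) - 2) / 3)"
  \<comment> \<open>The value for which the two terms depending on \<open>s\<close> balance:
    \<open>M * y\<close> and \<open>N * K^2 / y^2\<close> both equal \<open>Z\<close>.\<close>
  define y where "y = Z / M"
  have n: "n \<ge> 1" using kmn by simp
  have pos: "M \<ge> 1" "K \<ge> 1" "N \<ge> 1" using kmn n by (simp_all add: M_def K_def N_def)
  have Z: "Z > 0" using kmn n by (simp add: Z_def)
  have Z3: "Z ^ 3 = M\<^sup>2 * K\<^sup>2 * N"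
    unfolding Z_def M_def K_def N_def by (rule mixed_term_cube[OF kmn(3,1) n])
  have y: "y > 0" using Z pos by (simp add: y_def)
  have My: "M * y = Z" using pos by (simp add: y_def)
  have NK: "N * K\<^sup>2 / y\<^sup>2 = Z"
    using Z3 Z pos by (simp add: y_def power2_eq_square power3_eq_cube field_simps)
  \<comment> \<open>Rounding up adds at most 1 to \<open>y\<close>, and this produces the summand
    \<open>M\<close>.\<close>
  define s where "s = nat \<lceil>y\<rceil>"
  have s: "s > 0" "y \<le> real s" "real s \<le> y + 1" using y by (auto simp: s_def)
  have "real (card (incidences P \<R>) * s\<^sup>2) \<le> real (16000000 ^ D * ((n + 1) ^ D * (k * s\<^sup>2 + k\<^sup>2) + 3 * m * s ^ 3))"
    using incidences_crossing_bound[OF conf d kmn(2) s(1)] by (simp only: of_nat_le_iff)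
  also have "\<dots> = 16000000 ^ D * ((real n + 1) ^ D * (K * (real s)\<^sup>2 + K\<^sup>2) + 3 * M * real s ^ 3)"
    by (simp add: M_def K_def add.commute)
  also have "\<dots> \<le> 16000000 ^ D * ((2 ^ D * N) * (K * (real s)\<^sup>2 + K\<^sup>2) + 3 * M * real s ^ 3)"
  proof -
    have "(real n + 1) ^ D \<le> (2 * real n) ^ D" using n by (intro power_mono) auto
    then have "(real n + 1) ^ D \<le> 2 ^ D * N" by (simp add: N_def power_mult_distrib)
    then show ?thesis using pos by (intro mult_left_mono add_right_mono mult_right_mono) auto
  qed
  also have "\<dots> = (16000000 ^ D * (2 ^ D * N * K + 2 ^ D * (N * K\<^sup>2 / (real s)\<^sup>2) + 3 * M * real s)) * (real s)\<^sup>2"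
    using s(1) by (simp add: power2_eq_square power3_eq_cube field_simps)
  finally have "I * (real s)\<^sup>2 \<le> (16000000 ^ D * (2 ^ D * N * K + 2 ^ D * (N * K\<^sup>2 / (real s)\<^sup>2) + 3 * M * real s)) * (real s)\<^sup>2"
    by (simp add: I_def)
  then have "I \<le> 16000000 ^ D * (2 ^ D * N * K + 2 ^ D * (N * K\<^sup>2 / (real s)\<^sup>2) + 3 * M * real s)"
    by (rule mult_right_le_imp_le) (use s(1) in simp)
  also have "\<dots> \<le> 16000000 ^ D * (2 ^ D * N * K + 2 ^ D * Z + 3 * (Z + M))"
  proof (intro mult_left_mono add_mono order_refl)
    have "y\<^sup>2 \<le> (real s)\<^sup>2" using y s(2) by (intro power_mono) auto
    then have "N * K\<^sup>2 / (real s)\<^sup>2 \<le> N * K\<^sup>2 / y\<^sup>2"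
      using y pos s(1) by (intro divide_left_mono) auto
    then show "N * K\<^sup>2 / (real s)\<^sup>2 \<le> Z" using NK by simp
    have "M * real s \<le> M * (y + 1)" using s(3) pos by (intro mult_left_mono) auto
    then show "3 * M * real s \<le> 3 * (Z + M)" using My by (simp add: distrib_left)
  qed (use pos in auto)
  also have "\<dots> \<le> 16000000 ^ D * ((4 * 2 ^ D) * (Z + K * N + M))"
  proof (rule mult_left_mono)
    have p: "(1::real) \<le> 2 ^ D" by simp
    have "M \<le> 2 ^ D * M" "Z \<le> 2 ^ D * Z" using mult_right_mono[OF p, of M] mult_right_mono[OF p, of Z] pos Z by simp_all
    moreover have "0 \<le> 2 ^ D * (K * N)" using pos by simp
    moreover have "a + b + 3 * (Z + M) \<le> 4 * b + 4 * a + 4 * e" if "M \<le> e" "Z \<le> b" "0 \<le> a" for a b e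
      using that pos(1) Z by (simp add: algebra_simps)
    ultimately have "2 ^ D * (K * N) + 2 ^ D * Z + 3 * (Z + M) \<le> 4 * (2 ^ D * Z) + 4 * (2 ^ D * (K * N)) + 4 * (2 ^ D * M)"
      by metis
    then show "2 ^ D * N * K + 2 ^ D * Z + 3 * (Z + M) \<le> 4 * 2 ^ D * (Z + K * N + M)"
      by (simp add: algebra_simps)
  qed simp
  also have "Z + K * N + M = incidence_bound (D + 2) m k n"
    by (simp add: incidence_bound_def Z_def K_def N_def M_def)
  finally show ?thesis by (simp add: I_def mult.assoc)
qed

section \<open>The lower bound\<close>

text \<open>Removing a lightest element does not lower the average, so the induction discards
  elements until \<open>j\<close> are left.\<close>

lemma proportional_subset:
  fixes f :: "'b \<Rightarrow> nat"
  assumes "finite A" "j \<le> card A"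
  shows "\<exists>B\<subseteq>A. card B = j \<and> j * sum f A \<le> card A * sum f B"
proof (cases "j = 0")
  case False
  show ?thesis
    using assms
  proof (induction "card A - j" arbitrary: A)
    case 0
    then show ?case by (intro exI[of _ A]) simp
  next
    case (Suc i)
    then have "A \<noteq> {}" by auto
    then have "\<exists>a\<in>A. \<forall>b\<in>A. real (f a) \<le> real (f b)" by (rule finite_min_exists[OF Suc.prems(1)])
    then obtain a where a: "a \<in> A" "\<And>b. b \<in> A \<Longrightarrow> f a \<le> f b" by auto
    let ?A = "A - {a}"
    have c: "card A = Suc (card ?A)" using a(1) Suc.prems(1) by (metis card_Suc_Diff1)
    then have "i = card ?A - j" "j \<le> card ?A" using Suc.hyps(2) by simp_all
    from Suc.hyps(1)[OF this(1) _ this(2)] Suc.prems(1)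
    obtain B where B: "B \<subseteq> ?A" "card B = j" "j * sum f ?A \<le> card ?A * sum f B" by auto
    have s: "sum f A = f a + sum f ?A" using a(1) Suc.prems(1) by (rule sum.remove[rotated])
    have "card ?A * f a \<le> sum f ?A"
      using sum_mono[of ?A "\<lambda>_. f a" f] a(2) by simp
    then have "j * (card ?A * f a) \<le> j * sum f ?A" by (rule mult_le_mono2)
    then have "card ?A * (j * sum f A) \<le> card A * (j * sum f ?A)"
      unfolding s c by (simp add: algebra_simps)
    also have "\<dots> \<le> card A * (card ?A * sum f B)" using B(3) by (rule mult_le_mono2)
    finally have "card ?A * (j * sum f A) \<le> card ?A * (card A * sum f B)" by (simp add: mult_ac)
    moreover have "0 < card ?A" using \<open>j \<le> card ?A\<close> False by simp
    ultimately have "j * sum f A \<le> card A * sum f B" by simp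
    then show ?case using B(1,2) by (intro exI[of _ B]) auto
  qed
qed (intro exI[of _ "{}"], simp)

section \<open>The maximum under padding and recolouring\<close>

lemma finite_incidences: "finite P \<Longrightarrow> finite \<R> \<Longrightarrow> finite (incidences P \<R>)"
  by (rule finite_subset[of _ "P \<times> \<R>"]) (auto simp: incidences_def)

lemma finite_red_incidence_counts: "finite (red_incidence_counts TYPE('a::euclidean_space) m k n)"
proof (rule finite_subset)
  show "red_incidence_counts TYPE('a) m k n \<subseteq> {..m * k}"
  proof
    fix x assume "x \<in> red_incidence_counts TYPE('a) m k n"
    then obtain \<R> \<B> :: "'a set set" and P where x: "x = card (incidences P \<R>)" 
      and c: "bichromatic_configuration m k n \<R> \<B> P"
      unfolding red_incidence_counts_def by (elim CollectE exE conjE)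
    have "finite P" "finite \<R>" "card P = m" "card \<R> = k" using c by (simp_all add: bichromatic_configuration_def)
    moreover have "incidences P \<R> \<subseteq> P \<times> \<R>" by (auto simp: incidences_def)
    ultimately have "x \<le> card (P \<times> \<R>)" unfolding x by (intro card_mono) auto
    then show "x \<in> {..m * k}" using \<open>card P = m\<close> \<open>card \<R> = k\<close> by (simp add: card_cartesian_product)
  qed
qed simp

lemma max_red_incidences_ge:
  fixes \<R> :: "'a::euclidean_space set set"
  assumes "bichromatic_configuration m k n \<R> \<B> P"
  shows "card (incidences P \<R>) \<le> max_red_incidences TYPE('a) m k n"
  unfolding max_red_incidences_def
proof (rule Max_ge[OF finite_red_incidence_counts])
  show "card (incidences P \<R>) \<in> red_incidence_counts TYPE('a) m k n"
    unfolding red_incidence_counts_def using assms by blast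
qed

lemma max_red_incidences_attained:
  assumes "red_incidence_counts TYPE('a::euclidean_space) m k n \<noteq> {}"
  obtains \<R> \<B> :: "'a::euclidean_space set set" and P where "bichromatic_configuration m k n \<R> \<B> P"
    "max_red_incidences TYPE('a) m k n = card (incidences P \<R>)"
proof -
  have "max_red_incidences TYPE('a) m k n \<in> red_incidence_counts TYPE('a) m k n"
    unfolding max_red_incidences_def by (rule Max_in[OF finite_red_incidence_counts assms])
  then show ?thesis
    unfolding red_incidence_counts_def by (elim CollectE exE conjE) (rule that)
qed

lemma arrangement_vertices_mono: "\<A> \<subseteq> \<B> \<Longrightarrow> arrangement_vertices \<A> \<subseteq> arrangement_vertices \<B>"
  unfolding arrangement_vertices_def by (blast intro: order.trans)

lemma infinite_hyperplanes: "infinite {H :: 'a::euclidean_space set. hyperplane H}"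
proof
  assume fin: "finite {H :: 'a set. hyperplane H}"
  obtain b :: 'a where b: "b \<in> Basis" using nonempty_Basis by blast
  let ?h = "\<lambda>i::nat. {x. b \<bullet> x = real i}"
  have "inj ?h"
  proof (rule injI)
    fix i j assume eq: "?h i = ?h j"
    have "real i *\<^sub>R b \<in> ?h i" using b by simp
    then have "real i *\<^sub>R b \<in> ?h j" unfolding eq .
    then show "i = j" using b by simp
  qed
  moreover have "hyperplane (?h i)" for i using b nonzero_Basis unfolding hyperplane_def by blast
  then have "range ?h \<subseteq> {H. hyperplane H}" by blast
  ultimately show False using fin finite_subset finite_imageD infinite_UNIV_nat by metis
qed

text \<open>Allows constructions that do not use up \<open>n\<close>, \<open>k\<close> and
  \<open>m\<close> exactly: fresh hyperplanes, further red hyperplanes and further vertices never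
  destroy an incidence. \<open>V\<close> is the reservoir of vertices to fill up to
  \<open>m\<close>.\<close>

lemma max_red_incidences_extend:
  fixes \<A> :: "'a::euclidean_space set set"
  assumes \<A>: "finite \<A>" "\<forall>H\<in>\<A>. hyperplane H" "card \<A> \<le> n"
    and \<R>: "\<R> \<subseteq> \<A>" "card \<R> \<le> k" "k \<le> n"
    and P: "finite P" "P \<subseteq> arrangement_vertices \<A>" "card P \<le> m"
    and V: "finite V" "V \<subseteq> arrangement_vertices \<A>" "m \<le> card V"
  shows "card (incidences P \<R>) \<le> max_red_incidences TYPE('a) m k n"
proof -
  have "infinite ({H :: 'a set. hyperplane H} - \<A>)" using infinite_hyperplanes \<A>(1) by simp
  then obtain \<C> where \<C>: "finite \<C>" "card \<C> = n - card \<A>" "\<C> \<subseteq> {H. hyperplane H} - \<A>"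
    using infinite_arbitrarily_large by metis
  let ?H = "\<A> \<union> \<C>"
  have H: "finite ?H" "card ?H = n" "\<forall>H\<in>?H. hyperplane H"
  proof -
    show "finite ?H" using \<A>(1) \<C>(1) by simp
    have "\<A> \<inter> \<C> = {}" using \<C>(3) by blast
    then show "card ?H = n" using card_Un_disjoint[OF \<A>(1) \<C>(1)] \<A>(3) \<C>(2) by simp
    show "\<forall>H\<in>?H. hyperplane H" using \<A>(2) \<C>(3) by blast
  qed
  obtain \<R>' where R': "\<R> \<subseteq> \<R>'" "\<R>' \<subseteq> ?H" "card \<R>' = k"
    using exists_subset_between[of \<R> k ?H] H(1,2) \<R> by auto
  have "m \<le> card (P \<union> V)" using V(3) card_mono[of "P \<union> V" V] P(1) V(1) by simp
  then obtain P' where P': "P \<subseteq> P'" "P' \<subseteq> P \<union> V" "card P' = m"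
    using exists_subset_between[of P m "P \<union> V"] P V(1) by auto
  have fin: "finite \<R>'" "finite P'" using R'(2) H(1) P'(2) P(1) V(1) by (auto intro: finite_subset)
  have "bichromatic_configuration m k n \<R>' (?H - \<R>') P'"
    unfolding bichromatic_configuration_def
  proof (intro conjI)
    show "card (?H - \<R>') = n - k" using R'(2,3) H(1,2) fin by (simp add: card_Diff_subset)
    have "P' \<subseteq> arrangement_vertices \<A>" using P'(2) P(2) V(2) by blast
    also have "\<dots> \<subseteq> arrangement_vertices (\<R>' \<union> (?H - \<R>'))" by (rule arrangement_vertices_mono) blast
    finally show "P' \<subseteq> arrangement_vertices (\<R>' \<union> (?H - \<R>'))" .
  qed (use R' P' H fin in auto)
  then have "card (incidences P' \<R>') \<le> max_red_incidences TYPE('a) m k n" by (rule max_red_incidences_ge)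
  moreover have "card (incidences P \<R>) \<le> card (incidences P' \<R>')"
    using R'(1) P'(1) fin by (intro card_mono finite_incidences) (auto simp: incidences_def)
  ultimately show ?thesis by linarith
qed

text \<open>Recolouring: the \<open>k\<close> hyperplanes with the most incidences carry at least the average share.\<close>

lemma max_red_incidences_average:
  assumes "red_incidence_counts TYPE('a::euclidean_space) m k n \<noteq> {}" "k \<le> n"
  shows "k * m \<le> n * max_red_incidences TYPE('a) m k n"
proof -
  obtain \<R> \<B> :: "'a set set" and P where c: "bichromatic_configuration m k n \<R> \<B> P"
    using max_red_incidences_attained[OF assms(1)] by metis
  let ?H = "\<R> \<union> \<B>"
  have H: "finite ?H" "card ?H = n" "\<forall>H\<in>?H. hyperplane H" and P: "finite P" "card P = m" "P \<subseteq> arrangement_vertices ?H"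
    using c assms(2) by (auto simp: bichromatic_configuration_def card_Un_disjoint)
  let ?f = "\<lambda>H. card {p \<in> P. p \<in> H}"
  have inc: "card (incidences P \<S>) = sum ?f \<S>" if "finite \<S>" for \<S>
  proof -
    have "incidences P \<S> = (\<lambda>(H, p). (p, H)) ` (SIGMA H:\<S>. {p \<in> P. p \<in> H})"
      by (auto simp: incidences_def image_iff)
    then have "card (incidences P \<S>) = card (SIGMA H:\<S>. {p \<in> P. p \<in> H})"
      by (simp add: card_image inj_on_def split_def prod_eq_iff)
    then show ?thesis using that P(1) by (simp add: card_SigmaI)
  qed
  \<comment> \<open>The empty family has the whole space as intersection, so a vertex needs at least
    one hyperplane and contributes at least one incidence.\<close>
  have "\<exists>H\<in>?H. p \<in> H" if "p \<in> P" for p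
  proof -
    have "p \<in> arrangement_vertices ?H" using that P(3) by (rule subsetD[rotated])
    then obtain S where S: "S \<subseteq> ?H" "\<Inter>S = {p}" unfolding arrangement_vertices_def by (elim CollectE exE conjE)
    have "S \<noteq> {}"
    proof
      assume "S = {}"
      then have "(UNIV :: 'a set) = {p}" using S(2) by simp
      moreover obtain b :: 'a where "b \<in> Basis" using nonempty_Basis by blast
      ultimately have "p + b = p" "b \<noteq> 0" using nonzero_Basis by (blast, blast)
      then show False by simp
    qed
    then show ?thesis using S by blast
  qed
  then have "P \<subseteq> (\<Union>H\<in>?H. {p \<in> P. p \<in> H})" by blast
  then have "m \<le> card (\<Union>H\<in>?H. {p \<in> P. p \<in> H})" 
    using P(1,2) H(1) card_mono[of "\<Union>H\<in>?H. {p \<in> P. p \<in> H}" P] by auto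
  also have "\<dots> \<le> sum ?f ?H" by (rule card_UN_le[OF H(1)])
  finally have m: "m \<le> sum ?f ?H" .
  obtain \<R>' where R': "\<R>' \<subseteq> ?H" "card \<R>' = k" "k * sum ?f ?H \<le> card ?H * sum ?f \<R>'"
    using proportional_subset[of ?H k ?f] H assms(2) by auto
  have fin: "finite \<R>'" using R'(1) H(1) by (rule finite_subset)
  have "bichromatic_configuration m k n \<R>' (?H - \<R>') P"
    unfolding bichromatic_configuration_def
  proof (intro conjI)
    show "card (?H - \<R>') = n - k" using R'(1,2) H(1,2) fin by (simp add: card_Diff_subset)
    have "\<R>' \<union> (?H - \<R>') = ?H" using R'(1) by blast
    then show "P \<subseteq> arrangement_vertices (\<R>' \<union> (?H - \<R>'))" using P(3) by simp
  qed (use R' P H fin in auto)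
  then have "sum ?f \<R>' \<le> max_red_incidences TYPE('a) m k n" 
    using max_red_incidences_ge inc[OF fin] by metis
  then have "n * sum ?f \<R>' \<le> n * max_red_incidences TYPE('a) m k n" by (rule mult_le_mono2)
  moreover have "k * m \<le> k * sum ?f ?H" using m by (rule mult_le_mono2)
  ultimately show ?thesis using R'(3) unfolding H(2) by linarith
qed

section \<open>The axis-parallel grid and hyperplanes over planar lines\<close>

definition axis_grid :: "nat \<Rightarrow> 'a::euclidean_space set set" where
  "axis_grid q = (\<lambda>(b, i). {x. x \<bullet> b = real i}) ` (Basis \<times> {..<q})"

definition lattice_point :: "('a \<Rightarrow> nat) \<Rightarrow> 'a::euclidean_space" where
  "lattice_point f = (\<Sum>b\<in>Basis. real (f b) *\<^sub>R b)"

definition lattice_box :: "('a \<Rightarrow> nat) \<Rightarrow> 'a::euclidean_space set" where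
  "lattice_box g = lattice_point ` (\<Pi>\<^sub>E b\<in>Basis. {..<g b})"

lemma lattice_point_inner: "b \<in> Basis \<Longrightarrow> lattice_point f \<bullet> b = real (f b)"
  by (simp add: lattice_point_def inner_sum_left inner_Basis if_distrib cong: if_cong)

lemma inj_lattice_point: "inj_on lattice_point (\<Pi>\<^sub>E b\<in>Basis. {..<g b})"
proof (rule inj_onI)
  fix f f' assume f: "f \<in> (\<Pi>\<^sub>E b\<in>Basis. {..<g b})" "f' \<in> (\<Pi>\<^sub>E b\<in>Basis. {..<g b})" "lattice_point f = lattice_point f'"
  show "f = f'"
  proof (rule PiE_ext[OF f(1,2)])
    fix b :: 'a assume "b \<in> Basis"
    then show "f b = f' b" using f(3) lattice_point_inner by (metis of_nat_eq_iff)
  qed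
qed

lemma card_lattice_box: "card (lattice_box g :: 'a::euclidean_space set) = (\<Prod>b\<in>(Basis :: 'a set). g b)"
  unfolding lattice_box_def by (simp add: card_image inj_lattice_point card_PiE)

lemma finite_lattice_box: "finite (lattice_box g)"
  unfolding lattice_box_def by (intro finite_imageI finite_PiE) auto

lemma axis_hyperplane: "b \<in> Basis \<Longrightarrow> hyperplane {x. x \<bullet> b = t}"
  unfolding hyperplane_def by (intro exI[of _ b] exI[of _ t]) (auto simp: inner_commute)

lemma axis_grid_hyperplane: "\<forall>H\<in>axis_grid q. hyperplane H"
  using axis_hyperplane by (auto simp: axis_grid_def)

lemma finite_axis_grid: "finite (axis_grid q)"
  by (simp add: axis_grid_def)

lemma card_axis_grid: "card (axis_grid q :: 'a::euclidean_space set set) \<le> DIM('a) * q"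
  unfolding axis_grid_def
  by (rule order.trans[OF card_image_le]) (simp_all add: card_cartesian_product)

lemma lattice_box_vertices:
  fixes g :: "'a::euclidean_space \<Rightarrow> nat"
  assumes "\<And>b. b \<in> Basis \<Longrightarrow> g b \<le> q"
  shows "lattice_box g \<subseteq> arrangement_vertices (axis_grid q)"
proof
  fix p assume "p \<in> lattice_box g"
  then obtain f where f: "p = lattice_point f" "f \<in> (\<Pi>\<^sub>E b\<in>Basis. {..<g b})"
    unfolding lattice_box_def by (elim imageE)
  let ?S = "(\<lambda>b. {x. x \<bullet> b = real (f b)}) ` Basis"
  have "?S \<subseteq> axis_grid q"
  proof (rule image_subsetI)
    fix b :: 'a assume b: "b \<in> Basis"
    then have "f b < g b" using f(2) by auto
    then have "f b < q" using assms[OF b] by simp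
    then show "{x. x \<bullet> b = real (f b)} \<in> axis_grid q"
      unfolding axis_grid_def using b by (intro image_eqI[of _ _ "(b, f b)"]) auto
  qed
  moreover have "\<Inter>?S = {p}"
  proof (intro subset_antisym subsetI)
    fix x assume "x \<in> \<Inter>?S"
    then have "x \<bullet> b = p \<bullet> b" if "b \<in> Basis" for b using that by (simp add: f(1) lattice_point_inner)
    then show "x \<in> {p}" using euclidean_eqI[of x p] by simp
  qed (auto simp: f(1) lattice_point_inner)
  ultimately show "p \<in> arrangement_vertices (axis_grid q)" unfolding arrangement_vertices_def by blast
qed

lemma prod_two_special:
  fixes e1 e2 :: "'a::euclidean_space" and g :: "'a \<Rightarrow> nat"
  assumes "e1 \<in> Basis" "e2 \<in> Basis" "e1 \<noteq> e2" "DIM('a) = D + 2"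
    and "\<And>b. b \<in> Basis \<Longrightarrow> b \<noteq> e1 \<Longrightarrow> b \<noteq> e2 \<Longrightarrow> g b = q"
  shows "(\<Prod>b\<in>Basis. g b) = g e1 * g e2 * q ^ D"
proof -
  have "(Basis :: 'a set) = insert e1 (insert e2 (Basis - {e1, e2}))" using assms(1,2) by auto
  then have "(\<Prod>b\<in>Basis. g b) = (\<Prod>b\<in>insert e1 (insert e2 (Basis - {e1, e2})). g b)" by simp
  also have "\<dots> = g e1 * (g e2 * (\<Prod>b\<in>Basis - {e1, e2}. g b))" using assms(3) by simp
  also have "(\<Prod>b\<in>Basis - {e1, e2}. g b) = (\<Prod>b\<in>(Basis :: 'a set) - {e1, e2}. q)"
    using assms(5) by (intro prod.cong) auto
  also have "\<dots> = q ^ D" using assms(1-4) by (simp add: card_Diff_subset)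
  finally show ?thesis by simp
qed

text \<open>The cylinder over the planar line of slope a and intercept b. It is free in the
  remaining D directions, so every planar incidence is repeated for all \<open>q ^ D\<close> choices
  of the other coordinates.\<close>

definition slanted :: "'a::euclidean_space \<Rightarrow> 'a \<Rightarrow> nat \<times> nat \<Rightarrow> 'a set" where
  "slanted e1 e2 = (\<lambda>(a, b). {x. x \<bullet> e2 = real a * (x \<bullet> e1) + real b})"

lemma hyperplane_slanted:
  assumes "e1 \<in> Basis" "e2 \<in> Basis" "e1 \<noteq> e2" shows "hyperplane (slanted e1 e2 z)"
proof -
  obtain a b where z: "z = (a, b)" by (metis surj_pair)
  have "(e2 - real a *\<^sub>R e1) \<bullet> e2 = 1" using assms by (simp add: inner_diff_left inner_Basis)
  then have "e2 - real a *\<^sub>R e1 \<noteq> 0" by auto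
  moreover have "(e2 - real a *\<^sub>R e1) \<bullet> x = x \<bullet> e2 - real a * (x \<bullet> e1)" for x
    by (simp add: inner_diff_left inner_diff_right inner_commute[of _ x])
  then have "slanted e1 e2 z = {x. (e2 - real a *\<^sub>R e1) \<bullet> x = real b}"
    by (auto simp: slanted_def z)
  ultimately show ?thesis unfolding hyperplane_def by blast
qed

lemma inj_slanted:
  assumes "e1 \<in> Basis" "e2 \<in> Basis" "e1 \<noteq> e2" shows "inj (slanted e1 e2)"
proof (rule injI)
  fix z z' assume eq: "slanted e1 e2 z = slanted e1 e2 z'"
  obtain a b where z: "z = (a, b)" by fastforce
  obtain a' b' where z': "z' = (a', b')" by fastforce
  have mem: "t *\<^sub>R e1 + s *\<^sub>R e2 \<in> slanted e1 e2 (c, d) \<longleftrightarrow> s = real c * t + real d" for t s c d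
    using assms by (simp add: slanted_def inner_add_left inner_Basis)
  have "0 *\<^sub>R e1 + real b *\<^sub>R e2 \<in> slanted e1 e2 z" unfolding z mem by simp
  then have b: "b = b'" unfolding eq z' mem by simp
  have "1 *\<^sub>R e1 + (real a + real b) *\<^sub>R e2 \<in> slanted e1 e2 z" unfolding z mem by simp
  then have "a = a'" unfolding eq z' mem using b by simp
  with b show "z = z'" by (simp add: z z')
qed

text \<open>The budget: \<open>k'\<close> slanted hyperplanes and at most \<open>(D + 2) * q\<close>
  grid hyperplanes fit into \<open>n\<close>, and the grid alone has at least \<open>m\<close>
  vertices for padding.\<close>

context
  fixes e1 e2 :: "'a::euclidean_space" and D q k n m k' :: nat
  assumes e: "e1 \<in> Basis" "e2 \<in> Basis" "e1 \<noteq> e2"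
    and d: "DIM('a) = D + 2"
    and k': "k' \<le> k" "k \<le> n" "k' + (D + 2) * q \<le> n"
    and q: "1 \<le> q"
    and m: "m \<le> q ^ (D + 2)"
begin

lemma card_full_box: "m \<le> card (lattice_box (\<lambda>_. q) :: 'a set)"
  using m d by (simp add: card_lattice_box)

lemma slanted_arrangement:
  assumes Z: "finite Z" "card Z \<le> k'" and P: "P \<subseteq> lattice_box g" "\<And>b. b \<in> Basis \<Longrightarrow> g b \<le> q" "card P \<le> m"
  shows "card (incidences P (slanted e1 e2 ` Z)) \<le> max_red_incidences TYPE('a) m k n"
proof (rule max_red_incidences_extend)
  let ?A = "axis_grid q \<union> slanted e1 e2 ` Z"
  show "finite ?A" using Z(1) finite_axis_grid by simp
  show "\<forall>H\<in>?A. hyperplane H" using axis_grid_hyperplane hyperplane_slanted[OF e] by blast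
  have cZ: "card (slanted e1 e2 ` Z) \<le> k'" using card_image_le[OF Z(1)] Z(2) by (rule order.trans)
  have "card ?A \<le> card (axis_grid q :: 'a set set) + card (slanted e1 e2 ` Z)" by (rule card_Un_le)
  then show "card ?A \<le> n" using card_axis_grid[where 'a = 'a, of q] cZ k'(3) d by simp
  show "card (slanted e1 e2 ` Z) \<le> k" using cZ k'(1) by simp
  show "finite P" using P(1) finite_lattice_box by (rule finite_subset)
  have mono: "arrangement_vertices (axis_grid q) \<subseteq> arrangement_vertices ?A" by (rule arrangement_vertices_mono) blast
  show "P \<subseteq> arrangement_vertices ?A" using P(1) lattice_box_vertices[of g q] P(2) mono by blast
  show "lattice_box (\<lambda>_. q) \<subseteq> arrangement_vertices ?A" using lattice_box_vertices[of "\<lambda>_. q" q] mono by blast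
qed (use k'(2) P(3) card_full_box finite_lattice_box in auto)

lemma max_red_incidences_ge_pencils: "k' * min m (q ^ D) \<le> max_red_incidences TYPE('a) m k n"
proof -
  \<comment> \<open>Side length 1 forces the first two coordinates to be 0, so all points lie on the
    common flat of the slanted hyperplanes.\<close>
  define g where "g b = (if b = e1 \<or> b = e2 then 1 else q)" for b
  have "card (lattice_box g) = q ^ D"
    unfolding card_lattice_box using prod_two_special[OF e d, of g q] e by (simp add: g_def)
  then obtain P where P: "P \<subseteq> lattice_box g" "card P = min m (q ^ D)"
    using obtain_subset_with_card_n[of "min m (q ^ D)" "lattice_box g"] by (metis min.cobounded2)
  let ?Z = "(\<lambda>a::nat. (a, 0::nat)) ` {..<k'}"
  have on: "p \<in> slanted e1 e2 (a, 0)" if p: "p \<in> P" for p a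
  proof -
    obtain f where f: "p = lattice_point f" "f \<in> (\<Pi>\<^sub>E b\<in>Basis. {..<g b})"
      using p P(1) unfolding lattice_box_def by blast
    have "f e1 \<in> {..<g e1}" "f e2 \<in> {..<g e2}" using PiE_mem[OF f(2)] e(1,2) by blast+
    then have "p \<bullet> e1 = 0" "p \<bullet> e2 = 0" using e by (simp_all add: f(1) lattice_point_inner g_def)
    then show ?thesis by (simp add: slanted_def)
  qed
  have "incidences P (slanted e1 e2 ` ?Z) = P \<times> (slanted e1 e2 ` ?Z)"
    using on by (auto simp: incidences_def)
  moreover have "card (slanted e1 e2 ` ?Z) = k'"
    using inj_slanted[OF e] by (subst card_image, auto simp: inj_on_def card_image dest: injD)
  ultimately have "card (incidences P (slanted e1 e2 ` ?Z)) = k' * min m (q ^ D)"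
    using P(2) by (simp add: card_cartesian_product)
  moreover have "card (incidences P (slanted e1 e2 ` ?Z)) \<le> max_red_incidences TYPE('a) m k n"
  proof (rule slanted_arrangement[OF _ _ P(1)])
    show "card ?Z \<le> k'" using card_image_le[of "{..<k'}" "\<lambda>a. (a, 0::nat)"] by simp
  qed (use P(2) q in \<open>auto simp: g_def\<close>)
  ultimately show ?thesis by simp
qed

lemma max_red_incidences_ge_parallel: "min m (min k q * q ^ (D + 1)) \<le> max_red_incidences TYPE('a) m k n"
proof -
  define r where "r = min k q"
  define g where "g b = (if b = e1 then r else q)" for b
  have "card (lattice_box g) = r * q ^ (D + 1)"
    unfolding card_lattice_box using prod_two_special[OF e d, of g q] e by (simp add: g_def)
  then obtain P where P: "P \<subseteq> lattice_box g" "card P = min m (r * q ^ (D + 1))"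
    using obtain_subset_with_card_n[of "min m (r * q ^ (D + 1))" "lattice_box g"] by (metis min.cobounded2)
  have finP: "finite P" using P(1) finite_lattice_box by (rule finite_subset)
  define \<R> where "\<R> = (\<lambda>i. {x. x \<bullet> e1 = real i}) ` {..<r}"
  have sub: "\<R> \<subseteq> axis_grid q"
    unfolding \<R>_def axis_grid_def using e(1) by (auto simp: r_def)
  have "card P \<le> card (incidences P \<R>)"
  proof (rule card_inj_on_le[of "\<lambda>p. (p, {x. x \<bullet> e1 = p \<bullet> e1})"])
    show "(\<lambda>p. (p, {x. x \<bullet> e1 = p \<bullet> e1})) ` P \<subseteq> incidences P \<R>"
    proof (rule image_subsetI)
      fix p assume p: "p \<in> P"
      then obtain f where f: "p = lattice_point f" "f \<in> (\<Pi>\<^sub>E b\<in>Basis. {..<g b})"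
        using P(1) unfolding lattice_box_def by blast
      have "f e1 < r" using PiE_mem[OF f(2) e(1)] by (simp add: g_def)
      moreover have "p \<bullet> e1 = real (f e1)" using e(1) by (simp add: f(1) lattice_point_inner)
      ultimately have "{x. x \<bullet> e1 = p \<bullet> e1} \<in> \<R>" by (auto simp: \<R>_def)
      then show "(p, {x. x \<bullet> e1 = p \<bullet> e1}) \<in> incidences P \<R>" using p by (simp add: incidences_def)
    qed
  qed (use finP in \<open>auto simp: inj_on_def \<R>_def intro: finite_incidences\<close>)
  also have "\<dots> \<le> max_red_incidences TYPE('a) m k n"
  proof (rule max_red_incidences_extend[OF finite_axis_grid axis_grid_hyperplane _ sub])
    show "card (axis_grid q :: 'a set set) \<le> n" using card_axis_grid[where 'a = 'a, of q] k'(3) d by simp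
    have "card \<R> \<le> r" unfolding \<R>_def using card_image_le[of "{..<r}"] by (metis card_lessThan finite_lessThan)
    then show "card \<R> \<le> k" by (simp add: r_def)
    show "P \<subseteq> arrangement_vertices (axis_grid q)"
      using P(1) lattice_box_vertices[of g q] by (force simp: g_def r_def)
    show "lattice_box (\<lambda>_. q) \<subseteq> arrangement_vertices (axis_grid q)" by (rule lattice_box_vertices) simp
  qed (use finP P(2) k'(2) card_full_box finite_lattice_box in auto)
  finally show ?thesis using P(2) by (simp add: r_def)
qed

text \<open>With \<open>A\<close> slopes, \<open>B\<close> intercepts and \<open>X\<close> columns,
  the values of a x + b run from 0 to (A - 1)(X - 1) + B - 1. A box of that height therefore meets
  every line in every column. The three sizes stay free and are balanced later.\<close>

lemma max_red_incidences_ge_grid: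
  assumes A: "1 \<le> A" "A * B \<le> k'" and X: "1 \<le> X" "X \<le> q"
    and Y: "(A - 1) * (X - 1) + B \<le> q" and mm: "X * ((A - 1) * (X - 1) + B) * q ^ D \<le> m"
  shows "A * B * X * q ^ D \<le> max_red_incidences TYPE('a) m k n"
proof -
  define Y where "Y = (A - 1) * (X - 1) + B"
  define g where "g b = (if b = e1 then X else if b = e2 then Y else q)" for b
  \<comment> \<open>An incidence is coded by a line and a point whose \<open>e2\<close>-coordinate
    is fixed at 0; \<open>h\<close> overwrites it with the height of the line. The original value
    being known, the overwriting loses nothing.\<close>
  define g1 where "g1 b = (if b = e1 then X else if b = e2 then 1 else q)" for b
  let ?Z = "{..<A} \<times> {..<B}"
  let ?F = "\<Pi>\<^sub>E b\<in>Basis. {..<g1 b}"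
  let ?I = "incidences (lattice_box g) (slanted e1 e2 ` ?Z)"
  define h where "h = (\<lambda>(z, f). (lattice_point (f(e2 := fst z * f e1 + snd z)), slanted e1 e2 z))"
  have cg: "card (lattice_box g) = X * Y * q ^ D"
    unfolding card_lattice_box using prod_two_special[OF e d, of g q] e by (simp add: g_def)
  have F: "card ?F = X * q ^ D"
    using prod_two_special[OF e d, of g1 q] e by (simp add: g1_def card_PiE)
  have upd: "f(e2 := a * f e1 + b) \<in> (\<Pi>\<^sub>E b\<in>Basis. {..<g b})" if "f \<in> ?F" "a < A" "b < B" for f a b
  proof -
    have f: "f c < g1 c" if "c \<in> Basis" for c using PiE_mem[OF \<open>f \<in> ?F\<close> that] by simp
    have "f e1 < X" using f[OF e(1)] by (simp add: g1_def)
    then have "a * f e1 \<le> (A - 1) * (X - 1)" using that(2) by (intro mult_le_mono) auto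
    then have Y: "a * f e1 + b < Y" using that(3) by (simp add: Y_def)
    show ?thesis
    proof (rule PiE_I)
      show "(f(e2 := a * f e1 + b)) c \<in> {..<g c}" if "c \<in> Basis" for c
        using f[OF that] Y e by (auto simp: g_def g1_def split: if_splits)
      show "(f(e2 := a * f e1 + b)) c = undefined" if "c \<notin> Basis" for c
        using PiE_arb[OF \<open>f \<in> ?F\<close> that] e(2) that by auto
    qed
  qed
  have "A * B * X * q ^ D = card (?Z \<times> ?F)" by (simp add: card_cartesian_product F)
  also have "\<dots> \<le> card ?I"
  proof (rule card_inj_on_le[of h])
    show "inj_on h (?Z \<times> ?F)"
    proof (rule inj_onI)
      fix x y assume xy: "x \<in> ?Z \<times> ?F" "y \<in> ?Z \<times> ?F" "h x = h y"
      obtain z f z' f' where eq: "x = (z, f)" "y = (z', f')" by fastforce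
      have ff: "f \<in> ?F" "f' \<in> ?F" and zz: "z \<in> ?Z" "z' \<in> ?Z" using xy(1,2) eq by auto
      have z: "z = z'" using xy(3) injD[OF inj_slanted[OF e]] by (simp add: eq h_def)
      have "lattice_point (f(e2 := fst z * f e1 + snd z)) = lattice_point (f'(e2 := fst z * f' e1 + snd z))"
        using xy(3) z by (simp add: eq h_def)
      moreover have "f(e2 := fst z * f e1 + snd z) \<in> (\<Pi>\<^sub>E b\<in>Basis. {..<g b})"
          "f'(e2 := fst z * f' e1 + snd z) \<in> (\<Pi>\<^sub>E b\<in>Basis. {..<g b})"
      proof -
        have "fst z < A" "snd z < B" using zz(1) by (auto simp: mem_Times_iff)
        then show "f(e2 := fst z * f e1 + snd z) \<in> (\<Pi>\<^sub>E b\<in>Basis. {..<g b})"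
          "f'(e2 := fst z * f' e1 + snd z) \<in> (\<Pi>\<^sub>E b\<in>Basis. {..<g b})"
          by (rule upd[OF ff(1)], rule upd[OF ff(2)])
      qed
      ultimately have fe: "f(e2 := fst z * f e1 + snd z) = f'(e2 := fst z * f' e1 + snd z)"
        by (rule inj_onD[OF inj_lattice_point[of g]])
      have "f = f'"
      proof (rule PiE_ext[OF ff])
        fix b :: 'a assume b: "b \<in> Basis"
        show "f b = f' b"
        proof (cases "b = e2")
          case True
          then show ?thesis using PiE_mem[OF ff(1) b] PiE_mem[OF ff(2) b] e(3) by (simp add: g1_def)
        next
          case False
          then show ?thesis using fun_cong[OF fe, of b] by simp
        qed
      qed
      then show "x = y" using z eq by simp
    qed
    show "h ` (?Z \<times> ?F) \<subseteq> ?I"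
    proof (rule image_subsetI)
      fix x assume x: "x \<in> ?Z \<times> ?F"
      obtain a b f where eq: "x = ((a, b), f)" by (metis surj_pair)
      have f: "f \<in> ?F" "a < A" "b < B" using x eq by auto
      let ?p = "lattice_point (f(e2 := a * f e1 + b)) :: 'a"
      have "?p \<in> lattice_box g" unfolding lattice_box_def using upd[OF f] by (rule imageI)
      moreover have "?p \<bullet> e1 = real (f e1)" "?p \<bullet> e2 = real (a * f e1 + b)"
        using e by (simp_all add: lattice_point_inner)
      then have "?p \<in> slanted e1 e2 (a, b)" by (simp add: slanted_def)
      ultimately show "h x \<in> ?I" using f by (auto simp: h_def eq incidences_def)
    qed
    show "finite ?I" by (intro finite_incidences finite_lattice_box finite_imageI) auto
  qed
  also have "\<dots> \<le> max_red_incidences TYPE('a) m k n"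
  proof (rule slanted_arrangement[where g = g])
    show "card (lattice_box g) \<le> m" using mm cg by (simp add: Y_def)
    show "g b \<le> q" for b using X(2) Y by (simp add: g_def Y_def)
  qed (use A(2) in \<open>auto simp: card_cartesian_product\<close>)
  finally show ?thesis .
qed

end

section \<open>Comparison of the constructions with the bound\<close>

lemma cube_eq: "x ^ 3 = x * x\<^sup>2" for x :: real
  by (simp add: power2_eq_square power3_eq_cube)

lemma le_of_cube_le: "x ^ 3 \<le> y ^ 3 \<Longrightarrow> 0 \<le> y \<Longrightarrow> x \<le> (y :: real)"
  using power_le_imp_le_base[of x 2 y] by (simp add: eval_nat_numeral)

text \<open>If m is at least \<open>\<epsilon>\<close> n^d, every summand of the bound is at most m
  / \<open>\<epsilon>\<close>. Moreover m at most K k n^(d-1) forces k to be at least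
  \<open>\<epsilon>\<close> n / K, so the average share k m / n already has order m.\<close>

lemma max_red_incidences_lower_many_vertices:
  fixes \<epsilon> K :: real
  assumes d: "DIM('a::euclidean_space) = D + 2" and kmn: "1 \<le> k" "k \<le> n" "1 \<le> m"
    and ne: "red_incidence_counts TYPE('a) m k n \<noteq> {}"
    and K: "K > 0" "real m \<le> K * (real k * real n ^ (D + 1))"
    and \<epsilon>: "0 < \<epsilon>" "\<epsilon> \<le> 1" "\<epsilon> * real n ^ (D + 2) \<le> real m"
  shows "\<epsilon>\<^sup>2 / (3 * K) * incidence_bound (D + 2) m k n \<le> real (max_red_incidences TYPE('a) m k n)"
proof -
  define G M \<nu> where "G = real (max_red_incidences TYPE('a) m k n)" and "M = real m" and "\<nu> = real n"
  define Z where "Z = real m powr (2/3) * real k powr (2/3) * real n powr ((real (D + 2) - 2) / 3)"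
  have pos: "M \<ge> 1" "\<nu> \<ge> 1" "real k \<ge> 1" "real k \<le> \<nu>" using kmn by (simp_all add: M_def \<nu>_def)
  have n: "n \<ge> 1" using kmn by simp
  have nM: "\<nu> ^ (D + 2) \<le> M / \<epsilon>" using \<epsilon> by (simp add: M_def \<nu>_def field_simps)
  have "real (k * m) \<le> real (n * max_red_incidences TYPE('a) m k n)"
    using max_red_incidences_average[OF ne kmn(2)] by (simp only: of_nat_le_iff)
  then have "\<nu> ^ (D + 1) * (real k * M) \<le> \<nu> ^ (D + 1) * (\<nu> * G)"
    using pos by (intro mult_left_mono) (auto simp: G_def M_def \<nu>_def)
  moreover have "M / K * M \<le> (real k * \<nu> ^ (D + 1)) * M"
    using K pos by (intro mult_right_mono) (auto simp: M_def \<nu>_def field_simps)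
  moreover have "\<nu> ^ (D + 2) * G \<le> M / \<epsilon> * G" using nM by (intro mult_right_mono) (auto simp: G_def)
  ultimately have "M * (M / K) \<le> M * (G / \<epsilon>)" by (simp add: mult_ac)
  then have "M / K \<le> G / \<epsilon>" by (rule mult_left_le_imp_le) (use pos in simp)
  then have G: "\<epsilon> / K * M \<le> G" using \<epsilon> K by (simp add: field_simps)
  have "Z ^ 3 = M\<^sup>2 * (real k)\<^sup>2 * \<nu> ^ D"
    unfolding Z_def M_def \<nu>_def by (rule mixed_term_cube[OF kmn(3,1) n])
  also have "\<dots> \<le> M\<^sup>2 * \<nu>\<^sup>2 * \<nu> ^ D" using pos by (intro mult_right_mono mult_left_mono power_mono) auto
  also have "\<dots> = M\<^sup>2 * \<nu> ^ (D + 2)" by (simp add: power_add power2_eq_square mult_ac)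
  also have "\<dots> \<le> M\<^sup>2 * (M / \<epsilon>)" using nM by (intro mult_left_mono) auto
  also have "\<dots> \<le> (M / \<epsilon>)\<^sup>2 * (M / \<epsilon>)"
    using \<epsilon> pos by (intro mult_right_mono power_mono) (auto simp: field_simps)
  also have "\<dots> = (M / \<epsilon>) ^ 3" by (simp only: power2_eq_square power3_eq_cube mult.assoc)
  finally have "Z \<le> M / \<epsilon>" by (rule le_of_cube_le) (use \<epsilon> pos in simp)
  moreover have "real k * \<nu> ^ D \<le> M / \<epsilon>"
  proof -
    have "real k * \<nu> ^ D \<le> \<nu> * \<nu> ^ D" using pos by (intro mult_right_mono) auto
    also have "\<dots> \<le> \<nu> ^ (D + 2)" using power_increasing[of "D + 1" "D + 2" \<nu>] pos by simp
    finally show ?thesis using nM by simp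
  qed
  moreover have "M \<le> M / \<epsilon>" using \<epsilon> pos by (simp add: field_simps)
  ultimately have "incidence_bound (D + 2) m k n \<le> 3 * (M / \<epsilon>)"
    unfolding incidence_bound_def by (simp add: Z_def M_def \<nu>_def)
  then have "\<epsilon>\<^sup>2 / (3 * K) * incidence_bound (D + 2) m k n \<le> \<epsilon>\<^sup>2 / (3 * K) * (3 * (M / \<epsilon>))"
    using K by (intro mult_left_mono) auto
  also have "\<dots> = \<epsilon> / K * M" using \<epsilon> K by (simp add: power2_eq_square field_simps)
  finally show ?thesis using G by (simp add: G_def)
qed

text \<open>Both divisions round up. With half of the columns and \<open>A * X / 2\<close>
  intercepts the height needed for the grid construction stays within \<open>A * X\<close>.\<close>

lemma half_box_bound:
  fixes A X :: nat
  assumes "1 \<le> A" "1 \<le> X"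
  shows "(A - 1) * ((X + 1) div 2 - 1) + (A * X + 1) div 2 \<le> A * X"
proof -
  obtain a x where ax: "A = Suc a" "X = Suc x" using assms by (metis Suc_le_D One_nat_def)
  define t where "t = (X + 1) div 2 - 1"
  have "2 * t \<le> x" using ax by (simp add: t_def)
  then have "a * (2 * t) \<le> a * x" by (rule mult_le_mono2)
  then have "2 * (a * t) \<le> a * x" by (simp only: mult.left_commute)
  moreover have "2 * ((A * X + 1) div 2) \<le> A * X + 1" by simp
  moreover have "A * X = a * x + a + x + 1" using ax by simp
  ultimately have "a * t + (A * X + 1) div 2 \<le> A * X" by linarith
  then show ?thesis using ax(1) by (simp add: t_def)
qed

lemma nat_floor_bounds:
  fixes x :: real
  assumes "1 \<le> x" shows "1 \<le> nat \<lfloor>x\<rfloor>" "real (nat \<lfloor>x\<rfloor>) \<le> x" "x \<le> 2 * real (nat \<lfloor>x\<rfloor>)"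
proof -
  have "1 \<le> \<lfloor>x\<rfloor>" using assms by simp
  then have r: "real (nat \<lfloor>x\<rfloor>) = real_of_int \<lfloor>x\<rfloor>" by simp
  show "1 \<le> nat \<lfloor>x\<rfloor>" using \<open>1 \<le> \<lfloor>x\<rfloor>\<close> by linarith
  show "real (nat \<lfloor>x\<rfloor>) \<le> x" unfolding r by simp
  have "x < real_of_int \<lfloor>x\<rfloor> + 1" by simp
  moreover have "1 \<le> real_of_int \<lfloor>x\<rfloor>" using \<open>1 \<le> \<lfloor>x\<rfloor>\<close> by simp
  ultimately show "x \<le> 2 * real (nat \<lfloor>x\<rfloor>)" unfolding r by linarith
qed

text \<open>The summands \<open>real k * N\<close> and \<open>M\<close> of the bound are always
  reached by their own constructions (\<open>G2\<close>, \<open>G3\<close>). The grid is needed for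
  the mixed term only where it can be built, \<open>\<kappa> \<le> \<mu>^2\<close> and
  \<open>\<mu> \<le> \<kappa>^2\<close>; elsewhere the mixed term is dominated by one of the other
  two.\<close>

lemma max_red_incidences_lower_few_vertices:
  fixes c K w c1 c2 c3 :: real
  assumes d: "DIM('a::euclidean_space) = D + 2" and kmn: "1 \<le> k" "k \<le> n" "1 \<le> m"
    and c: "0 < c" "c * real n ^ D \<le> real m"
    and K: "K > 0" "real m \<le> K * (real k * real n ^ (D + 1))"
    and w: "w = 8 * real (D + 2)" and few: "real m < 1 / w ^ (D + 3) * real n ^ (D + 2)"
    and cs: "c1 = 1 / (128 * w ^ D)" "c2 = min c (1 / w ^ D) / 2" "c3 = min 1 (1 / (K * w ^ (D + 2)))"
  shows "1 / (1 / c1 + 2 / c2 + 3 / c3) * incidence_bound (D + 2) m k n \<le> real (max_red_incidences TYPE('a) m k n)"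
proof -
  define G M \<nu> N where "G = real (max_red_incidences TYPE('a) m k n)" and "M = real m" and "\<nu> = real n"
    and "N = real n ^ D"
  define Z where "Z = real m powr (2/3) * real k powr (2/3) * real n powr ((real (D + 2) - 2) / 3)"
  \<comment> \<open>The grid takes at most a quarter of the hyperplanes and \<open>k'\<close> about
    half, which leaves room; rounding down keeps \<open>q\<close> at least n / \<open>w\<close>,
    hence the 8 in \<open>w\<close>.\<close>
  define q where "q = n div (4 * (D + 2))"
  define k' where "k' = (k + 1) div 2"
  have w1: "w \<ge> 16" using w by simp
  have pos: "M \<ge> 1" "\<nu> \<ge> 1" "real k \<ge> 1" "real k \<le> \<nu>" "N \<ge> 1" using kmn by (simp_all add: M_def \<nu>_def N_def)
  \<comment> \<open>Small n is excluded by \<open>few\<close>: the upper bound on m would be at most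
    1.\<close>
  have n4: "4 * (D + 2) \<le> n"
  proof (rule ccontr)
    assume "\<not> ?thesis"
    then have "real n \<le> real (4 * (D + 2))" by (simp only: of_nat_le_iff)
    then have "\<nu> \<le> w" by (simp add: \<nu>_def w)
    then have "\<nu> ^ (D + 2) \<le> w ^ (D + 2)" using pos by (intro power_mono) auto
    also have "\<dots> \<le> w ^ (D + 3)" using w1 by (intro power_increasing) auto
    finally have "1 / w ^ (D + 3) * \<nu> ^ (D + 2) \<le> 1" using w1 by simp
    then show False using few pos(1) by (simp add: M_def \<nu>_def)
  qed
  have q1: "1 \<le> q" using n4 by (simp add: q_def less_eq_div_iff_mult_less_eq)
  have qn: "4 * (D + 2) * q \<le> n" by (simp add: q_def)
  have "n mod (4 * (D + 2)) < 4 * (D + 2)" by simp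
  then have "n < 4 * (D + 2) * q + 4 * (D + 2)"
    unfolding q_def using mult_div_mod_eq[of "4 * (D + 2)" n] by linarith
  also have "\<dots> \<le> 8 * (D + 2) * q" using mult_le_mono2[OF q1, of "4 * (D + 2)"] by (simp add: algebra_simps)
  finally have "real n \<le> real (8 * (D + 2) * q)" by (simp only: of_nat_le_iff less_imp_le)
  then have "\<nu> \<le> w * real q" by (simp add: \<nu>_def w)
  then have wq: "\<nu> / w \<le> real q" using w1 by (simp add: field_simps)
  have "q \<le> n" by (simp add: q_def)
  then have qn': "real q \<le> \<nu>" by (simp add: \<nu>_def)
  have k': "1 \<le> k'" "k' \<le> k" "k \<le> 2 * k'" using kmn(1) by (simp_all add: k'_def)
  have k'n: "k' + (D + 2) * q \<le> n"
  proof -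
    have "2 * k' \<le> n + 1" using kmn(2) by (simp add: k'_def)
    moreover have "8 \<le> n" using n4 by simp
    ultimately show ?thesis using qn by linarith
  qed
  have mq: "m \<le> q ^ (D + 2)"
  proof -
    have "1 / w ^ (D + 3) \<le> 1 / w ^ (D + 2)" using w1 by (intro divide_left_mono power_increasing) auto
    then have "1 / w ^ (D + 3) * \<nu> ^ (D + 2) \<le> 1 / w ^ (D + 2) * \<nu> ^ (D + 2)" using pos by (intro mult_right_mono) auto
    also have "\<dots> = (\<nu> / w) ^ (D + 2)" by (simp add: power_divide)
    also have "\<dots> \<le> real q ^ (D + 2)" using wq pos w1 by (intro power_mono) auto
    finally have "real m \<le> real (q ^ (D + 2))" using few by (simp add: \<nu>_def)
    then show ?thesis by (simp only: of_nat_le_iff)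
  qed
  have "card (Basis :: 'a set) \<ge> 2" using d by simp
  then obtain T where "T \<subseteq> (Basis :: 'a set)" "card T = 2" by (metis obtain_subset_with_card_n)
  then obtain e1 e2 :: 'a where e: "e1 \<in> Basis" "e2 \<in> Basis" "e1 \<noteq> e2" by (auto simp: card_2_iff)
  note ctx = e d k'(2) kmn(2) k'n q1 mq
  have qD: "N / w ^ D \<le> real q ^ D"
  proof -
    have "(\<nu> / w) ^ D \<le> real q ^ D" using wq pos w1 by (intro power_mono) auto
    then show ?thesis by (simp add: power_divide \<nu>_def N_def)
  qed
  have cpos: "c1 > 0" "c2 > 0" "c3 > 0" using w1 c K by (simp_all add: cs)
  have G2: "c2 * (real k * N) \<le> G"
  proof -
    \<comment> \<open>Here the hypothesis m = Omega(n^(d-2)) enters: it guarantees a positive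
      proportion of n^(d-2) points on the common flat. The 2 compensates for \<open>k'\<close> being
      only half of \<open>k\<close>.\<close>
    have "2 * c2 * N \<le> min M (real q ^ D)"
    proof (rule min.boundedI)
      have "2 * c2 * N \<le> c * N" using pos by (intro mult_right_mono) (auto simp: cs)
      then show "2 * c2 * N \<le> M" using c by (simp add: N_def M_def)
      have "2 * c2 * N \<le> 1 / w ^ D * N" using pos by (intro mult_right_mono) (auto simp: cs)
      then show "2 * c2 * N \<le> real q ^ D" using qD by simp
    qed
    then have "real k / 2 * (2 * c2 * N) \<le> real k' * min M (real q ^ D)"
      using k'(3) pos cpos by (intro mult_mono) auto
    also have "\<dots> = real (k' * min m (q ^ D))" by (simp add: M_def of_nat_min)
    also have "\<dots> \<le> G" unfolding G_def using max_red_incidences_ge_pencils[OF ctx] by (simp only: of_nat_le_iff)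
    finally show ?thesis by (simp add: mult_ac)
  qed
  have G3: "c3 * M \<le> G"
  proof -
    have "c3 * M \<le> min M (min (real k) (real q) * real q ^ (D + 1))"
    proof (rule min.boundedI)
      have "c3 * M \<le> 1 * M" using pos by (intro mult_right_mono) (auto simp: cs)
      then show "c3 * M \<le> M" by simp
      have "c3 * M \<le> 1 / (K * w ^ (D + 2)) * (K * (real k * \<nu> ^ (D + 1)))"
        using K pos cpos w1 by (intro mult_mono) (auto simp: cs M_def \<nu>_def)
      also have "\<dots> = (real k / w) * (\<nu> / w) ^ (D + 1)"
        using K w1 by (simp add: power_divide field_simps)
      also have "\<dots> \<le> min (real k) (real q) * real q ^ (D + 1)"
      proof (intro mult_mono power_mono wq min.boundedI)
        have "real k * 1 \<le> real k * w" using w1 by (intro mult_left_mono) auto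
        then show "real k / w \<le> real k" using w1 by (simp add: field_simps)
        have "real k / w \<le> \<nu> / w" using pos w1 by (intro divide_right_mono) auto
        then show "real k / w \<le> real q" using wq by simp
      qed (use pos w1 in auto)
      finally show "c3 * M \<le> min (real k) (real q) * real q ^ (D + 1)" .
    qed
    also have "\<dots> = real (min m (min k q * q ^ (D + 1)))" by (simp add: M_def of_nat_min)
    also have "\<dots> \<le> G" unfolding G_def using max_red_incidences_ge_parallel[OF ctx] by (simp only: of_nat_le_iff)
    finally show ?thesis .
  qed
  define \<kappa> \<mu> where "\<kappa> = real k'" and "\<mu> = M / N"
  have \<kappa>: "\<kappa> \<ge> 1" "\<kappa> \<le> real k" "real k \<le> 2 * \<kappa>" using k' by (simp_all add: \<kappa>_def)
  have \<mu>: "\<mu> > 0" "M = \<mu> * N" using pos by (simp_all add: \<mu>_def)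
  have "Z ^ 3 = M\<^sup>2 * (real k)\<^sup>2 * N"
    unfolding Z_def M_def N_def by (rule mixed_term_cube[OF kmn(3,1)]) (use kmn in simp)
  then have Z3: "Z ^ 3 = \<mu>\<^sup>2 * (real k)\<^sup>2 * N ^ 3"
    unfolding \<mu>(2) by (simp add: power2_eq_square power3_eq_cube)
  have ksq: "(real k)\<^sup>2 \<le> 4 * \<kappa>\<^sup>2"
    using power_mono[OF \<kappa>(3), of 2] by (simp add: power_mult_distrib)
  have G1: "Z \<le> 1 / c1 * G" if "\<kappa> \<le> \<mu>\<^sup>2" "\<mu> \<le> \<kappa>\<^sup>2"
  proof -
    \<comment> \<open>Ideal numbers of slopes and of columns, with \<open>\<alpha> * x\<close>
      intercepts. They solve \<open>\<alpha>^2 * x = \<kappa>\<close> (red hyperplanes) and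
      \<open>\<alpha> * x^2 = \<mu>\<close> (points per level); the incidences per level are then
      \<open>(\<alpha> * x)^2\<close>, the 2/3 power of \<open>\<mu> * \<kappa>\<close>. The two
      case conditions say that both are at least 1.\<close>
    define \<alpha> x where "\<alpha> = root 3 (\<kappa>\<^sup>2 / \<mu>)" and "x = root 3 (\<mu>\<^sup>2 / \<kappa>)"
    have \<alpha>1: "1 \<le> \<alpha>" and x1: "1 \<le> x"
      using that \<mu>(1) \<kappa>(1) by (simp_all add: \<alpha>_def x_def)
    have cubes: "\<alpha> ^ 3 = \<kappa>\<^sup>2 / \<mu>" "x ^ 3 = \<mu>\<^sup>2 / \<kappa>"
      by (simp_all add: \<alpha>_def x_def odd_real_root_pow)
    have e1': "\<alpha> * x\<^sup>2 = \<mu>"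
    proof (rule power_eq_imp_eq_base[of _ 3])
      have "(\<alpha> * x\<^sup>2) ^ 3 = \<alpha> ^ 3 * (x ^ 3)\<^sup>2" by (simp add: power_mult_distrib flip: power_mult)
      then show "(\<alpha> * x\<^sup>2) ^ 3 = \<mu> ^ 3"
        unfolding cubes using \<mu>(1) \<kappa>(1) by (simp add: power2_eq_square power3_eq_cube field_simps)
    qed (use \<alpha>1 x1 \<mu>(1) in auto)
    have e2': "\<alpha>\<^sup>2 * x = \<kappa>"
    proof (rule power_eq_imp_eq_base[of _ 3])
      have "(\<alpha>\<^sup>2 * x) ^ 3 = (\<alpha> ^ 3)\<^sup>2 * x ^ 3" by (simp add: power_mult_distrib flip: power_mult)
      then show "(\<alpha>\<^sup>2 * x) ^ 3 = \<kappa> ^ 3"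
        unfolding cubes using \<mu>(1) \<kappa>(1) by (simp add: power2_eq_square power3_eq_cube field_simps)
    qed (use \<alpha>1 x1 \<kappa>(1) in auto)
    have e3: "(\<alpha> * x) ^ 3 = \<mu> * \<kappa>"
      unfolding power_mult_distrib cubes using \<mu>(1) \<kappa>(1) by (simp add: power2_eq_square field_simps)
    define A X where "A = nat \<lfloor>\<alpha>\<rfloor>" and "X = nat \<lfloor>x\<rfloor>"
    note A = nat_floor_bounds[OF \<alpha>1, folded A_def] and X = nat_floor_bounds[OF x1, folded X_def]
    define X0 B where "X0 = (X + 1) div 2" and "B = (A * X + 1) div 2"
    have X0: "1 \<le> X0" "X0 \<le> X" "X \<le> 2 * X0" using X(1) by (simp_all add: X0_def)
    have AX1: "1 \<le> A * X" using A(1) X(1) by simp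
    then have B: "B \<le> A * X" "A * X \<le> 2 * B" by (simp_all add: B_def)
    have Y: "(A - 1) * (X0 - 1) + B \<le> A * X"
      unfolding X0_def B_def by (rule half_box_bound[OF A(1) X(1)])
    have AX: "real A * real X \<le> \<alpha> * x" using A(2) X(2) \<alpha>1 by (intro mult_mono) auto
    have "\<alpha> * x \<le> \<nu> / w"
    proof (rule le_of_cube_le)
      have "\<mu> * \<kappa> \<le> M / N * \<nu>" unfolding \<mu>_def using \<kappa>(2) pos by (intro mult_left_mono) auto
      also have "\<dots> \<le> (1 / w ^ (D + 3) * \<nu> ^ (D + 2)) / N * \<nu>"
        using few pos by (intro mult_right_mono divide_right_mono) (auto simp: M_def \<nu>_def)
      also have "\<dots> = 1 / w ^ (D + 3) * \<nu> ^ 3"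
        using pos by (simp add: N_def \<nu>_def power_add power2_eq_square power3_eq_cube)
      \<comment> \<open>The exponent \<open>D + 3\<close> in the threshold for m is at least 3 even
        in the plane, where \<open>D\<close> is 0.\<close>
      also have "\<dots> \<le> 1 / w ^ 3 * \<nu> ^ 3"
        using w1 pos by (intro mult_right_mono divide_left_mono power_increasing) auto
      finally show "(\<alpha> * x) ^ 3 \<le> (\<nu> / w) ^ 3" unfolding e3 by (simp add: power_divide)
    qed (use pos w1 in auto)
    then have "real (A * X) \<le> real q" using AX wq by simp
    then have AXq: "A * X \<le> q" by (simp only: of_nat_le_iff)
    have "X \<le> A * X" using A(1) by simp
    then have X0q: "X0 \<le> q" using X0(2) AXq by linarith
    have ABk: "A * B \<le> k'"
    proof -
      have "A * B \<le> A * (A * X)" using B(1) by (rule mult_le_mono2)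
      then have "real (A * B) \<le> real (A * (A * X))" by (simp only: of_nat_le_iff)
      also have "\<dots> = real A * (real A * real X)" by simp
      also have "\<dots> \<le> \<alpha> * (\<alpha> * x)" by (rule mult_mono) (use A(2) AX \<alpha>1 in auto)
      also have "\<dots> = real k'" using e2' by (simp add: power2_eq_square \<kappa>_def mult_ac)
      finally show ?thesis by (simp only: of_nat_le_iff)
    qed
    have Pm: "X0 * ((A - 1) * (X0 - 1) + B) * q ^ D \<le> m"
    proof -
      have "X0 * ((A - 1) * (X0 - 1) + B) \<le> X * (A * X)" using X0(2) Y by (rule mult_le_mono)
      then have "real (X0 * ((A - 1) * (X0 - 1) + B)) \<le> real (X * (A * X))" by (simp only: of_nat_le_iff)
      also have "\<dots> = real X * (real A * real X)" by simp
      also have "\<dots> \<le> x * (\<alpha> * x)" by (rule mult_mono) (use X(2) AX x1 in auto)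
      also have "\<dots> = \<mu>" using e1' by (simp add: power2_eq_square mult_ac)
      finally have "real (X0 * ((A - 1) * (X0 - 1) + B)) * real q ^ D \<le> \<mu> * \<nu> ^ D"
        using qn' \<mu>(1) pos by (intro mult_mono power_mono) auto
      also have "\<dots> = real m" using \<mu>(2) by (simp add: M_def N_def \<nu>_def)
      finally show ?thesis by (simp only: of_nat_le_iff of_nat_mult[symmetric] of_nat_power[symmetric])
    qed
    have "(A * X) * (X * A) \<le> (2 * B) * ((2 * X0) * A)" by (rule mult_le_mono[OF B(2) mult_le_mono1[OF X0(3)]])
    then have "real ((A * X) * (X * A)) \<le> real ((2 * B) * ((2 * X0) * A))" by (simp only: of_nat_le_iff)
    then have ABX: "(real A * real X)\<^sup>2 / 4 \<le> real (A * B * X0)" by (simp add: power2_eq_square mult_ac)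
    have "\<alpha> * x \<le> (2 * real A) * (2 * real X)" using A(3) X(3) \<alpha>1 x1 by (intro mult_mono) auto
    then have "(\<alpha> * x)\<^sup>2 \<le> (4 * (real A * real X))\<^sup>2" using \<alpha>1 x1 by (intro power_mono) auto
    then have "(\<alpha> * x)\<^sup>2 / 64 \<le> real (A * B * X0)" using ABX by (simp add: power_mult_distrib)
    then have "(\<alpha> * x)\<^sup>2 / 64 * (N / w ^ D) \<le> real (A * B * X0) * real q ^ D"
      using qD pos w1 by (intro mult_mono) auto
    also have "\<dots> = real (A * B * X0 * q ^ D)" by simp
    also have "\<dots> \<le> G" unfolding G_def
      using max_red_incidences_ge_grid[OF ctx A(1) ABk X0(1) X0q _ Pm] Y AXq by (simp only: of_nat_le_iff)
    finally have g: "(\<alpha> * x)\<^sup>2 / 64 * (N / w ^ D) \<le> G" .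
    have "Z \<le> 2 * ((\<alpha> * x)\<^sup>2 * N)"
    proof (rule le_of_cube_le)
      have "Z ^ 3 \<le> \<mu>\<^sup>2 * (4 * \<kappa>\<^sup>2) * N ^ 3" unfolding Z3 using ksq pos by (intro mult_right_mono mult_left_mono) auto
      also have "\<dots> = 4 * ((\<alpha> * x) ^ 3)\<^sup>2 * N ^ 3" unfolding e3 by (simp add: power_mult_distrib)
      also have "\<dots> \<le> 8 * ((\<alpha> * x) ^ 3)\<^sup>2 * N ^ 3" using pos by (intro mult_right_mono) auto
      also have "\<dots> = (2 * ((\<alpha> * x)\<^sup>2 * N)) ^ 3"
        by (simp add: power_mult_distrib power2_eq_square power3_eq_cube)
      finally show "Z ^ 3 \<le> (2 * ((\<alpha> * x)\<^sup>2 * N)) ^ 3" .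
    qed (use pos in auto)
    \<comment> \<open>The 128 in \<open>c1\<close> is 4 for the halving of columns and intercepts,
      16 for the roundings to \<open>A\<close> and \<open>X\<close>, and 2 for the passage from
      \<open>k\<close> to \<open>k'\<close>.\<close>
    also have "\<dots> = 1 / c1 * ((\<alpha> * x)\<^sup>2 / 64 * (N / w ^ D))" using w1 by (simp add: cs)
    also have "\<dots> \<le> 1 / c1 * G" using g cpos by (intro mult_left_mono) auto
    finally show ?thesis .
  qed
  have kN: "real k * N \<le> 1 / c2 * G" using G2 cpos by (simp add: field_simps)
  have M: "M \<le> 1 / c3 * G" using G3 cpos by (simp add: field_simps)
  have "G \<ge> 0" by (simp add: G_def)
  then have nn: "0 \<le> 1 / c1 * G" "0 \<le> 1 / c2 * G" "0 \<le> 1 / c3 * G" using cpos by simp_all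
  have "Z \<le> 1 / c1 * G \<or> Z \<le> real k * N \<or> Z \<le> 2 * M"
  proof -
    consider "\<kappa> \<le> \<mu>\<^sup>2" "\<mu> \<le> \<kappa>\<^sup>2" | "\<mu>\<^sup>2 < \<kappa>" | "\<kappa>\<^sup>2 < \<mu>" by linarith
    then show ?thesis
    proof cases
      case 1
      then show ?thesis using G1 by simp
    next
      case 2
      have "Z ^ 3 \<le> real k * (real k)\<^sup>2 * N ^ 3"
        unfolding Z3 using 2 \<kappa>(2) pos by (intro mult_right_mono) auto
      also have "\<dots> = (real k * N) ^ 3"
        unfolding power_mult_distrib cube_eq[of "real k"] by (rule refl)
      finally have "Z \<le> real k * N" by (rule le_of_cube_le) (use pos in auto)
      then show ?thesis by simp
    next
      case 3
      \<comment> \<open>The factor 4 is enlarged to 8 so that the right side becomes the cube of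
        \<open>2 * M\<close>.\<close>
      then have "(real k)\<^sup>2 \<le> 8 * \<mu>" using ksq \<mu>(1) by linarith
      then have "Z ^ 3 \<le> \<mu>\<^sup>2 * (8 * \<mu>) * N ^ 3"
        unfolding Z3 using pos by (intro mult_right_mono mult_left_mono) auto
      also have "\<mu>\<^sup>2 * (8 * \<mu>) * N ^ 3 = 8 * M ^ 3"
        unfolding \<mu>(2) power_mult_distrib cube_eq[of \<mu>] by simp
      also have "\<dots> = (2 * M) ^ 3" by (simp add: power_mult_distrib)
      finally have "Z \<le> 2 * M" by (rule le_of_cube_le) (use pos in auto)
      then show ?thesis by simp
    qed
  qed
  \<comment> \<open>In the worst of the three cases the mixed term costs one more
    \<open>real k * N\<close> or two more \<open>M\<close>, which explains the coefficients 1, 2 and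
    3.\<close>
  then have "Z + real k * N + M \<le> 1 / c1 * G + 2 * (1 / c2 * G) + 3 * (1 / c3 * G)"
    using kN M nn by (elim disjE) linarith+
  also have "\<dots> = (1 / c1 + 2 / c2 + 3 / c3) * G" by (simp add: algebra_simps)
  finally have "incidence_bound (D + 2) m k n \<le> (1 / c1 + 2 / c2 + 3 / c3) * G"
    by (simp add: incidence_bound_def Z_def N_def M_def)
  moreover have "1 / c1 + 2 / c2 + 3 / c3 > 0" using cpos by (intro add_pos_pos) auto
  ultimately show ?thesis by (simp add: G_def field_simps)
qed

theorem max_red_incidences_lower_bound:
  fixes c K :: real
  assumes d: "DIM('a::euclidean_space) = D + 2" and "c > 0" "K > 0"
  shows "\<exists>C>0. \<forall>m k n. 1 \<le> k \<and> k \<le> n \<and> 1 \<le> m \<and> real m \<ge> c * real n ^ D \<and>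
            red_incidence_counts TYPE('a) m k n \<noteq> {} \<and> real m \<le> K * (real k * real n ^ (D + 1)) \<longrightarrow>
            real (max_red_incidences TYPE('a) m k n) \<ge> C * incidence_bound (D + 2) m k n"
proof -
  define w where "w = 8 * real (D + 2)"
  \<comment> \<open>The threshold, as a multiple of n^d, between recolouring and the grid
    constructions.\<close>
  define \<epsilon> where "\<epsilon> = 1 / w ^ (D + 3)"
  define c1 c2 c3 where "c1 = 1 / (128 * w ^ D)" and "c2 = min c (1 / w ^ D) / 2" and "c3 = min 1 (1 / (K * w ^ (D + 2)))"
  define C1 C2 where "C1 = \<epsilon>\<^sup>2 / (3 * K)" and "C2 = 1 / (1 / c1 + 2 / c2 + 3 / c3)"
  have w: "w \<ge> 1" by (simp add: w_def)
  then have "1 \<le> w ^ (D + 3)" by (rule one_le_power)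
  then have \<epsilon>: "0 < \<epsilon>" "\<epsilon> \<le> 1" by (simp_all add: \<epsilon>_def)
  have "c1 > 0" "c2 > 0" "c3 > 0" using w assms(2,3) by (simp_all add: c1_def c2_def c3_def)
  then have "1 / c1 + 2 / c2 + 3 / c3 > 0" by (intro add_pos_pos) auto
  then have C: "C1 > 0" "C2 > 0" using \<epsilon> assms(3) by (simp_all add: C1_def C2_def)
  show ?thesis
  proof (rule exI[of _ "min C1 C2"], intro conjI allI impI)
    show "min C1 C2 > 0" using C by simp
    fix m k n :: nat
    assume H: "1 \<le> k \<and> k \<le> n \<and> 1 \<le> m \<and> real m \<ge> c * real n ^ D \<and>
      red_incidence_counts TYPE('a) m k n \<noteq> {} \<and> real m \<le> K * (real k * real n ^ (D + 1))"
    have b: "0 \<le> incidence_bound (D + 2) m k n" using incidence_bound_pos[of m] H by (simp add: less_imp_le)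
    show "min C1 C2 * incidence_bound (D + 2) m k n \<le> real (max_red_incidences TYPE('a) m k n)"
    proof (cases "\<epsilon> * real n ^ (D + 2) \<le> real m")
      case True
      have "min C1 C2 * incidence_bound (D + 2) m k n \<le> C1 * incidence_bound (D + 2) m k n"
        using b by (intro mult_right_mono) auto
      also have "\<dots> \<le> real (max_red_incidences TYPE('a) m k n)"
        unfolding C1_def by (rule max_red_incidences_lower_many_vertices[OF d]) (use H \<epsilon> True assms(3) in auto)
      finally show ?thesis .
    next
      case False
      have "min C1 C2 * incidence_bound (D + 2) m k n \<le> C2 * incidence_bound (D + 2) m k n"
        using b by (intro mult_right_mono) auto
      also have "\<dots> \<le> real (max_red_incidences TYPE('a) m k n)"
        unfolding C2_def
        by (rule max_red_incidences_lower_few_vertices[OF d _ _ _ assms(2) _ assms(3) _ w_def _ c1_def c2_def c3_def])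
           (use H False in \<open>auto simp: \<epsilon>_def\<close>)
      finally show ?thesis .
    qed
  qed
qed

theorem max_red_incidences_upper_bound:
  assumes d: "DIM('a::euclidean_space) = D + 2"
  shows "\<exists>C>0. \<forall>m k n. 1 \<le> k \<and> k \<le> n \<and> 1 \<le> m \<and> red_incidence_counts TYPE('a) m k n \<noteq> {} \<longrightarrow>
    real (max_red_incidences TYPE('a) m k n) \<le> C * incidence_bound (D + 2) m k n"
proof (rule exI[of _ "16000000 ^ D * (4 * 2 ^ D)"], intro conjI allI impI)
  fix m k n :: nat
  assume H: "1 \<le> k \<and> k \<le> n \<and> 1 \<le> m \<and> red_incidence_counts TYPE('a) m k n \<noteq> {}"
  then obtain \<R> \<B> :: "'a set set" and P where c: "bichromatic_configuration m k n \<R> \<B> P"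
    "max_red_incidences TYPE('a) m k n = card (incidences P \<R>)"
    using max_red_incidences_attained[of m k n, where 'a = 'a] by metis
  show "real (max_red_incidences TYPE('a) m k n) \<le> 16000000 ^ D * (4 * 2 ^ D) * incidence_bound (D + 2) m k n"
    unfolding c(2) by (rule incidences_upper_bound[OF c(1) d]) (use H in auto)
qed simp

theorem theorem2:
  fixes c :: real
  assumes "DIM('a::euclidean_space) \<ge> 2" and "c > 0"
  shows "(\<exists>C>0. \<forall>m k n :: nat.
            1 \<le> k \<and> k \<le> n \<and> 1 \<le> m \<and> real m \<ge> c * real n ^ (DIM('a) - 2) \<and>
            red_incidence_counts TYPE('a) m k n \<noteq> {} \<longrightarrow>
            real (max_red_incidences TYPE('a) m k n) \<le> C * incidence_bound DIM('a) m k n)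
       \<and> (\<forall>K>0. \<exists>C>0. \<forall>m k n :: nat.
            1 \<le> k \<and> k \<le> n \<and> 1 \<le> m \<and> real m \<ge> c * real n ^ (DIM('a) - 2) \<and>
            red_incidence_counts TYPE('a) m k n \<noteq> {} \<and>
            real m \<le> K * (real k * real n ^ (DIM('a) - 1)) \<longrightarrow>
            real (max_red_incidences TYPE('a) m k n) \<ge> C * incidence_bound DIM('a) m k n)"
proof -
  obtain D where d: "DIM('a) = D + 2" using assms(1) by (metis le_add_diff_inverse2)
  have D: "DIM('a) - 2 = D" "DIM('a) - 1 = D + 1" using d by simp_all
  show ?thesis
    \<comment> \<open>The order matters: the differences with the dimension are replaced by
      \<open>D\<close> and \<open>D + 1\<close> before the dimension itself is rewritten.\<close>
    unfolding D unfolding d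
  proof (intro conjI allI impI)
    show "\<exists>C>0. \<forall>m k n. 1 \<le> k \<and> k \<le> n \<and> 1 \<le> m \<and> real m \<ge> c * real n ^ D \<and>
        red_incidence_counts TYPE('a) m k n \<noteq> {} \<longrightarrow>
        real (max_red_incidences TYPE('a) m k n) \<le> C * incidence_bound (D + 2) m k n"
      using max_red_incidences_upper_bound[OF d] by meson
    fix K :: real assume "K > 0"
    then show "\<exists>C>0. \<forall>m k n. 1 \<le> k \<and> k \<le> n \<and> 1 \<le> m \<and> real m \<ge> c * real n ^ D \<and>
        red_incidence_counts TYPE('a) m k n \<noteq> {} \<and> real m \<le> K * (real k * real n ^ (D + 1)) \<longrightarrow>
        real (max_red_incidences TYPE('a) m k n) \<ge> C * incidence_bound (D + 2) m k n"
      by (rule max_red_incidences_lower_bound[OF d assms(2)])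
  qed
qed

end
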